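(* Let $Y$ and $Z$ be topological vector spaces. If $Y$ is complete and metrizable, then $\mathrm{Ext}_{\mathrm{TVS}}(Z,Y)\cong\mathrm{Ext}_{\mathrm{TVS}}(\varrho Z,Y)$ (isomorphism of abelian groups), where $\varrho Z$ denotes the completion of $Z$.
   Context: All topological vector spaces are Hausdorff and over $\mathbb{R}$. $\varrho Z$ denotes the completion of $Z$. An extension of topological vector spaces is a short exact sequence $E:0\to Y\stackrel{\imath}{\to}X\stackrel{\pi}{\to}Z\to 0$ of topological vector spaces in which $\imath,\pi$ are continuous linear maps that are open onto their images. Two extensions $0\to Y\stackrel{\imath}{\to}X\stackrel{\pi}{\to}Z\to 0$ and $0\to Y\stackrel{\imath'}{\to}X'\stackrel{\pi'}{\to}Z\to 0$ are equivalent if there is a continuous linear map $T:X\to X'$ with $T\circ\imath=\imath'$ and $\pi'\circ T=\pi$. $\mathrm{Ext}_{\mathrm{TVS}}(Z,Y)$ is the set of equivalence classes of such extensions. It is an abelian group under the Baer sum: $[E_1]+[E_2]$ is the class of the extension obtained from the product extension $0\to Y\times Y\to X_1\times X_2\to Z\times Z\to 0$ by pulling back along the diagonal $Z\to Z\times Z$ and then pushing out along the addition map $Y\times Y\to Y$ (pull-backs and push-outs taken in topological vector spaces). The zero element is the class of the trivial extension $0\to Y\to Y\times Z\to Z\to 0$. *)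

theory Defs
  imports "HOL-Analysis.Analysis" "HOL-Algebra.Module" "HOL-Algebra.AbelCoset"
begin
section \<open>Topological vector spaces with explicit carriers\<close>

text \<open>
  Real vector spaces are modules, in the sense of HOL-Algebra, over the field of reals. The record
  type of modules extends that of rings, so it has two fields, \<open>mult\<close> and \<open>one\<close>, that
  play no role here and are left unspecified.
\<close>

definition real_ring :: "real ring" where
  "real_ring = \<lparr>carrier = UNIV, monoid.mult = (*), one = 1, zero = 0, add = (+)\<rparr>"

record 'a tvs = "(real, 'a) module" +
  topo :: "'a topology"

definition is_tvs :: "'a tvs \<Rightarrow> bool" where
  "is_tvs V \<longleftrightarrow>
     module real_ring V \<and>
     topspace (topo V) = carrier V \<and>
     Hausdorff_space (topo V) \<and>
     continuous_map (prod_topology (topo V) (topo V)) (topo V) (\<lambda>(x, y). x \<oplus>\<^bsub>V\<^esub> y) \<and>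
     continuous_map (prod_topology euclideanreal (topo V)) (topo V) (\<lambda>(r, x). r \<odot>\<^bsub>V\<^esub> x)"

definition tvs_linear :: "'a tvs \<Rightarrow> 'b tvs \<Rightarrow> ('a \<Rightarrow> 'b) \<Rightarrow> bool" where
  "tvs_linear V W f \<longleftrightarrow>
     f \<in> carrier V \<rightarrow> carrier W \<and>
     (\<forall>x\<in>carrier V. \<forall>y\<in>carrier V. f (x \<oplus>\<^bsub>V\<^esub> y) = f x \<oplus>\<^bsub>W\<^esub> f y) \<and>
     (\<forall>r. \<forall>x\<in>carrier V. f (r \<odot>\<^bsub>V\<^esub> x) = r \<odot>\<^bsub>W\<^esub> f x)"

definition continuous_linear :: "'a tvs \<Rightarrow> 'b tvs \<Rightarrow> ('a \<Rightarrow> 'b) \<Rightarrow> bool" where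
  "continuous_linear V W f \<longleftrightarrow> tvs_linear V W f \<and> continuous_map (topo V) (topo W) f"

definition open_onto_image :: "'a tvs \<Rightarrow> 'b tvs \<Rightarrow> ('a \<Rightarrow> 'b) \<Rightarrow> bool" where
  "open_onto_image V W f \<longleftrightarrow>
     open_map (topo V) (subtopology (topo W) (f ` carrier V)) f"

subsection \<open>Completeness and completions\<close>

text \<open>Completeness refers to the canonical uniformity of the additive group.\<close>

definition tvs_Cauchy_filter :: "'a tvs \<Rightarrow> 'a filter \<Rightarrow> bool" where
  "tvs_Cauchy_filter V F \<longleftrightarrow>
     F \<noteq> bot \<and> (\<forall>\<^sub>F x in F. x \<in> carrier V) \<and>
     (\<forall>U. openin (topo V) U \<and> \<zero>\<^bsub>V\<^esub> \<in> U \<longrightarrow>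
        (\<forall>\<^sub>F (x, y) in F \<times>\<^sub>F F. x \<ominus>\<^bsub>V\<^esub> y \<in> U))"

definition tvs_complete :: "'a tvs \<Rightarrow> bool" where
  "tvs_complete V \<longleftrightarrow>
     (\<forall>F. tvs_Cauchy_filter V F \<longrightarrow> (\<exists>l. limitin (topo V) (\<lambda>x. x) l F))"

text \<open>
  A completion of \<open>Z\<close> is a complete (Hausdorff) space \<open>W\<close> in which \<open>Z\<close> is embedded by \<open>j\<close> as a
  dense topological vector subspace; it is unique up to isomorphism under \<open>Z\<close>.
\<close>

definition is_completion :: "'z tvs \<Rightarrow> 'w tvs \<Rightarrow> ('z \<Rightarrow> 'w) \<Rightarrow> bool" where
  "is_completion Z W j \<longleftrightarrow>
     is_tvs W \<and> tvs_complete W \<and> tvs_linear Z W j \<and>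
     embedding_map (topo Z) (topo W) j \<and>
     topo W closure_of (j ` carrier Z) = carrier W"

subsection \<open>Products, subspaces, quotients\<close>

definition prod_tvs :: "'a tvs \<Rightarrow> 'b tvs \<Rightarrow> ('a \<times> 'b) tvs" where
  "prod_tvs V W = \<lparr>carrier = carrier V \<times> carrier W,
     monoid.mult = undefined, one = undefined,
     zero = (\<zero>\<^bsub>V\<^esub>, \<zero>\<^bsub>W\<^esub>),
     add = (\<lambda>(x, y) (x', y'). (x \<oplus>\<^bsub>V\<^esub> x', y \<oplus>\<^bsub>W\<^esub> y')),
     smult = (\<lambda>r (x, y). (r \<odot>\<^bsub>V\<^esub> x, r \<odot>\<^bsub>W\<^esub> y)),
     topo = prod_topology (topo V) (topo W)\<rparr>"

definition sub_tvs :: "'a tvs \<Rightarrow> 'a set \<Rightarrow> 'a tvs" where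
  "sub_tvs V S = V\<lparr>carrier := S, topo := subtopology (topo V) S\<rparr>"

definition quotient_topology :: "'a topology \<Rightarrow> ('a \<Rightarrow> 'b) \<Rightarrow> 'b topology" where
  "quotient_topology T p = topology (\<lambda>U. U \<subseteq> p ` topspace T \<and>
     openin T {x \<in> topspace T. p x \<in> U})"

lemma openin_quotient_topology:
  "openin (quotient_topology T p) U \<longleftrightarrow>
     U \<subseteq> p ` topspace T \<and> openin T {x \<in> topspace T. p x \<in> U}"
proof -
  have "istopology (\<lambda>U. U \<subseteq> p ` topspace T \<and> openin T {x \<in> topspace T. p x \<in> U})"
    unfolding istopology_def
  proof (intro conjI allI impI)
    fix S S' assume "S \<subseteq> p ` topspace T \<and> openin T {x \<in> topspace T. p x \<in> S}"
      and "S' \<subseteq> p ` topspace T \<and> openin T {x \<in> topspace T. p x \<in> S'}"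
    moreover have "{x \<in> topspace T. p x \<in> S \<inter> S'} =
        {x \<in> topspace T. p x \<in> S} \<inter> {x \<in> topspace T. p x \<in> S'}" by auto
    ultimately show "S \<inter> S' \<subseteq> p ` topspace T"
      and "openin T {x \<in> topspace T. p x \<in> S \<inter> S'}" by (auto intro: openin_Int)
  next
    fix K assume "\<forall>S\<in>K. S \<subseteq> p ` topspace T \<and> openin T {x \<in> topspace T. p x \<in> S}"
    moreover have "{x \<in> topspace T. p x \<in> \<Union>K} = (\<Union>S\<in>K. {x \<in> topspace T. p x \<in> S})" by auto
    ultimately show "\<Union>K \<subseteq> p ` topspace T" and "openin T {x \<in> topspace T. p x \<in> \<Union>K}"
      by auto
  qed
  then show ?thesis unfolding quotient_topology_def by (simp add: topology_inverse')
qed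

lemma quotient_map_quotient_topology: "quotient_map T (quotient_topology T p) p"
proof -
  have "openin (quotient_topology T p) (p ` topspace T)"
    by (simp add: openin_quotient_topology) (metis (mono_tags, lifting) Collect_cong Collect_mem_eq imageI openin_topspace)
  then have "topspace (quotient_topology T p) = p ` topspace T"
    by (meson openin_quotient_topology openin_subset openin_topspace subset_antisym)
  then show ?thesis by (auto simp: quotient_map_def openin_quotient_topology)
qed

text \<open>
  The scalar multiple of a coset \<open>C\<close> is \<open>r C + N\<close>, which is also correct for \<open>r = 0\<close>.
\<close>

definition quotient_tvs :: "'a tvs \<Rightarrow> 'a set \<Rightarrow> 'a set tvs" where
  "quotient_tvs V N = \<lparr>carrier = a_rcosets\<^bsub>V\<^esub> N,
     monoid.mult = undefined, one = undefined,
     zero = N,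
     add = (\<lambda>C D. C <+>\<^bsub>V\<^esub> D),
     smult = (\<lambda>r C. N <+>\<^bsub>V\<^esub> ((\<lambda>x. r \<odot>\<^bsub>V\<^esub> x) ` C)),
     topo = quotient_topology (topo V) (\<lambda>x. N +>\<^bsub>V\<^esub> x)\<rparr>"

section \<open>Extensions\<close>

record ('y, 'x, 'z) extension =
  middle :: "'x tvs"
  incl :: "'y \<Rightarrow> 'x"
  proj :: "'x \<Rightarrow> 'z"

definition is_extension :: "'z tvs \<Rightarrow> 'y tvs \<Rightarrow> ('y, 'x, 'z) extension \<Rightarrow> bool" where
  "is_extension Z Y E \<longleftrightarrow>
     is_tvs (middle E) \<and>
     continuous_linear Y (middle E) (incl E) \<and> open_onto_image Y (middle E) (incl E) \<and>
     continuous_linear (middle E) Z (proj E) \<and> open_onto_image (middle E) Z (proj E) \<and>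
     inj_on (incl E) (carrier Y) \<and>
     incl E ` carrier Y = {x \<in> carrier (middle E). proj E x = \<zero>\<^bsub>Z\<^esub>} \<and>
     proj E ` carrier (middle E) = carrier Z"

definition ext_equiv ::
  "'z tvs \<Rightarrow> 'y tvs \<Rightarrow> ('y, 'x, 'z) extension \<Rightarrow> ('y, 'u, 'z) extension \<Rightarrow> bool" where
  "ext_equiv Z Y E E' \<longleftrightarrow> (\<exists>T.
     continuous_linear (middle E) (middle E') T \<and>
     (\<forall>y\<in>carrier Y. T (incl E y) = incl E' y) \<and>
     (\<forall>x\<in>carrier (middle E). proj E' (T x) = proj E x))"

definition trivial_ext :: "'z tvs \<Rightarrow> 'y tvs \<Rightarrow> ('y, 'y \<times> 'z, 'z) extension" where
  "trivial_ext Z Y = \<lparr>middle = prod_tvs Y Z, incl = (\<lambda>y. (y, \<zero>\<^bsub>Z\<^esub>)), proj = snd\<rparr>"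

definition prod_ext ::
  "('y, 'x, 'z) extension \<Rightarrow> ('v, 'u, 'w) extension \<Rightarrow> ('y \<times> 'v, 'x \<times> 'u, 'z \<times> 'w) extension"
  where
  "prod_ext E E' = \<lparr>middle = prod_tvs (middle E) (middle E'),
     incl = map_prod (incl E) (incl E'), proj = map_prod (proj E) (proj E')\<rparr>"

text \<open>The pull-back of an extension of \<open>Z\<close> along \<open>f\<close> from \<open>Z'\<close> to \<open>Z\<close>.\<close>

definition pullback_ext ::
  "'w tvs \<Rightarrow> ('w \<Rightarrow> 'z) \<Rightarrow> ('y, 'x, 'z) extension \<Rightarrow> ('y, 'x \<times> 'w, 'w) extension" where
  "pullback_ext Z' f E = \<lparr>
     middle = sub_tvs (prod_tvs (middle E) Z')
       {(x, w). x \<in> carrier (middle E) \<and> w \<in> carrier Z' \<and> proj E x = f w},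
     incl = (\<lambda>y. (incl E y, \<zero>\<^bsub>Z'\<^esub>)), proj = snd\<rparr>"

text \<open>
  The push-out of an extension by \<open>Y\<close> along \<open>g\<close> from \<open>Y\<close> to \<open>Y'\<close>, with middle space
  \<open>(Y' \<times> X) / N\<close>. The map \<open>(v, x) \<mapsto> proj E x\<close> is constant on each coset of \<open>N\<close>, so
  \<open>the_elem\<close> picks its value there. The subspace \<open>N\<close> is closed, so that this quotient is Hausdorff
  and is the push-out in the category of Hausdorff spaces.
\<close>

definition pushout_ext ::
  "'y tvs \<Rightarrow> 'v tvs \<Rightarrow> ('y \<Rightarrow> 'v) \<Rightarrow> ('y, 'x, 'z) extension \<Rightarrow> ('v, ('v \<times> 'x) set, 'z) extension"
  where
  "pushout_ext Y Y' g E =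
     (let P = prod_tvs Y' (middle E);
          N = (\<lambda>y. (g y, \<ominus>\<^bsub>middle E\<^esub> incl E y)) ` carrier Y
      in \<lparr>middle = quotient_tvs P N,
          incl = (\<lambda>v. N +>\<^bsub>P\<^esub> (v, \<zero>\<^bsub>middle E\<^esub>)),
          proj = (\<lambda>C. the_elem ((\<lambda>(v, x). proj E x) ` C))\<rparr>)"

definition baer_ext ::
  "'z tvs \<Rightarrow> 'y tvs \<Rightarrow> ('y, 'x, 'z) extension \<Rightarrow> ('y, 'u, 'z) extension \<Rightarrow>
     ('y, ('y \<times> ('x \<times> 'u) \<times> 'z) set, 'z) extension" where
  "baer_ext Z Y E E' =
     pushout_ext (prod_tvs Y Y) Y (\<lambda>(y, y'). y \<oplus>\<^bsub>Y\<^esub> y')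
       (pullback_ext Z (\<lambda>z. (z, z)) (prod_ext E E'))"

section \<open>The group Ext\<close>

text \<open>
  The class of all extensions is cut down to a set by taking middle spaces on subsets of the type
  \<open>'y \<times> 'z\<close>. This loses no equivalence class: the middle space of any extension, on whatever type,
  is in bijection with \<open>carrier Y \<times> carrier Z\<close> (choose a section of the projection), and its
  structure can be transported along this bijection. Accordingly the Baer sum of two classes
  consists of those extensions in this set that are equivalent to a Baer sum of representatives,
  whose middle space lives on another type.
\<close>

definition extensions :: "'z tvs \<Rightarrow> 'y tvs \<Rightarrow> ('y, 'y \<times> 'z, 'z) extension set" where
  "extensions Z Y = {E. is_extension Z Y E}"

definition ext_rel :: "'z tvs \<Rightarrow> 'y tvs \<Rightarrow> ('y, 'y \<times> 'z, 'z) extension rel" where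
  "ext_rel Z Y = {(E, E'). E \<in> extensions Z Y \<and> E' \<in> extensions Z Y \<and> ext_equiv Z Y E E'}"

definition Ext_TVS :: "'z tvs \<Rightarrow> 'y tvs \<Rightarrow> ('y, 'y \<times> 'z, 'z) extension set monoid" where
  "Ext_TVS Z Y = \<lparr>carrier = extensions Z Y // ext_rel Z Y,
     monoid.mult = (\<lambda>C C'. {E \<in> extensions Z Y.
       \<exists>E1\<in>C. \<exists>E2\<in>C'. ext_equiv Z Y (baer_ext Z Y E1 E2) E}),
     one = ext_rel Z Y `` {trivial_ext Z Y}\<rparr>"

end

theory Submission
  imports Defs
begin

text \<open>
  Let \<open>j\<close> embed \<open>Z\<close> densely in its completion \<open>W\<close>. An extension \<open>E'\<close> of \<open>Z\<close> is a \<^emph>\<open>restriction\<close> of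
  an extension \<open>E\<close> of \<open>W\<close> if there is a continuous linear map of the middle spaces that lies over
  \<open>j\<close> and is the identity on \<open>Y\<close>; this says that \<open>E'\<close> is the pull-back of \<open>E\<close> along \<open>j\<close>.
  The isomorphism sends the class of \<open>E'\<close> to the class of the extensions of which \<open>E'\<close> is a
  restriction. Five facts make it one.

  \<^item> A map between extensions that is the identity on \<open>Y\<close> and an embedding on the quotients is
    itself an embedding (\<open>R_embedding\<close>). Hence equivalence of extensions is symmetric and any two
    restrictions of \<open>E\<close> are equivalent (\<open>restrictions_equivalent\<close>).

  \<^item> Every extension of \<open>W\<close> has a restriction, namely the pull-back along \<open>j\<close>, moved to the type
    \<open>'y \<times> 'z\<close> (\<open>pullback_extension\<close>, \<open>transport\<close>).

  \<^item> The middle space of an extension of a complete space by a complete space is complete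
    (\<open>complete_middle\<close>), and the middle space of a restriction is dense in that of the extension.
    So maps defined on the restriction extend by continuity (\<open>extend_from_dense\<close>), and two
    extensions with a common restriction are equivalent (\<open>restriction_injective\<close>).

  \<^item> Every extension \<open>E'\<close> of \<open>Z\<close> is a restriction (\<open>extends_to_dense_superspace\<close>). This is where
    \<open>Y\<close> has to be metrizable. Choose neighbourhoods \<open>A n\<close> of zero in the middle space \<open>X\<close> with
    \<open>A (n + 1) + A (n + 1) \<subseteq> A n\<close> whose traces on \<open>Y\<close> form a neighbourhood base, and
    neighbourhoods \<open>H n\<close> of zero in \<open>W\<close> that meet \<open>Z\<close> inside the image of \<open>A n\<close>. The new middle
    space consists of the pairs of a sequence in \<open>X\<close> that is Cauchy for the \<open>A n\<close> and a point of
    \<open>W\<close> to which its image in \<open>Z\<close> converges for the \<open>H n\<close>, modulo pairs that tend to zero.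
    A countable system of neighbourhoods is what allows points of \<open>W\<close> to be lifted to Cauchy
    sequences, one step at a time; completeness of \<open>Y\<close> ensures that the kernel of
    the new projection is \<open>Y\<close> and no larger. A single such system suffices because the
    topology of \<open>X\<close> is the coarsest one finer than that of the \<open>A n\<close> and that of \<open>Z\<close>.

  \<^item> An extension \<open>E\<close> represents the Baer sum of \<open>E1\<close> and \<open>E2\<close> exactly if there is a continuous
    linear map from the fibre product of their middle spaces to that of \<open>E\<close> which adds the two
    copies of \<open>Y\<close> and respects the projections (\<open>ext_equiv_baer_iff\<close>). The fibre product of two
    restrictions is dense in that of the extensions, so such maps can be restricted and
    extended, which gives the homomorphism property.

  Vector topologies are handled throughout by neighbourhoods of zero. This turns continuity and
  openness of linear maps into statements about sets, and it allows spaces to be described by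
  neighbourhood bases.
\<close>

section \<open>Vector spaces on explicit carriers and neighbourhoods of zero\<close>

text \<open>The module laws with the carrier of the scalars, which is everything, simplified away.\<close>

locale real_module =
  fixes V :: "'a tvs" (structure)
  assumes module: "module real_ring V"
begin

sublocale abelian_group V
  using module by (simp add: module_def)

lemma smult_closed [simp, intro]: "x \<in> carrier V \<Longrightarrow> r \<odot> x \<in> carrier V"
  using module.smult_closed[OF module] by (simp add: real_ring_def)

lemma smult_add_right:
  "x \<in> carrier V \<Longrightarrow> y \<in> carrier V \<Longrightarrow> r \<odot> (x \<oplus> y) = r \<odot> x \<oplus> r \<odot> y"
  using module.smult_r_distr[OF module] by (simp add: real_ring_def)

lemma smult_add_left: "x \<in> carrier V \<Longrightarrow> (r + s) \<odot> x = r \<odot> x \<oplus> s \<odot> x"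
  using module.smult_l_distr[OF module] by (simp add: real_ring_def)

lemma smult_smult: "x \<in> carrier V \<Longrightarrow> r \<odot> (s \<odot> x) = (r * s) \<odot> x"
  using module.smult_assoc1[OF module] by (simp add: real_ring_def)

lemma smult_one [simp]: "x \<in> carrier V \<Longrightarrow> 1 \<odot> x = x"
  using module.smult_one[OF module] by (simp add: real_ring_def)

lemma smult_zero_left [simp]: "x \<in> carrier V \<Longrightarrow> 0 \<odot> x = \<zero>"
  using module.smult_l_null[OF module] by (simp add: real_ring_def)

lemma smult_zero_right [simp]: "r \<odot> \<zero> = \<zero>"
  using module.smult_r_null[OF module] by (simp add: real_ring_def)

lemma minus_one_smult:
  assumes "x \<in> carrier V" shows "(-1) \<odot> x = \<ominus> x"
proof -
  have "(-1) \<odot> x \<oplus> x = \<zero>"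
    using smult_add_left[OF assms, of "-1" 1] assms by simp
  then show ?thesis using assms by (simp add: minus_equality[symmetric])
qed

lemma minus_smult:
  assumes "x \<in> carrier V" shows "(- r) \<odot> x = \<ominus> (r \<odot> x)"
  using smult_smult[OF assms, of "-1" r] minus_one_smult[of "r \<odot> x"] assms by simp

lemma smult_minus:
  assumes "x \<in> carrier V" shows "r \<odot> (\<ominus> x) = \<ominus> (r \<odot> x)"
  using smult_smult[OF assms, of r "-1"] minus_smult[of x r] minus_one_smult[of x] assms by simp

lemma smult_diff:
  assumes "x \<in> carrier V" "y \<in> carrier V" shows "r \<odot> (x \<ominus> y) = r \<odot> x \<ominus> r \<odot> y"
  using assms by (simp add: a_minus_def smult_add_right smult_minus)

lemma diff_self [simp]: "x \<in> carrier V \<Longrightarrow> x \<ominus> x = \<zero>"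
  by (simp add: a_minus_def r_neg)

lemma diff_zero [simp]: "x \<in> carrier V \<Longrightarrow> x \<ominus> \<zero> = x"
  by (simp add: a_minus_def)

lemma add_diff_cancel [simp]:
  "x \<in> carrier V \<Longrightarrow> y \<in> carrier V \<Longrightarrow> y \<oplus> (x \<ominus> y) = x"
  by (simp add: a_minus_def a_lcomm r_neg)

lemma diff_add_cancel [simp]:
  "x \<in> carrier V \<Longrightarrow> y \<in> carrier V \<Longrightarrow> (x \<ominus> y) \<oplus> y = x"
  by (simp add: a_minus_def a_assoc l_neg)

lemma add_diff_cancel_left [simp]:
  "x \<in> carrier V \<Longrightarrow> y \<in> carrier V \<Longrightarrow> (x \<oplus> y) \<ominus> x = y"
  by (simp add: a_minus_def a_assoc a_lcomm[of x y "\<ominus> x"] r_neg)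

lemma add_diff_cancel_right [simp]:
  "x \<in> carrier V \<Longrightarrow> y \<in> carrier V \<Longrightarrow> (x \<oplus> y) \<ominus> y = x"
  by (simp add: a_minus_def a_assoc r_neg)

lemma diff_add_diff:
  "x \<in> carrier V \<Longrightarrow> y \<in> carrier V \<Longrightarrow> z \<in> carrier V \<Longrightarrow> (x \<ominus> y) \<oplus> (y \<ominus> z) = x \<ominus> z"
  by (simp add: a_minus_def a_assoc r_neg1)

lemma add_diff_add:
  "\<lbrakk>x \<in> carrier V; y \<in> carrier V; z \<in> carrier V; w \<in> carrier V\<rbrakk>
   \<Longrightarrow> (x \<oplus> y) \<ominus> (z \<oplus> w) = (x \<ominus> z) \<oplus> (y \<ominus> w)"
  by (simp add: a_minus_def minus_add a_ac)

lemma diff_diff_diff: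
  "\<lbrakk>x \<in> carrier V; y \<in> carrier V; z \<in> carrier V; w \<in> carrier V\<rbrakk>
   \<Longrightarrow> (x \<ominus> y) \<ominus> (z \<ominus> w) = (x \<ominus> z) \<ominus> (y \<ominus> w)"
  by (simp add: a_minus_def minus_add a_ac)

lemma diff_eq_zero_iff:
  "x \<in> carrier V \<Longrightarrow> y \<in> carrier V \<Longrightarrow> x \<ominus> y = \<zero> \<longleftrightarrow> x = y"
  by (metis add_diff_cancel diff_self r_zero)

lemma minus_zero_eq [simp]: "\<ominus> \<zero> = \<zero>"
  using minus_equality[of \<zero> \<zero>] by simp

lemma diff_diff_cancel_left:
  "x \<in> carrier V \<Longrightarrow> y \<in> carrier V \<Longrightarrow> z \<in> carrier V \<Longrightarrow> (x \<ominus> y) \<ominus> (x \<ominus> z) = z \<ominus> y"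
  by (simp add: diff_diff_diff) (simp add: a_minus_def minus_add a_comm)

lemma diff_diff_cancel_right:
  "x \<in> carrier V \<Longrightarrow> y \<in> carrier V \<Longrightarrow> z \<in> carrier V \<Longrightarrow> (x \<ominus> z) \<ominus> (y \<ominus> z) = x \<ominus> y"
  by (simp add: diff_diff_diff)

lemma diff_diff_self: "x \<in> carrier V \<Longrightarrow> y \<in> carrier V \<Longrightarrow> x \<ominus> (x \<ominus> y) = y"
  by (simp add: a_minus_def minus_add r_neg2)

end

lemma real_moduleI:
  fixes V :: "'a tvs" (structure)
  assumes "\<And>x y. \<lbrakk>x \<in> carrier V; y \<in> carrier V\<rbrakk> \<Longrightarrow> x \<oplus> y \<in> carrier V"
    and "\<zero> \<in> carrier V"
    and "\<And>x y z. \<lbrakk>x \<in> carrier V; y \<in> carrier V; z \<in> carrier V\<rbrakk> \<Longrightarrow> (x \<oplus> y) \<oplus> z = x \<oplus> (y \<oplus> z)"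
    and "\<And>x y. \<lbrakk>x \<in> carrier V; y \<in> carrier V\<rbrakk> \<Longrightarrow> x \<oplus> y = y \<oplus> x"
    and "\<And>x. x \<in> carrier V \<Longrightarrow> \<zero> \<oplus> x = x"
    and "\<And>r x. x \<in> carrier V \<Longrightarrow> r \<odot> x \<in> carrier V"
    and "\<And>r s x. x \<in> carrier V \<Longrightarrow> (r + s) \<odot> x = r \<odot> x \<oplus> s \<odot> x"
    and "\<And>r x y. \<lbrakk>x \<in> carrier V; y \<in> carrier V\<rbrakk> \<Longrightarrow> r \<odot> (x \<oplus> y) = r \<odot> x \<oplus> r \<odot> y"
    and "\<And>r s x. x \<in> carrier V \<Longrightarrow> (r * s) \<odot> x = r \<odot> (s \<odot> x)"
    and "\<And>x. x \<in> carrier V \<Longrightarrow> 1 \<odot> x = x"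
    and "\<And>x. x \<in> carrier V \<Longrightarrow> 0 \<odot> x = \<zero>"
  shows "real_module V"
proof (rule real_module.intro)
  have "cring real_ring"
  proof (rule cringI)
    show "abelian_group real_ring"
    proof (rule abelian_groupI)
      fix x assume "x \<in> carrier real_ring"
      show "\<exists>y\<in>carrier real_ring. y \<oplus>\<^bsub>real_ring\<^esub> x = \<zero>\<^bsub>real_ring\<^esub>"
        by (rule bexI[of _ "- x"]) (simp_all add: real_ring_def)
    qed (simp_all add: real_ring_def)
    show "comm_monoid real_ring"
      by (rule comm_monoidI) (simp_all add: real_ring_def)
  qed (simp add: real_ring_def algebra_simps)
  moreover have "abelian_group V"
  proof (rule abelian_groupI)
    fix x assume x: "x \<in> carrier V"
    show "\<exists>y\<in>carrier V. y \<oplus> x = \<zero>"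
      using assms(6)[OF x, of "-1"] assms(7)[OF x, of "-1" 1] assms(10,11)[OF x] by auto
  qed (use assms in auto)
  ultimately show "module real_ring V"
    by (rule moduleI) (use assms in \<open>auto simp: real_ring_def\<close>)
qed

subsection \<open>Linear maps\<close>

locale linear_map = V: real_module V + W: real_module W
  for V :: "'a tvs" and W :: "'b tvs" +
  fixes f :: "'a \<Rightarrow> 'b"
  assumes linear: "tvs_linear V W f"
begin

lemma closed [simp, intro]: "x \<in> carrier V \<Longrightarrow> f x \<in> carrier W"
  using linear by (auto simp: tvs_linear_def)

lemma add: "x \<in> carrier V \<Longrightarrow> y \<in> carrier V \<Longrightarrow> f (x \<oplus>\<^bsub>V\<^esub> y) = f x \<oplus>\<^bsub>W\<^esub> f y"
  using linear by (auto simp: tvs_linear_def)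

lemma smult: "x \<in> carrier V \<Longrightarrow> f (r \<odot>\<^bsub>V\<^esub> x) = r \<odot>\<^bsub>W\<^esub> f x"
  using linear by (auto simp: tvs_linear_def)

lemma zero [simp]: "f \<zero>\<^bsub>V\<^esub> = \<zero>\<^bsub>W\<^esub>"
  using smult[of "\<zero>\<^bsub>V\<^esub>" 0] by simp

lemma minus: "x \<in> carrier V \<Longrightarrow> f (\<ominus>\<^bsub>V\<^esub> x) = \<ominus>\<^bsub>W\<^esub> f x"
  using smult[of x "-1"] by (simp add: V.minus_one_smult W.minus_one_smult)

lemma diff: "x \<in> carrier V \<Longrightarrow> y \<in> carrier V \<Longrightarrow> f (x \<ominus>\<^bsub>V\<^esub> y) = f x \<ominus>\<^bsub>W\<^esub> f y"
  by (simp add: a_minus_def add minus)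

lemma inj_onI: 
  assumes "\<And>x. x \<in> carrier V \<Longrightarrow> f x = \<zero>\<^bsub>W\<^esub> \<Longrightarrow> x = \<zero>\<^bsub>V\<^esub>" 
  shows "inj_on f (carrier V)"
proof (rule Fun.inj_onI)
  fix x y assume xy: "x \<in> carrier V" "y \<in> carrier V" "f x = f y"
  then have "f (x \<ominus>\<^bsub>V\<^esub> y) = \<zero>\<^bsub>W\<^esub>" by (simp add: diff)
  with xy assms have "x \<ominus>\<^bsub>V\<^esub> y = \<zero>\<^bsub>V\<^esub>" by blast
  with xy show "x = y" by (simp add: V.diff_eq_zero_iff)
qed

end

lemma tvs_linear_compose:
  "tvs_linear U V f \<Longrightarrow> tvs_linear V W g \<Longrightarrow> tvs_linear U W (\<lambda>x. g (f x))"
  unfolding tvs_linear_def Pi_iff by metis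

subsection \<open>Neighbourhoods of zero\<close>

definition nbhd0 :: "'a tvs \<Rightarrow> 'a set \<Rightarrow> bool" where
  "nbhd0 V U \<longleftrightarrow> U \<subseteq> carrier V \<and> (\<exists>O'. openin (topo V) O' \<and> \<zero>\<^bsub>V\<^esub> \<in> O' \<and> O' \<subseteq> U)"

text \<open>Topological vector spaces without the Hausdorff axiom, the setting in which products and
  subspaces are treated below.\<close>

locale pretvs = real_module V for V :: "'a tvs" (structure) +
  assumes topspace [simp]: "topspace (topo V) = carrier V"
    and continuous_add:
      "continuous_map (prod_topology (topo V) (topo V)) (topo V) (\<lambda>(x, y). x \<oplus> y)"
    and continuous_smult:
      "continuous_map (prod_topology euclideanreal (topo V)) (topo V) (\<lambda>(r, x). r \<odot> x)"

lemma is_tvs_iff: "is_tvs V \<longleftrightarrow> pretvs V \<and> Hausdorff_space (topo V)"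
  by (auto simp: is_tvs_def pretvs_def pretvs_axioms_def real_module_def)

context pretvs
begin

lemma continuous_add_comp:
  assumes "continuous_map T (topo V) f" "continuous_map T (topo V) g"
  shows "continuous_map T (topo V) (\<lambda>t. f t \<oplus> g t)"
  using continuous_map_compose[OF continuous_map_pairedI[OF assms] continuous_add]
  by (simp add: o_def)

lemma continuous_smult_comp:
  assumes "continuous_map T euclideanreal f" "continuous_map T (topo V) g"
  shows "continuous_map T (topo V) (\<lambda>t. f t \<odot> g t)"
  using continuous_map_compose[OF continuous_map_pairedI[OF assms] continuous_smult]
  by (simp add: o_def)

lemma nbhd0_subset: "nbhd0 V U \<Longrightarrow> u \<in> U \<Longrightarrow> u \<in> carrier V"
  by (auto simp: nbhd0_def)

lemma nbhd0_zero: "nbhd0 V U \<Longrightarrow> \<zero> \<in> U"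
  by (auto simp: nbhd0_def)

lemma nbhd0_carrier [simp]: "nbhd0 V (carrier V)"
  unfolding nbhd0_def by (metis openin_topspace order_refl topspace zero_closed)

lemma nbhd0_mono: "nbhd0 V U \<Longrightarrow> U \<subseteq> U' \<Longrightarrow> U' \<subseteq> carrier V \<Longrightarrow> nbhd0 V U'"
  unfolding nbhd0_def by (meson order_trans)

lemma nbhd0_Int: 
  assumes "nbhd0 V U" "nbhd0 V U'" shows "nbhd0 V (U \<inter> U')"
proof -
  obtain A B where "openin (topo V) A" "\<zero> \<in> A" "A \<subseteq> U" "openin (topo V) B" "\<zero> \<in> B" "B \<subseteq> U'"
    using assms unfolding nbhd0_def by blast
  then have "openin (topo V) (A \<inter> B) \<and> \<zero> \<in> A \<inter> B \<and> A \<inter> B \<subseteq> U \<inter> U'" by auto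
  with assms show ?thesis unfolding nbhd0_def by blast
qed

lemma openin_nbhd0: "openin (topo V) A \<Longrightarrow> \<zero> \<in> A \<Longrightarrow> nbhd0 V A"
  unfolding nbhd0_def using openin_subset topspace by fastforce

lemma nbhd0_translate:
  assumes "openin (topo V) A" "a \<in> A"
  shows "nbhd0 V {u \<in> carrier V. a \<oplus> u \<in> A}"
proof (rule openin_nbhd0)
  have a: "a \<in> carrier V" using assms openin_subset topspace by blast
  have "continuous_map (topo V) (topo V) (\<lambda>u. a \<oplus> u)"
    using a by (intro continuous_add_comp continuous_map_id[unfolded id_def]) auto
  from openin_continuous_map_preimage[OF this assms(1)]
  show "openin (topo V) {u \<in> carrier V. a \<oplus> u \<in> A}" by simp
  show "\<zero> \<in> {u \<in> carrier V. a \<oplus> u \<in> A}" using a assms by simp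
qed

lemma openin_iff_nbhd0:
  "openin (topo V) A \<longleftrightarrow>
     A \<subseteq> carrier V \<and> (\<forall>a\<in>A. \<exists>U. nbhd0 V U \<and> (\<forall>u\<in>U. a \<oplus> u \<in> A))" (is "_ \<longleftrightarrow> ?R")
proof
  assume "openin (topo V) A"
  then show ?R using nbhd0_translate openin_subset topspace by fastforce
next
  assume R: ?R
  have "\<exists>T. openin (topo V) T \<and> a \<in> T \<and> T \<subseteq> A" if "a \<in> A" for a
  proof -
    from R that have a: "a \<in> carrier V" and "\<exists>U. nbhd0 V U \<and> (\<forall>u\<in>U. a \<oplus> u \<in> A)" by auto
    then obtain U where "nbhd0 V U" and Ua: "\<forall>u\<in>U. a \<oplus> u \<in> A" by metis
    then obtain B where U: "openin (topo V) B" "\<zero> \<in> B" "B \<subseteq> U"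
      unfolding nbhd0_def by blast
    have "continuous_map (topo V) (topo V) (\<lambda>u. (\<ominus> a) \<oplus> u)"
      using a by (intro continuous_add_comp continuous_map_id[unfolded id_def]) auto
    from openin_continuous_map_preimage[OF this U(1)]
    have "openin (topo V) {u \<in> carrier V. (\<ominus> a) \<oplus> u \<in> B}" by simp
    moreover have "a \<in> {u \<in> carrier V. (\<ominus> a) \<oplus> u \<in> B}" using a U by (simp add: l_neg)
    moreover have "{u \<in> carrier V. (\<ominus> a) \<oplus> u \<in> B} \<subseteq> A"
    proof
      fix u assume u: "u \<in> {u \<in> carrier V. (\<ominus> a) \<oplus> u \<in> B}"
      then have "a \<oplus> ((\<ominus> a) \<oplus> u) \<in> A" using U Ua by blast
      with u a show "u \<in> A" by (simp add: r_neg2)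
    qed
    ultimately show ?thesis by blast
  qed
  then show "openin (topo V) A" using openin_subopen by blast
qed

lemma openin_translate_nbhd0:
  assumes "nbhd0 V U" "a \<in> carrier V"
  obtains A where "openin (topo V) A" "a \<in> A" "\<And>x. x \<in> A \<Longrightarrow> x \<ominus> a \<in> U"
proof -
  obtain B where U: "openin (topo V) B" "\<zero> \<in> B" "B \<subseteq> U"
    using assms unfolding nbhd0_def by blast
  have "continuous_map (topo V) (topo V) (\<lambda>u. u \<oplus> (\<ominus> a))"
    using assms(2) by (intro continuous_add_comp continuous_map_id[unfolded id_def]) auto
  from openin_continuous_map_preimage[OF this U(1)]
  have "openin (topo V) {u \<in> carrier V. u \<oplus> (\<ominus> a) \<in> B}" by simp
  moreover have "a \<in> {u \<in> carrier V. u \<oplus> (\<ominus> a) \<in> B}" using assms(2) U by (simp add: r_neg)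
  ultimately show thesis using that U unfolding a_minus_def by blast
qed

lemma nbhd0_smult:
  assumes "nbhd0 V U" shows "nbhd0 V {x \<in> carrier V. r \<odot> x \<in> U}"
proof -
  obtain B where U: "openin (topo V) B" "\<zero> \<in> B" "B \<subseteq> U"
    using assms unfolding nbhd0_def by blast
  have "continuous_map (topo V) (topo V) (\<lambda>u. r \<odot> u)"
    by (intro continuous_smult_comp continuous_map_id[unfolded id_def]) auto
  from openin_continuous_map_preimage[OF this U(1)]
  have "openin (topo V) {u \<in> carrier V. r \<odot> u \<in> B}" by simp
  with U show ?thesis unfolding nbhd0_def
    by (intro conjI exI[of _ "{u \<in> carrier V. r \<odot> u \<in> B}"]) auto
qed

lemma nbhd0_absorbing:
  assumes "nbhd0 V U" "x \<in> carrier V"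
  obtains e where "e > 0" "\<And>r. \<bar>r\<bar> \<le> e \<Longrightarrow> r \<odot> x \<in> U"
proof -
  obtain B where U: "openin (topo V) B" "\<zero> \<in> B" "B \<subseteq> U"
    using assms unfolding nbhd0_def by blast
  have "continuous_map euclideanreal (topo V) (\<lambda>r. r \<odot> x)"
    using assms(2) continuous_smult_comp[of euclideanreal "\<lambda>r. r" "\<lambda>_. x"] by simp
  from openin_continuous_map_preimage[OF this U(1)]
  have "open {r. r \<odot> x \<in> B}" by simp
  moreover have "0 \<in> {r. r \<odot> x \<in> B}" using U assms by simp
  ultimately obtain e where e: "e > 0" "cball 0 e \<subseteq> {r. r \<odot> x \<in> B}"
    using open_contains_cball_eq by blast
  show thesis
  proof
    fix r :: real assume "\<bar>r\<bar> \<le> e"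
    then have "r \<in> cball 0 e" by simp
    with e U show "r \<odot> x \<in> U" by blast
  qed fact
qed

lemma nbhd0_halve:
  assumes "nbhd0 V U"
  obtains U' where "nbhd0 V U'" "\<And>x y. x \<in> U' \<Longrightarrow> y \<in> U' \<Longrightarrow> x \<oplus> y \<in> U"
proof -
  obtain B where U: "openin (topo V) B" "\<zero> \<in> B" "B \<subseteq> U"
    using assms unfolding nbhd0_def by blast
  define S where "S = {p \<in> topspace (prod_topology (topo V) (topo V)). (case p of (x, y) \<Rightarrow> x \<oplus> y) \<in> B}"
  have "openin (prod_topology (topo V) (topo V)) S"
    unfolding S_def by (rule openin_continuous_map_preimage[OF continuous_add U(1)])
  moreover have "(\<zero>, \<zero>) \<in> S" using U by (simp add: S_def)
  ultimately obtain A A' where A: "openin (topo V) A" "openin (topo V) A'" "\<zero> \<in> A" "\<zero> \<in> A'"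
    "A \<times> A' \<subseteq> S"
    unfolding openin_prod_topology_alt by metis
  show thesis
  proof
    show "nbhd0 V (A \<inter> A')" using A by (intro openin_nbhd0) auto
    fix x y assume "x \<in> A \<inter> A'" "y \<in> A \<inter> A'"
    then have "(x, y) \<in> S" using A(5) by auto
    then show "x \<oplus> y \<in> U" using U(3) by (auto simp: S_def)
  qed
qed

lemma nbhd0_balanced:
  assumes "nbhd0 V U"
  obtains U' where "nbhd0 V U'" "U' \<subseteq> U" "\<And>r x. \<bar>r\<bar> \<le> 1 \<Longrightarrow> x \<in> U' \<Longrightarrow> r \<odot> x \<in> U'"
proof -
  obtain B where U: "openin (topo V) B" "\<zero> \<in> B" "B \<subseteq> U"
    using assms unfolding nbhd0_def by blast
  define S where "S = {p \<in> topspace (prod_topology euclideanreal (topo V)). (case p of (x, y) \<Rightarrow> x \<odot> y) \<in> B}"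
  have "openin (prod_topology euclideanreal (topo V)) S"
    unfolding S_def by (rule openin_continuous_map_preimage[OF continuous_smult U(1)])
  moreover have "(0, \<zero>) \<in> S" using U by (simp add: S_def)
  ultimately obtain A A' where A: "openin euclideanreal A" "openin (topo V) A'" "0 \<in> A" "\<zero> \<in> A'"
    "A \<times> A' \<subseteq> S"
    unfolding openin_prod_topology_alt by metis
  obtain e where e: "e > 0" "cball 0 e \<subseteq> A" using A(1,3) open_contains_cball_eq open_openin by metis
  define U' where "U' = {x \<in> carrier V. \<forall>r. \<bar>r\<bar> \<le> 1 \<longrightarrow> r \<odot> x \<in> B}"
  show thesis
  proof
    show "nbhd0 V U'"
    proof (rule nbhd0_mono)
      show "nbhd0 V {x \<in> carrier V. (1 / e) \<odot> x \<in> A'}"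
        using A by (intro nbhd0_smult openin_nbhd0)
      show "{x \<in> carrier V. (1 / e) \<odot> x \<in> A'} \<subseteq> U'"
      proof (clarsimp simp: U'_def)
        fix x r assume x: "x \<in> carrier V" "(1 / e) \<odot> x \<in> A'" "\<bar>r\<bar> \<le> (1::real)"
        then have "\<bar>r * e\<bar> \<le> e" using e by (simp add: abs_mult mult_left_le_one_le)
        then have "r * e \<in> A" using e by auto
        with A(5) x have "(r * e, (1 / e) \<odot> x) \<in> S" by auto
        then have "(r * e) \<odot> ((1 / e) \<odot> x) \<in> B" by (simp add: S_def)
        then show "r \<odot> x \<in> B" using e x by (simp add: smult_smult)
      qed
    qed (auto simp: U'_def)
    show "U' \<subseteq> U"
    proof
      fix x assume "x \<in> U'"
      then have "x \<in> carrier V" "1 \<odot> x \<in> B" by (auto simp: U'_def dest: spec[of _ 1])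
      then show "x \<in> U" using U(3) by auto
    qed
    fix r x assume rx: "\<bar>r\<bar> \<le> (1::real)" "x \<in> U'"
    have "\<bar>s * r\<bar> \<le> 1" if "\<bar>s\<bar> \<le> 1" for s 
      using rx that by (simp add: abs_mult mult_le_one)
    with rx show "r \<odot> x \<in> U'" unfolding U'_def by (auto simp: smult_smult)
  qed
qed

text \<open>Halving and balancing at once, which is how nearly every argument with small elements
  below begins.\<close>

lemma nbhd0_halve_balanced:
  assumes "nbhd0 V U"
  obtains U' where "nbhd0 V U'" "U' \<subseteq> U" "\<And>x y. x \<in> U' \<Longrightarrow> y \<in> U' \<Longrightarrow> x \<oplus> y \<in> U"
    "\<And>r x. \<bar>r\<bar> \<le> 1 \<Longrightarrow> x \<in> U' \<Longrightarrow> r \<odot> x \<in> U'" 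
    "\<And>x y. x \<in> U' \<Longrightarrow> y \<in> U' \<Longrightarrow> x \<ominus> y \<in> U"
proof -
  obtain A where A: "nbhd0 V A" "\<And>x y. x \<in> A \<Longrightarrow> y \<in> A \<Longrightarrow> x \<oplus> y \<in> U"
    using nbhd0_halve[OF assms] by metis
  obtain B where B: "nbhd0 V B" "B \<subseteq> A \<inter> U" "\<And>r x. \<bar>r\<bar> \<le> 1 \<Longrightarrow> x \<in> B \<Longrightarrow> r \<odot> x \<in> B"
    using nbhd0_balanced[OF nbhd0_Int[OF A(1) assms]] by metis
  have "\<ominus> x \<in> B" if "x \<in> B" for x
    using B(3)[of "-1" x] that minus_one_smult nbhd0_subset[OF B(1)] by simp
  moreover have "x \<in> A" if "x \<in> B" for x using B(2) that by auto
  ultimately show thesis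
    using A(2) B by (intro that[of B]) (simp_all add: a_minus_def)
qed

end

lemma is_tvs_separated:
  assumes "is_tvs V" "x \<in> carrier V" "\<And>U. nbhd0 V U \<Longrightarrow> x \<in> U"
  shows "x = \<zero>\<^bsub>V\<^esub>"
proof (rule ccontr)
  interpret pretvs V using assms by (simp add: is_tvs_iff)
  assume "x \<noteq> \<zero>\<^bsub>V\<^esub>"
  then obtain A B where "openin (topo V) A" "openin (topo V) B" "x \<in> B" "\<zero>\<^bsub>V\<^esub> \<in> A" "disjnt A B"
    using assms(1,2) unfolding is_tvs_def Hausdorff_space_def by (metis zero_closed topspace)
  then show False using assms(3)[of A] by (auto simp: openin_nbhd0 disjnt_iff)
qed

subsection \<open>Continuity, openness\<close>

locale pretvs_map = V: pretvs V + W: pretvs W + linear_map V W f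
  for V :: "'a tvs" and W :: "'b tvs" and f
begin

lemma continuous_iff_nbhd0:
  "continuous_map (topo V) (topo W) f \<longleftrightarrow>
     (\<forall>U. nbhd0 W U \<longrightarrow> nbhd0 V {x \<in> carrier V. f x \<in> U})"
proof
  assume c: "continuous_map (topo V) (topo W) f"
  show "\<forall>U. nbhd0 W U \<longrightarrow> nbhd0 V {x \<in> carrier V. f x \<in> U}"
  proof (intro allI impI)
    fix U assume "nbhd0 W U"
    then obtain A where A: "openin (topo W) A" "\<zero>\<^bsub>W\<^esub> \<in> A" "A \<subseteq> U" unfolding nbhd0_def by blast
    have "openin (topo V) {x \<in> carrier V. f x \<in> A}"
      using openin_continuous_map_preimage[OF c A(1)] by simp
    then show "nbhd0 V {x \<in> carrier V. f x \<in> U}"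
      unfolding nbhd0_def using A by (intro conjI exI[of _ "{x \<in> carrier V. f x \<in> A}"]) auto
  qed
next
  assume c: "\<forall>U. nbhd0 W U \<longrightarrow> nbhd0 V {x \<in> carrier V. f x \<in> U}"
  show "continuous_map (topo V) (topo W) f"
  proof (rule continuous_map[THEN iffD2], intro conjI allI impI)
    show "f ` topspace (topo V) \<subseteq> topspace (topo W)" by auto
    fix A assume A: "openin (topo W) A"
    have "\<exists>U. nbhd0 V U \<and> (\<forall>u\<in>U. a \<oplus>\<^bsub>V\<^esub> u \<in> {x \<in> carrier V. f x \<in> A})"
      if a: "a \<in> carrier V" "f a \<in> A" for a
    proof -
      have "nbhd0 W {u \<in> carrier W. f a \<oplus>\<^bsub>W\<^esub> u \<in> A}" using W.nbhd0_translate[OF A] a by blast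
      let ?U = "{x \<in> carrier V. f x \<in> {u \<in> carrier W. f a \<oplus>\<^bsub>W\<^esub> u \<in> A}}"
      have "nbhd0 V ?U" by (rule c[rule_format]) fact
      moreover have "\<forall>u \<in> ?U. a \<oplus>\<^bsub>V\<^esub> u \<in> {x \<in> carrier V. f x \<in> A}" using a by (simp add: add)
      ultimately show ?thesis by (intro exI[of _ ?U] conjI)
    qed
    then show "openin (topo V) {x \<in> topspace (topo V). f x \<in> A}"
      by (subst V.openin_iff_nbhd0) auto
  qed
qed

lemma open_onto_image_iff_nbhd0:
  "open_onto_image V W f \<longleftrightarrow>
     (\<forall>U. nbhd0 V U \<longrightarrow> (\<exists>O'. nbhd0 W O' \<and> O' \<inter> f ` carrier V \<subseteq> f ` U))"
proof
  assume o: "open_onto_image V W f"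
  show "\<forall>U. nbhd0 V U \<longrightarrow> (\<exists>O'. nbhd0 W O' \<and> O' \<inter> f ` carrier V \<subseteq> f ` U)"
  proof (intro allI impI)
    fix U assume "nbhd0 V U"
    then obtain A where A: "openin (topo V) A" "\<zero>\<^bsub>V\<^esub> \<in> A" "A \<subseteq> U" unfolding nbhd0_def by blast
    have "openin (subtopology (topo W) (f ` carrier V)) (f ` A)"
      using o A unfolding open_onto_image_def open_map_def by blast
    then obtain B where B: "openin (topo W) B" "f ` A = B \<inter> f ` carrier V"
      unfolding openin_subtopology by blast
    have "f \<zero>\<^bsub>V\<^esub> \<in> f ` A" using A by blast
    then have "\<zero>\<^bsub>W\<^esub> \<in> B" using B by auto
    then show "\<exists>O'. nbhd0 W O' \<and> O' \<inter> f ` carrier V \<subseteq> f ` U"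
      using B A by (intro exI[of _ B]) (auto intro: W.openin_nbhd0)
  qed
next
  assume o: "\<forall>U. nbhd0 V U \<longrightarrow> (\<exists>O'. nbhd0 W O' \<and> O' \<inter> f ` carrier V \<subseteq> f ` U)"
  show "open_onto_image V W f"
    unfolding open_onto_image_def open_map_def
  proof (intro allI impI)
    fix A assume A: "openin (topo V) A"
    then have Ac: "A \<subseteq> carrier V" using openin_subset by fastforce
    have "\<exists>B. openin (topo W) B \<and> f a \<in> B \<and> B \<inter> f ` carrier V \<subseteq> f ` A" if a: "a \<in> A" for a
    proof -
      obtain O' where O': "nbhd0 W O'" "O' \<inter> f ` carrier V \<subseteq> f ` {u \<in> carrier V. a \<oplus>\<^bsub>V\<^esub> u \<in> A}"
        using o V.nbhd0_translate[OF A a] by blast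
      obtain B where B: "openin (topo W) B" "f a \<in> B" "\<And>x. x \<in> B \<Longrightarrow> x \<ominus>\<^bsub>W\<^esub> f a \<in> O'"
        using W.openin_translate_nbhd0[OF O'(1), of "f a"] a Ac by (metis closed subsetD)
      have "B \<inter> f ` carrier V \<subseteq> f ` A"
      proof
        fix w assume w: "w \<in> B \<inter> f ` carrier V"
        then obtain x where x: "x \<in> carrier V" "w = f x" by auto
        have "w \<ominus>\<^bsub>W\<^esub> f a = f (x \<ominus>\<^bsub>V\<^esub> a)" using x a Ac by (simp add: diff subset_iff)
        moreover have "w \<ominus>\<^bsub>W\<^esub> f a \<in> O'" using B(3) w by auto
        moreover have "f (x \<ominus>\<^bsub>V\<^esub> a) \<in> f ` carrier V" using x a Ac by auto
        ultimately have "w \<ominus>\<^bsub>W\<^esub> f a \<in> O' \<inter> f ` carrier V" by simp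
        with O'(2) obtain u where u: "u \<in> carrier V" "a \<oplus>\<^bsub>V\<^esub> u \<in> A" "w \<ominus>\<^bsub>W\<^esub> f a = f u" by auto
        have wc: "w \<in> carrier W" "f a \<in> carrier W" using x a Ac by auto
        have "w = f a \<oplus>\<^bsub>W\<^esub> (w \<ominus>\<^bsub>W\<^esub> f a)" using wc by simp
        also have "\<dots> = f (a \<oplus>\<^bsub>V\<^esub> u)" using u a Ac by (simp add: add subset_iff)
        finally show "w \<in> f ` A" using u by blast
      qed
      with B(1,2) show ?thesis by metis
    qed
    then obtain B where B: "\<And>a. a \<in> A \<Longrightarrow> openin (topo W) (B a) \<and> f a \<in> B a \<and> B a \<inter> f ` carrier V \<subseteq> f ` A"
      by metis
    then have "openin (topo W) (\<Union>a\<in>A. B a)" by auto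
    moreover have "f ` A = (\<Union>a\<in>A. B a) \<inter> f ` carrier V"
    proof (intro equalityI subsetI)
      fix w assume "w \<in> f ` A"
      then show "w \<in> (\<Union>a\<in>A. B a) \<inter> f ` carrier V" using B Ac by auto
    next
      fix w assume "w \<in> (\<Union>a\<in>A. B a) \<inter> f ` carrier V"
      then obtain a where "a \<in> A" "w \<in> B a \<inter> f ` carrier V" by auto
      then show "w \<in> f ` A" using B by (meson subsetD)
    qed
    ultimately show "openin (subtopology (topo W) (f ` carrier V)) (f ` A)"
      unfolding openin_subtopology by metis
  qed
qed

end

section \<open>Embeddings and extension by continuity\<close>

subsection \<open>Completeness\<close>

text \<open>Completeness is tested on filters, and the filters needed are all given by a base.\<close>

lemma filter_from_base:
  assumes "B \<noteq> {}" "\<And>S T. S \<in> B \<Longrightarrow> T \<in> B \<Longrightarrow> \<exists>R\<in>B. R \<subseteq> S \<inter> T"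
  obtains F where "\<And>P. eventually P F \<longleftrightarrow> (\<exists>S\<in>B. \<forall>x\<in>S. P x)"
proof
  fix P
  have "eventually P (INF S\<in>B. principal S) \<longleftrightarrow> (\<exists>S\<in>B. eventually P (principal S))"
    by (rule eventually_INF_base) (use assms in auto)
  then show "eventually P (INF S\<in>B. principal S) \<longleftrightarrow> (\<exists>S\<in>B. \<forall>x\<in>S. P x)"
    by (simp add: eventually_principal)
qed

context pretvs
begin

lemma limitin_iff_nbhd0:
  "limitin (topo V) f l F \<longleftrightarrow>
     l \<in> carrier V \<and> (\<forall>U. nbhd0 V U \<longrightarrow> (\<forall>\<^sub>F x in F. f x \<in> carrier V \<and> f x \<ominus> l \<in> U))"
proof (intro iffI conjI allI impI)
  assume l: "limitin (topo V) f l F"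
  then show lc: "l \<in> carrier V" by (simp add: limitin_def)
  fix U assume "nbhd0 V U"
  then obtain A where A: "openin (topo V) A" "l \<in> A" "\<And>x. x \<in> A \<Longrightarrow> x \<ominus> l \<in> U"
    using openin_translate_nbhd0 lc by metis
  then have Ac: "A \<subseteq> carrier V" using openin_subset by fastforce
  have "\<forall>\<^sub>F x in F. f x \<in> A" using l A by (simp add: limitin_def)
  then show "\<forall>\<^sub>F x in F. f x \<in> carrier V \<and> f x \<ominus> l \<in> U"
    by (rule eventually_mono) (use A Ac in auto)
next
  assume l: "l \<in> carrier V \<and> (\<forall>U. nbhd0 V U \<longrightarrow> (\<forall>\<^sub>F x in F. f x \<in> carrier V \<and> f x \<ominus> l \<in> U))"
  show "limitin (topo V) f l F"
    unfolding limitin_def topspace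
  proof (intro conjI allI impI)
    show "l \<in> carrier V" using l ..
    fix A assume "openin (topo V) A \<and> l \<in> A"
    then have "nbhd0 V {u \<in> carrier V. l \<oplus> u \<in> A}" by (simp add: nbhd0_translate)
    with l have "\<forall>\<^sub>F x in F. f x \<in> carrier V \<and> f x \<ominus> l \<in> {u \<in> carrier V. l \<oplus> u \<in> A}" by auto
    then show "\<forall>\<^sub>F x in F. f x \<in> A" by (rule eventually_mono) (use l in auto)
  qed
qed

lemma tvs_Cauchy_filter_iff_nbhd0:
  "tvs_Cauchy_filter V F \<longleftrightarrow> F \<noteq> bot \<and> (\<forall>\<^sub>F x in F. x \<in> carrier V) \<and>
     (\<forall>U. nbhd0 V U \<longrightarrow> (\<exists>Q. eventually Q F \<and> (\<forall>x y. Q x \<longrightarrow> Q y \<longrightarrow> x \<ominus> y \<in> U)))"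
proof -
  have "(\<forall>U. openin (topo V) U \<and> \<zero> \<in> U \<longrightarrow> (\<forall>\<^sub>F (x, y) in F \<times>\<^sub>F F. x \<ominus> y \<in> U)) \<longleftrightarrow>
    (\<forall>U. nbhd0 V U \<longrightarrow> (\<exists>Q. eventually Q F \<and> (\<forall>x y. Q x \<longrightarrow> Q y \<longrightarrow> x \<ominus> y \<in> U)))" (is "?L \<longleftrightarrow> ?R")
  proof
    assume L: ?L
    show ?R
    proof (intro allI impI)
      fix U assume "nbhd0 V U"
      then obtain A where "openin (topo V) A" "\<zero> \<in> A" "A \<subseteq> U" unfolding nbhd0_def by auto
      with L obtain Q where "eventually Q F" "\<forall>x y. Q x \<longrightarrow> Q y \<longrightarrow> x \<ominus> y \<in> A"
        unfolding eventually_prod_same by auto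
      with \<open>A \<subseteq> U\<close> show "\<exists>Q. eventually Q F \<and> (\<forall>x y. Q x \<longrightarrow> Q y \<longrightarrow> x \<ominus> y \<in> U)" by auto
    qed
  next
    assume R: ?R
    show ?L
      unfolding eventually_prod_same using R openin_nbhd0 by simp
  qed
  then show ?thesis by (simp add: tvs_Cauchy_filter_def)
qed

end

subsection \<open>Embeddings\<close>

text \<open>The last clause says that the inverse map on the image is continuous at zero.\<close>

definition tvs_embedding :: "'a tvs \<Rightarrow> 'b tvs \<Rightarrow> ('a \<Rightarrow> 'b) \<Rightarrow> bool" where
  "tvs_embedding V W e \<longleftrightarrow> continuous_linear V W e \<and> inj_on e (carrier V) \<and>
     (\<forall>U. nbhd0 V U \<longrightarrow> (\<exists>O'. nbhd0 W O' \<and> (\<forall>x\<in>carrier V. e x \<in> O' \<longrightarrow> x \<in> U)))"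

definition dense_image :: "'a tvs \<Rightarrow> 'b tvs \<Rightarrow> ('a \<Rightarrow> 'b) \<Rightarrow> bool" where
  "dense_image V W e \<longleftrightarrow>
     (\<forall>w\<in>carrier W. \<forall>U. nbhd0 W U \<longrightarrow> (\<exists>x\<in>carrier V. e x \<ominus>\<^bsub>W\<^esub> w \<in> U))"

lemma pretvs_mapI:
  "pretvs V \<Longrightarrow> pretvs W \<Longrightarrow> tvs_linear V W f \<Longrightarrow> pretvs_map V W f"
  by (simp add: pretvs_map_def linear_map_def linear_map_axioms_def pretvs_def)

lemma continuous_linear_nbhd0:
  assumes "pretvs V" "pretvs W" "continuous_linear V W f" "nbhd0 W U"
  shows "nbhd0 V {x \<in> carrier V. f x \<in> U}"
proof -
  have "pretvs_map V W f" using assms by (intro pretvs_mapI) (simp_all add: continuous_linear_def)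
  from pretvs_map.continuous_iff_nbhd0[OF this] assms show ?thesis by (simp add: continuous_linear_def)
qed

lemma continuous_linearI:
  assumes "pretvs V" "pretvs W" "tvs_linear V W f"
    and "\<And>U. nbhd0 W U \<Longrightarrow> nbhd0 V {x \<in> carrier V. f x \<in> U}"
  shows "continuous_linear V W f"
proof -
  have "pretvs_map V W f" using assms by (intro pretvs_mapI) (simp_all add: continuous_linear_def)
  from pretvs_map.continuous_iff_nbhd0[OF this] assms show ?thesis by (simp add: continuous_linear_def)
qed

lemma continuous_linear_compose:
  "continuous_linear U V f \<Longrightarrow> continuous_linear V W g \<Longrightarrow> continuous_linear U W (\<lambda>x. g (f x))"
  unfolding continuous_linear_def
  by (auto intro: tvs_linear_compose dest: continuous_map_compose simp: o_def)

lemma continuous_linear_id: "continuous_linear V V (\<lambda>x. x)"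
  by (simp add: continuous_linear_def tvs_linear_def continuous_map_id[unfolded id_def])

lemma tvs_embedding_id: "tvs_embedding V V (\<lambda>x. x)"
  by (auto simp: tvs_embedding_def continuous_linear_id)

lemma factor_through_embedding:
  assumes A: "pretvs A" and V: "pretvs V" and W: "pretvs W" and e: "tvs_embedding V W e"
    and g: "continuous_linear A W g" and im: "g ` carrier A \<subseteq> e ` carrier V"
  obtains h where "continuous_linear A V h" "\<And>a. a \<in> carrier A \<Longrightarrow> e (h a) = g a"
proof -
  have "pretvs_map V W e" "pretvs_map A W g"
    using assms by (auto intro!: pretvs_mapI simp: tvs_embedding_def continuous_linear_def)
  then interpret e: pretvs_map V W e + g: pretvs_map A W g .
  have "\<forall>a\<in>carrier A. \<exists>x\<in>carrier V. e x = g a" using im by (auto simp: image_subset_iff) (metis imageE)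
  then obtain h where h: "\<And>a. a \<in> carrier A \<Longrightarrow> h a \<in> carrier V \<and> e (h a) = g a" by metis
  have inj: "\<And>x y. x \<in> carrier V \<Longrightarrow> y \<in> carrier V \<Longrightarrow> e x = e y \<Longrightarrow> x = y"
    using e by (auto simp: tvs_embedding_def inj_on_def)
  have lin: "tvs_linear A V h"
    unfolding tvs_linear_def
  proof (intro conjI ballI allI)
    show "h \<in> carrier A \<rightarrow> carrier V" using h by auto
    show "h (x \<oplus>\<^bsub>A\<^esub> y) = h x \<oplus>\<^bsub>V\<^esub> h y" if "x \<in> carrier A" "y \<in> carrier A" for x y
      by (rule inj) (use that h in \<open>auto simp: e.add g.add\<close>)
    show "h (r \<odot>\<^bsub>A\<^esub> x) = r \<odot>\<^bsub>V\<^esub> h x" if "x \<in> carrier A" for x r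
      by (rule inj) (use that h in \<open>auto simp: e.smult g.smult\<close>)
  qed
  have "continuous_linear A V h"
  proof (rule continuous_linearI[OF A V lin])
    fix U assume "nbhd0 V U"
    then obtain O' where O': "nbhd0 W O'" "\<And>x. x \<in> carrier V \<Longrightarrow> e x \<in> O' \<Longrightarrow> x \<in> U"
      using e unfolding tvs_embedding_def by metis
    have "nbhd0 A {a \<in> carrier A. g a \<in> O'}" by (rule continuous_linear_nbhd0[OF A W g O'(1)])
    then show "nbhd0 A {a \<in> carrier A. h a \<in> U}"
      by (rule g.V.nbhd0_mono) (use h O'(2) in auto)
  qed
  with h show thesis using that by metis
qed

text \<open>
  The value at \<open>p\<close> is the limit of \<open>f a\<close> as \<open>e a\<close> tends to \<open>p\<close>: these values form a Cauchy filter
  because \<open>f\<close> is continuous for the topology induced by \<open>e\<close>. The relation \<open>good p l\<close> says that \<open>l\<close> is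
  such a limit; all properties of the extension are read off from it and from uniqueness of limits.
\<close>

lemma extend_from_dense:
  assumes A: "pretvs A" and P: "pretvs P" and X: "is_tvs X" and compl: "tvs_complete X"
    and e: "tvs_embedding A P e" and dense: "dense_image A P e"
    and f: "continuous_linear A X f"
  obtains g where "continuous_linear P X g" "\<And>a. a \<in> carrier A \<Longrightarrow> g (e a) = f a"
proof -
  have Xp: "pretvs X" using X by (simp add: is_tvs_iff)
  have "pretvs_map A P e" "pretvs_map A X f"
    using assms Xp by (auto intro!: pretvs_mapI simp: tvs_embedding_def continuous_linear_def)
  then interpret e: pretvs_map A P e + f: pretvs_map A X f .
  have near: "\<exists>V. nbhd0 P V \<and> (\<forall>a\<in>carrier A. e a \<in> V \<longrightarrow> f a \<in> U)" if U: "nbhd0 X U" for U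
  proof -
    obtain V where "nbhd0 P V" "\<forall>x\<in>carrier A. e x \<in> V \<longrightarrow> x \<in> {x \<in> carrier A. f x \<in> U}"
      using e continuous_linear_nbhd0[OF A Xp f U] unfolding tvs_embedding_def by metis
    then show ?thesis by (intro exI[of _ V]) auto
  qed
  have dn: "\<exists>a\<in>carrier A. e a \<ominus>\<^bsub>P\<^esub> p \<in> V" if "p \<in> carrier P" "nbhd0 P V" for p V
    using dense that unfolding dense_image_def by metis
  define good where "good p l \<longleftrightarrow> l \<in> carrier X \<and> (\<forall>U. nbhd0 X U \<longrightarrow>
     (\<exists>V. nbhd0 P V \<and> (\<forall>a\<in>carrier A. e a \<ominus>\<^bsub>P\<^esub> p \<in> V \<longrightarrow> f a \<ominus>\<^bsub>X\<^esub> l \<in> U)))" for p l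
  have goodD: "\<exists>V. nbhd0 P V \<and> (\<forall>a\<in>carrier A. e a \<ominus>\<^bsub>P\<^esub> p \<in> V \<longrightarrow> f a \<ominus>\<^bsub>X\<^esub> l \<in> U)"
    if "good p l" "nbhd0 X U" for p l U using that by (simp add: good_def)
  have good_carrier: "l \<in> carrier X" if "good p l" for p l using that by (simp add: good_def)
  have uniq: "l = m" if p: "p \<in> carrier P" and l: "good p l" and m: "good p m" for p l m
  proof -
    have lm: "l \<in> carrier X" "m \<in> carrier X" using l m by (auto simp: good_def)
    have "m \<ominus>\<^bsub>X\<^esub> l = \<zero>\<^bsub>X\<^esub>"
    proof (rule is_tvs_separated[OF X])
      show "m \<ominus>\<^bsub>X\<^esub> l \<in> carrier X" using lm by simp
      fix U assume "nbhd0 X U"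
      then obtain U' where U': "nbhd0 X U'" "\<And>x y. x \<in> U' \<Longrightarrow> y \<in> U' \<Longrightarrow> x \<ominus>\<^bsub>X\<^esub> y \<in> U"
        using f.W.nbhd0_halve_balanced by metis
      obtain V where V: "nbhd0 P V" "\<forall>a\<in>carrier A. e a \<ominus>\<^bsub>P\<^esub> p \<in> V \<longrightarrow> f a \<ominus>\<^bsub>X\<^esub> l \<in> U'"
        using goodD[OF l U'(1)] by metis
      obtain V' where V': "nbhd0 P V'" "\<forall>a\<in>carrier A. e a \<ominus>\<^bsub>P\<^esub> p \<in> V' \<longrightarrow> f a \<ominus>\<^bsub>X\<^esub> m \<in> U'"
        using goodD[OF m U'(1)] by metis
      obtain a where a: "a \<in> carrier A" "e a \<ominus>\<^bsub>P\<^esub> p \<in> V \<inter> V'"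
        using dn[OF p e.W.nbhd0_Int[OF V(1) V'(1)]] by metis
      then have "(f a \<ominus>\<^bsub>X\<^esub> l) \<ominus>\<^bsub>X\<^esub> (f a \<ominus>\<^bsub>X\<^esub> m) \<in> U" using U'(2) V(2) V'(2) by auto
      then show "m \<ominus>\<^bsub>X\<^esub> l \<in> U" using a lm by (simp add: f.W.diff_diff_cancel_left)
    qed
    then show ?thesis using lm by (simp add: f.W.diff_eq_zero_iff)
  qed
  have ex: "\<exists>l. good p l" if p: "p \<in> carrier P" for p
  proof -
    define B where "B = (\<lambda>V. f ` {a \<in> carrier A. e a \<ominus>\<^bsub>P\<^esub> p \<in> V}) ` Collect (nbhd0 P)"
    have "\<exists>R\<in>B. R \<subseteq> S \<inter> T" if ST: "S \<in> B" "T \<in> B" for S T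
    proof -
      obtain V V' where V: "nbhd0 P V" "nbhd0 P V'" "S = f ` {a \<in> carrier A. e a \<ominus>\<^bsub>P\<^esub> p \<in> V}"
        "T = f ` {a \<in> carrier A. e a \<ominus>\<^bsub>P\<^esub> p \<in> V'}" using ST unfolding B_def by auto
      have "f ` {a \<in> carrier A. e a \<ominus>\<^bsub>P\<^esub> p \<in> V \<inter> V'} \<in> B"
        unfolding B_def using e.W.nbhd0_Int[OF V(1,2)] by (intro imageI) simp
      then show ?thesis by (rule bexI[rotated]) (use V in auto)
    qed
    moreover have "B \<noteq> {}" unfolding B_def using e.W.nbhd0_carrier by (auto intro: exI[of _ "carrier P"])
    ultimately obtain F where F: "\<And>Q. eventually Q F \<longleftrightarrow> (\<exists>S\<in>B. \<forall>x\<in>S. Q x)"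
      using filter_from_base[of B] by metis
    have ev: "eventually Q F \<longleftrightarrow>
       (\<exists>V. nbhd0 P V \<and> (\<forall>a\<in>carrier A. e a \<ominus>\<^bsub>P\<^esub> p \<in> V \<longrightarrow> Q (f a)))" for Q
      unfolding F B_def by auto
    have "tvs_Cauchy_filter X F"
      unfolding f.W.tvs_Cauchy_filter_iff_nbhd0
    proof (intro conjI allI impI)
      show "F \<noteq> bot"
        unfolding trivial_limit_def ev using dn[OF p] by metis
      show "\<forall>\<^sub>F x in F. x \<in> carrier X"
        unfolding ev by (intro exI[of _ "carrier P"]) simp
      fix U assume "nbhd0 X U"
      then obtain V where V: "nbhd0 P V" "\<And>a. a \<in> carrier A \<Longrightarrow> e a \<in> V \<Longrightarrow> f a \<in> U"
        using near by metis
      obtain V' where V': "nbhd0 P V'" "\<And>x y. x \<in> V' \<Longrightarrow> y \<in> V' \<Longrightarrow> x \<ominus>\<^bsub>P\<^esub> y \<in> V"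
        using e.W.nbhd0_halve_balanced[OF V(1)] by metis
      let ?Q = "\<lambda>x. \<exists>a\<in>carrier A. e a \<ominus>\<^bsub>P\<^esub> p \<in> V' \<and> x = f a"
      have "eventually ?Q F" unfolding ev using V'(1) by auto
      moreover have "x \<ominus>\<^bsub>X\<^esub> y \<in> U" if xy: "?Q x" "?Q y" for x y
      proof -
        obtain a b where a: "a \<in> carrier A" "e a \<ominus>\<^bsub>P\<^esub> p \<in> V'" "x = f a"
          and b: "b \<in> carrier A" "e b \<ominus>\<^bsub>P\<^esub> p \<in> V'" "y = f b" using xy by auto
        have "e (a \<ominus>\<^bsub>A\<^esub> b) = (e a \<ominus>\<^bsub>P\<^esub> p) \<ominus>\<^bsub>P\<^esub> (e b \<ominus>\<^bsub>P\<^esub> p)"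
          using a b p by (simp add: e.diff e.W.diff_diff_cancel_right)
        then have "e (a \<ominus>\<^bsub>A\<^esub> b) \<in> V" using V'(2) a b by simp
        then have "f (a \<ominus>\<^bsub>A\<^esub> b) \<in> U" using V(2) a b by simp
        then show ?thesis using a b by (simp add: f.diff)
      qed
      ultimately show "\<exists>Q. eventually Q F \<and> (\<forall>x y. Q x \<longrightarrow> Q y \<longrightarrow> x \<ominus>\<^bsub>X\<^esub> y \<in> U)"
        by (intro exI[of _ ?Q]) simp
    qed
    then obtain l where "limitin (topo X) (\<lambda>x. x) l F" using compl unfolding tvs_complete_def by metis
    then have l: "l \<in> carrier X" "\<And>U. nbhd0 X U \<Longrightarrow> \<forall>\<^sub>F x in F. x \<in> carrier X \<and> x \<ominus>\<^bsub>X\<^esub> l \<in> U"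
      unfolding f.W.limitin_iff_nbhd0 by auto
    have "good p l" unfolding good_def
    proof (intro conjI allI impI l(1))
      fix U assume "nbhd0 X U"
      from l(2)[OF this] obtain V where "nbhd0 P V"
        "\<forall>a\<in>carrier A. e a \<ominus>\<^bsub>P\<^esub> p \<in> V \<longrightarrow> f a \<in> carrier X \<and> f a \<ominus>\<^bsub>X\<^esub> l \<in> U" unfolding ev by metis
      then show "\<exists>V. nbhd0 P V \<and> (\<forall>a\<in>carrier A. e a \<ominus>\<^bsub>P\<^esub> p \<in> V \<longrightarrow> f a \<ominus>\<^bsub>X\<^esub> l \<in> U)" by metis
    qed
    then show ?thesis ..
  qed
  define g where "g p = (SOME l. good p l)" for p
  have g: "good p (g p)" if "p \<in> carrier P" for p
    unfolding g_def by (rule someI_ex) (rule ex[OF that])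
  have gc: "g p \<in> carrier X" if "p \<in> carrier P" for p using g[OF that] by (simp add: good_def)
  have g_eqI: "g p = l" if "p \<in> carrier P" "good p l" for p l
    using uniq[OF that(1) g[OF that(1)] that(2)] .
  have on_e: "g (e a) = f a" if a: "a \<in> carrier A" for a
  proof (rule g_eqI)
    show "e a \<in> carrier P" using a by simp
    show "good (e a) (f a)" unfolding good_def
    proof (intro conjI allI impI)
      show "f a \<in> carrier X" using a by simp
      fix U assume "nbhd0 X U"
      then obtain V where V: "nbhd0 P V" "\<And>a. a \<in> carrier A \<Longrightarrow> e a \<in> V \<Longrightarrow> f a \<in> U"
        using near by metis
      have "f b \<ominus>\<^bsub>X\<^esub> f a \<in> U" if b: "b \<in> carrier A" "e b \<ominus>\<^bsub>P\<^esub> e a \<in> V" for b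
        using V(2)[of "b \<ominus>\<^bsub>A\<^esub> a"] a b by (simp add: e.diff f.diff)
      with V(1) show "\<exists>V. nbhd0 P V \<and> (\<forall>b\<in>carrier A. e b \<ominus>\<^bsub>P\<^esub> e a \<in> V \<longrightarrow> f b \<ominus>\<^bsub>X\<^esub> f a \<in> U)" by metis
    qed
  qed
  have "tvs_linear P X g"
    unfolding tvs_linear_def
  proof (intro conjI ballI allI)
    show "g \<in> carrier P \<rightarrow> carrier X" using gc by auto
    fix p assume p: "p \<in> carrier P"
    show "g (p \<oplus>\<^bsub>P\<^esub> q) = g p \<oplus>\<^bsub>X\<^esub> g q" if q: "q \<in> carrier P" for q
    proof (rule g_eqI)
      show "p \<oplus>\<^bsub>P\<^esub> q \<in> carrier P" using p q by simp
      show "good (p \<oplus>\<^bsub>P\<^esub> q) (g p \<oplus>\<^bsub>X\<^esub> g q)" unfolding good_def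
      proof (intro conjI allI impI)
        show "g p \<oplus>\<^bsub>X\<^esub> g q \<in> carrier X" using gc p q by simp
        fix U assume "nbhd0 X U"
        then obtain U' where U': "nbhd0 X U'" "\<And>x y. x \<in> U' \<Longrightarrow> y \<in> U' \<Longrightarrow> x \<oplus>\<^bsub>X\<^esub> y \<in> U"
          using f.W.nbhd0_halve by metis
        obtain V where V: "nbhd0 P V" "\<forall>a\<in>carrier A. e a \<ominus>\<^bsub>P\<^esub> p \<in> V \<longrightarrow> f a \<ominus>\<^bsub>X\<^esub> g p \<in> U'"
          using goodD[OF g[OF p] U'(1)] by metis
        obtain V' where V': "nbhd0 P V'" "\<forall>a\<in>carrier A. e a \<ominus>\<^bsub>P\<^esub> q \<in> V' \<longrightarrow> f a \<ominus>\<^bsub>X\<^esub> g q \<in> U'"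
          using goodD[OF g[OF q] U'(1)] by metis
        obtain T where T: "nbhd0 P T" "\<And>x y. x \<in> T \<Longrightarrow> y \<in> T \<Longrightarrow> x \<ominus>\<^bsub>P\<^esub> y \<in> V'"
          using e.W.nbhd0_halve_balanced[OF V'(1)] by metis
        \<comment> \<open>split a point near \<open>p + q\<close> into a point near \<open>p\<close> and one near \<open>q\<close>\<close>
        obtain b where b: "b \<in> carrier A" "e b \<ominus>\<^bsub>P\<^esub> p \<in> V \<inter> T"
          using dn[OF p e.W.nbhd0_Int[OF V(1) T(1)]] by metis
        have "f a \<ominus>\<^bsub>X\<^esub> (g p \<oplus>\<^bsub>X\<^esub> g q) \<in> U" if a: "a \<in> carrier A" "e a \<ominus>\<^bsub>P\<^esub> (p \<oplus>\<^bsub>P\<^esub> q) \<in> T" for a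
        proof -
          define c where "c = a \<ominus>\<^bsub>A\<^esub> b"
          have c: "c \<in> carrier A" "b \<oplus>\<^bsub>A\<^esub> c = a" using a b by (auto simp: c_def)
          have "e a \<ominus>\<^bsub>P\<^esub> (p \<oplus>\<^bsub>P\<^esub> q) = (e b \<ominus>\<^bsub>P\<^esub> p) \<oplus>\<^bsub>P\<^esub> (e c \<ominus>\<^bsub>P\<^esub> q)"
            using b c p q by (simp flip: c(2) add: e.add e.W.add_diff_add)
          then have "e c \<ominus>\<^bsub>P\<^esub> q = (e a \<ominus>\<^bsub>P\<^esub> (p \<oplus>\<^bsub>P\<^esub> q)) \<ominus>\<^bsub>P\<^esub> (e b \<ominus>\<^bsub>P\<^esub> p)"
            using b c p q by simp
          then have "e c \<ominus>\<^bsub>P\<^esub> q \<in> V'" using T(2) a b by simp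
          then have "(f b \<ominus>\<^bsub>X\<^esub> g p) \<oplus>\<^bsub>X\<^esub> (f c \<ominus>\<^bsub>X\<^esub> g q) \<in> U" using U'(2) V(2) V'(2) b c by simp
          moreover have "(f b \<ominus>\<^bsub>X\<^esub> g p) \<oplus>\<^bsub>X\<^esub> (f c \<ominus>\<^bsub>X\<^esub> g q) = f a \<ominus>\<^bsub>X\<^esub> (g p \<oplus>\<^bsub>X\<^esub> g q)"
            using b c gc p q by (simp flip: c(2) add: f.add f.W.add_diff_add)
          ultimately show ?thesis by simp
        qed
        with T(1) show "\<exists>V. nbhd0 P V \<and> (\<forall>a\<in>carrier A. e a \<ominus>\<^bsub>P\<^esub> (p \<oplus>\<^bsub>P\<^esub> q) \<in> V \<longrightarrow>
            f a \<ominus>\<^bsub>X\<^esub> (g p \<oplus>\<^bsub>X\<^esub> g q) \<in> U)" by metis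
      qed
    qed
    show "g (r \<odot>\<^bsub>P\<^esub> p) = r \<odot>\<^bsub>X\<^esub> g p" for r
    proof (cases "r = 0")
      case True
      then show ?thesis using on_e[of "\<zero>\<^bsub>A\<^esub>"] p gc by simp
    next
      case False
      show ?thesis
      proof (rule g_eqI)
        show "r \<odot>\<^bsub>P\<^esub> p \<in> carrier P" using p by simp
        show "good (r \<odot>\<^bsub>P\<^esub> p) (r \<odot>\<^bsub>X\<^esub> g p)" unfolding good_def
        proof (intro conjI allI impI)
          show "r \<odot>\<^bsub>X\<^esub> g p \<in> carrier X" using gc p by simp
          fix U assume U: "nbhd0 X U"
          define U' where "U' = {x \<in> carrier X. r \<odot>\<^bsub>X\<^esub> x \<in> U}"
          have "nbhd0 X U'" unfolding U'_def by (rule f.W.nbhd0_smult[OF U])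
          then obtain V where V: "nbhd0 P V" "\<forall>a\<in>carrier A. e a \<ominus>\<^bsub>P\<^esub> p \<in> V \<longrightarrow> f a \<ominus>\<^bsub>X\<^esub> g p \<in> U'"
            using goodD[OF g[OF p]] by metis
          have "f a \<ominus>\<^bsub>X\<^esub> r \<odot>\<^bsub>X\<^esub> g p \<in> U"
            if a: "a \<in> carrier A" "e a \<ominus>\<^bsub>P\<^esub> r \<odot>\<^bsub>P\<^esub> p \<in> {x \<in> carrier P. (1/r) \<odot>\<^bsub>P\<^esub> x \<in> V}" for a
          proof -
            let ?b = "(1/r) \<odot>\<^bsub>A\<^esub> a"
            have "(1/r) \<odot>\<^bsub>P\<^esub> (e a \<ominus>\<^bsub>P\<^esub> r \<odot>\<^bsub>P\<^esub> p) = e ?b \<ominus>\<^bsub>P\<^esub> p"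
              using a p False by (simp add: e.W.smult_diff e.W.smult_smult e.smult)
            then have "e ?b \<ominus>\<^bsub>P\<^esub> p \<in> V" using a by auto
            then have "r \<odot>\<^bsub>X\<^esub> (f ?b \<ominus>\<^bsub>X\<^esub> g p) \<in> U" using V(2) a by (auto simp: U'_def)
            moreover have "r \<odot>\<^bsub>X\<^esub> (f ?b \<ominus>\<^bsub>X\<^esub> g p) = f a \<ominus>\<^bsub>X\<^esub> r \<odot>\<^bsub>X\<^esub> g p"
              using a p False gc by (simp add: f.W.smult_diff f.W.smult_smult f.smult)
            ultimately show ?thesis by simp
          qed
          then show "\<exists>V. nbhd0 P V \<and> (\<forall>a\<in>carrier A. e a \<ominus>\<^bsub>P\<^esub> r \<odot>\<^bsub>P\<^esub> p \<in> V \<longrightarrow>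
              f a \<ominus>\<^bsub>X\<^esub> r \<odot>\<^bsub>X\<^esub> g p \<in> U)"
            using e.W.nbhd0_smult[OF V(1), of "1/r"]
            by (intro exI[of _ "{x \<in> carrier P. (1/r) \<odot>\<^bsub>P\<^esub> x \<in> V}"]) simp
        qed
      qed
    qed
  qed
  then have "continuous_linear P X g"
  proof (rule continuous_linearI[OF P Xp])
    fix U assume "nbhd0 X U"
    then obtain U' where U': "nbhd0 X U'" "\<And>x y. x \<in> U' \<Longrightarrow> y \<in> U' \<Longrightarrow> x \<ominus>\<^bsub>X\<^esub> y \<in> U"
      using f.W.nbhd0_halve_balanced by metis
    obtain V where V: "nbhd0 P V" "\<And>a. a \<in> carrier A \<Longrightarrow> e a \<in> V \<Longrightarrow> f a \<in> U'"
      using near[OF U'(1)] by metis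
    obtain V' where V': "nbhd0 P V'" "\<And>x y. x \<in> V' \<Longrightarrow> y \<in> V' \<Longrightarrow> x \<oplus>\<^bsub>P\<^esub> y \<in> V"
      using e.W.nbhd0_halve[OF V(1)] by metis
    show "nbhd0 P {p \<in> carrier P. g p \<in> U}"
    proof (rule e.W.nbhd0_mono[OF V'(1)])
      show "V' \<subseteq> {p \<in> carrier P. g p \<in> U}"
      proof
        fix p assume pV: "p \<in> V'"
        then have p: "p \<in> carrier P" using e.W.nbhd0_subset[OF V'(1)] by simp
        obtain T where T: "nbhd0 P T" "\<forall>a\<in>carrier A. e a \<ominus>\<^bsub>P\<^esub> p \<in> T \<longrightarrow> f a \<ominus>\<^bsub>X\<^esub> g p \<in> U'"
          using goodD[OF g[OF p] U'(1)] by metis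
        obtain a where a: "a \<in> carrier A" "e a \<ominus>\<^bsub>P\<^esub> p \<in> T \<inter> V'"
          using dn[OF p e.W.nbhd0_Int[OF T(1) V'(1)]] by metis
        \<comment> \<open>\<open>e a\<close> is close to zero, as \<open>p\<close> is, so \<open>f a\<close> is small and close to \<open>g p\<close>\<close>
        have "(e a \<ominus>\<^bsub>P\<^esub> p) \<oplus>\<^bsub>P\<^esub> p \<in> V" using V'(2) a pV by simp
        then have "f a \<in> U'" using a p V(2) by simp
        moreover have "f a \<ominus>\<^bsub>X\<^esub> g p \<in> U'" using T(2) a by simp
        ultimately have "f a \<ominus>\<^bsub>X\<^esub> (f a \<ominus>\<^bsub>X\<^esub> g p) \<in> U" by (rule U'(2))
        then show "p \<in> {p \<in> carrier P. g p \<in> U}" using a p gc by (simp add: f.W.diff_diff_self)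
      qed
    qed auto
  qed
  then show thesis using that on_e by metis
qed

lemma is_completion_embedding:
  assumes "is_tvs Z" "is_completion Z W j"
  shows "tvs_embedding Z W j" "dense_image Z W j"
proof -
  have ZW: "pretvs Z" "pretvs W" using assms by (auto simp: is_completion_def is_tvs_iff)
  have "tvs_linear Z W j" using assms by (auto simp: is_completion_def)
  with ZW have "pretvs_map Z W j" by (intro pretvs_mapI)
  then interpret pretvs_map Z W j .
  have h: "homeomorphic_map (topo Z) (subtopology (topo W) (j ` carrier Z)) j"
    using assms by (auto simp: is_completion_def embedding_map_def)
  have inj: "inj_on j (carrier Z)" using homeomorphic_imp_injective_map[OF h] by simp
  have "continuous_map (topo Z) (topo W) j"
    using homeomorphic_imp_continuous_map[OF h] by (simp add: continuous_map_in_subtopology)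
  moreover have "open_onto_image Z W j"
    unfolding open_onto_image_def using homeomorphic_imp_open_map[OF h] .
  ultimately show "tvs_embedding Z W j"
    unfolding tvs_embedding_def continuous_linear_def
  proof (intro conjI allI impI linear inj)
    fix U assume U: "nbhd0 Z U"
    with \<open>open_onto_image Z W j\<close> obtain O' where O': "nbhd0 W O'" "O' \<inter> j ` carrier Z \<subseteq> j ` U"
      unfolding open_onto_image_iff_nbhd0 by metis
    have "x \<in> U" if "x \<in> carrier Z" "j x \<in> O'" for x
    proof -
      have "j x \<in> j ` U" using O'(2) that by auto
      then show ?thesis using inj V.nbhd0_subset[OF U] that(1) by (auto simp: inj_on_def)
    qed
    with O'(1) show "\<exists>O'. nbhd0 W O' \<and> (\<forall>x\<in>carrier Z. j x \<in> O' \<longrightarrow> x \<in> U)" by metis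
  qed
  show "dense_image Z W j" unfolding dense_image_def
  proof (intro ballI allI impI)
    fix w U assume w: "w \<in> carrier W" and "nbhd0 W U"
    then obtain A where A: "openin (topo W) A" "w \<in> A" "\<And>x. x \<in> A \<Longrightarrow> x \<ominus>\<^bsub>W\<^esub> w \<in> U"
      using W.openin_translate_nbhd0 by metis
    have "w \<in> topo W closure_of (j ` carrier Z)" using assms w by (simp add: is_completion_def)
    then obtain y where "y \<in> j ` carrier Z" "y \<in> A" using A(1,2) unfolding in_closure_of by metis
    then show "\<exists>x\<in>carrier Z. j x \<ominus>\<^bsub>W\<^esub> w \<in> U" using A(3) by auto
  qed
qed

section \<open>Extensions and their restrictions\<close>

locale tvs_extension = Z: pretvs Z + Y: pretvs Y
  for Z :: "'z tvs" and Y :: "'y tvs" +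
  fixes E :: "('y, 'x, 'z) extension"
  assumes ext: "is_extension Z Y E"
begin

sublocale X: pretvs "middle E"
  using ext by (simp add: is_extension_def is_tvs_iff)

sublocale i: pretvs_map Y "middle E" "incl E"
  using ext by (intro pretvs_mapI) (simp_all add: is_extension_def continuous_linear_def Y.pretvs_axioms X.pretvs_axioms)

sublocale p: pretvs_map "middle E" Z "proj E"
  using ext by (intro pretvs_mapI) (simp_all add: is_extension_def continuous_linear_def Z.pretvs_axioms X.pretvs_axioms)

lemma middle_tvs: "is_tvs (middle E)"
  using ext by (simp add: is_extension_def)

lemma incl_inj: "y \<in> carrier Y \<Longrightarrow> y' \<in> carrier Y \<Longrightarrow> incl E y = incl E y' \<longleftrightarrow> y = y'"
  using ext by (auto simp: is_extension_def inj_on_def)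

lemma proj_incl [simp]: "y \<in> carrier Y \<Longrightarrow> proj E (incl E y) = \<zero>\<^bsub>Z\<^esub>"
  using ext by (auto simp: is_extension_def)

lemma proj_zeroE:
  assumes "x \<in> carrier (middle E)" "proj E x = \<zero>\<^bsub>Z\<^esub>"
  obtains y where "y \<in> carrier Y" "x = incl E y"
proof -
  have "x \<in> incl E ` carrier Y" using ext assms by (simp add: is_extension_def)
  then show thesis using that by auto
qed

lemma proj_surjE:
  assumes "z \<in> carrier Z" obtains x where "x \<in> carrier (middle E)" "proj E x = z"
proof -
  have "z \<in> proj E ` carrier (middle E)" using ext assms by (simp add: is_extension_def)
  then show thesis using that by auto
qed

lemma nbhd0_incl_vimage: "nbhd0 (middle E) U \<Longrightarrow> nbhd0 Y {y \<in> carrier Y. incl E y \<in> U}"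
  using ext i.continuous_iff_nbhd0 by (simp add: is_extension_def continuous_linear_def)

lemma nbhd0_proj_vimage: "nbhd0 Z U \<Longrightarrow> nbhd0 (middle E) {x \<in> carrier (middle E). proj E x \<in> U}"
  using ext p.continuous_iff_nbhd0 by (simp add: is_extension_def continuous_linear_def)

lemma incl_openE:
  assumes "nbhd0 Y U"
  obtains O' where "nbhd0 (middle E) O'" "\<And>y. y \<in> carrier Y \<Longrightarrow> incl E y \<in> O' \<Longrightarrow> y \<in> U"
proof -
  obtain O' where O': "nbhd0 (middle E) O'" "O' \<inter> incl E ` carrier Y \<subseteq> incl E ` U"
    using ext assms unfolding is_extension_def i.open_onto_image_iff_nbhd0 by metis
  have "y \<in> U" if "y \<in> carrier Y" "incl E y \<in> O'" for y
  proof -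
    have "incl E y \<in> incl E ` U" using O' that by auto
    then show ?thesis using incl_inj Y.nbhd0_subset[OF assms] that(1) by auto
  qed
  with O'(1) show thesis using that by metis
qed

lemma nbhd0_proj_image:
  assumes "nbhd0 (middle E) U" shows "nbhd0 Z (proj E ` U)"
proof -
  obtain O' where O': "nbhd0 Z O'" "O' \<inter> proj E ` carrier (middle E) \<subseteq> proj E ` U"
    using ext assms unfolding is_extension_def p.open_onto_image_iff_nbhd0 by metis
  have "proj E ` carrier (middle E) = carrier Z" using ext by (simp add: is_extension_def)
  with O' have "O' \<subseteq> proj E ` U" using Z.nbhd0_subset[OF O'(1)] by auto
  with O'(1) show ?thesis
    by (rule Z.nbhd0_mono) (use X.nbhd0_subset[OF assms] in auto)
qed

end

text \<open>Injectivity of the inclusion comes from \<open>i2\<close>, as \<open>Y\<close> is Hausdorff, and surjectivity of the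
  projection from \<open>p2\<close>, as a linear subspace that is a neighbourhood of zero is everything.\<close>

lemma is_extensionI:
  assumes Z: "pretvs Z" and Y: "is_tvs Y" and X: "is_tvs (middle E)"
    and "tvs_linear Y (middle E) (incl E)" "tvs_linear (middle E) Z (proj E)"
    and i1: "\<And>U. nbhd0 (middle E) U \<Longrightarrow> nbhd0 Y {y \<in> carrier Y. incl E y \<in> U}"
    and i2: "\<And>U. nbhd0 Y U \<Longrightarrow> \<exists>O'. nbhd0 (middle E) O' \<and> (\<forall>y\<in>carrier Y. incl E y \<in> O' \<longrightarrow> y \<in> U)"
    and p1: "\<And>U. nbhd0 Z U \<Longrightarrow> nbhd0 (middle E) {x \<in> carrier (middle E). proj E x \<in> U}"
    and p2: "\<And>U. nbhd0 (middle E) U \<Longrightarrow> nbhd0 Z (proj E ` U)"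
    and c: "\<And>y. y \<in> carrier Y \<Longrightarrow> proj E (incl E y) = \<zero>\<^bsub>Z\<^esub>"
    and ker: "\<And>x. x \<in> carrier (middle E) \<Longrightarrow> proj E x = \<zero>\<^bsub>Z\<^esub> \<Longrightarrow> x \<in> incl E ` carrier Y"
  shows "is_extension Z Y E"
proof -
  have Yp: "pretvs Y" and Xp: "pretvs (middle E)" using X Y by (auto simp: is_tvs_iff)
  have "pretvs_map Y (middle E) (incl E)" "pretvs_map (middle E) Z (proj E)"
    using assms Yp Xp by (auto intro!: pretvs_mapI)
  then interpret i: pretvs_map Y "middle E" "incl E" + p: pretvs_map "middle E" Z "proj E" .
  show ?thesis unfolding is_extension_def continuous_linear_def
  proof (intro conjI X i.linear p.linear)
    show "continuous_map (topo Y) (topo (middle E)) (incl E)"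
      unfolding i.continuous_iff_nbhd0 using i1 by auto
    show "continuous_map (topo (middle E)) (topo Z) (proj E)"
      unfolding p.continuous_iff_nbhd0 using p1 by auto
    show "open_onto_image Y (middle E) (incl E)"
      unfolding i.open_onto_image_iff_nbhd0
    proof (intro allI impI)
      fix U assume "nbhd0 Y U"
      with i2 obtain O' where "nbhd0 (middle E) O'" "\<forall>y\<in>carrier Y. incl E y \<in> O' \<longrightarrow> y \<in> U" by metis
      then show "\<exists>O'. nbhd0 (middle E) O' \<and> O' \<inter> incl E ` carrier Y \<subseteq> incl E ` U"
        by (intro exI[of _ O']) auto
    qed
    show "open_onto_image (middle E) Z (proj E)"
      unfolding p.open_onto_image_iff_nbhd0 using p2 by (auto intro!: exI[of _ "proj E ` _"])
    show "inj_on (incl E) (carrier Y)"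
    proof (rule i.inj_onI)
      fix y assume y: "y \<in> carrier Y" "incl E y = \<zero>\<^bsub>middle E\<^esub>"
      show "y = \<zero>\<^bsub>Y\<^esub>"
      proof (rule is_tvs_separated[OF Y y(1)])
        fix U assume "nbhd0 Y U"
        with i2 obtain O' where "nbhd0 (middle E) O'" "\<forall>y\<in>carrier Y. incl E y \<in> O' \<longrightarrow> y \<in> U" by metis
        with y show "y \<in> U" using i.W.nbhd0_zero by metis
      qed
    qed
    show "incl E ` carrier Y = {x \<in> carrier (middle E). proj E x = \<zero>\<^bsub>Z\<^esub>}"
      using c ker by auto
    show "proj E ` carrier (middle E) = carrier Z"
    proof (intro equalityI subsetI)
      fix z assume z: "z \<in> carrier Z"
      have "nbhd0 Z (proj E ` carrier (middle E))" by (rule p2) simp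
      from p.W.nbhd0_absorbing[OF this z] obtain e where
        e: "e > 0" "\<And>r. \<bar>r\<bar> \<le> e \<Longrightarrow> r \<odot>\<^bsub>Z\<^esub> z \<in> proj E ` carrier (middle E)" by metis
      from e(1) e(2)[of e] obtain x where x: "x \<in> carrier (middle E)" "e \<odot>\<^bsub>Z\<^esub> z = proj E x" by auto
      have "z = (1/e) \<odot>\<^bsub>Z\<^esub> (e \<odot>\<^bsub>Z\<^esub> z)" using e(1) z by (simp add: p.W.smult_smult)
      also have "\<dots> = proj E ((1/e) \<odot>\<^bsub>middle E\<^esub> x)" using x by (simp add: p.smult)
      finally show "z \<in> proj E ` carrier (middle E)" using x by auto
    qed auto
  qed
qed

subsection \<open>Completeness of extensions\<close>

text \<open>
  Let \<open>F\<close> be a Cauchy filter on the middle space. Its image in \<open>Z\<close> converges to some \<open>proj E a\<close>. So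
  for every neighbourhood \<open>U\<close> the elements \<open>x\<close> far out in \<open>F\<close> satisfy \<open>x - a - y \<in> U\<close> for some \<open>y\<close> in
  \<open>Y\<close>. These \<open>y\<close> form a Cauchy filter on \<open>Y\<close>, with a limit \<open>y\<close>, and then \<open>a + y\<close> is the limit of \<open>F\<close>.
\<close>

theorem (in tvs_extension) complete_middle:
  assumes "tvs_complete Y" "tvs_complete Z"
  shows "tvs_complete (middle E)"
  unfolding tvs_complete_def
proof (intro allI impI)
  fix F assume "tvs_Cauchy_filter (middle E) F"
  then have F: "F \<noteq> bot" "\<forall>\<^sub>F x in F. x \<in> carrier (middle E)"
    and FC: "\<And>U. nbhd0 (middle E) U \<Longrightarrow>
      \<exists>Q. eventually Q F \<and> (\<forall>x y. Q x \<longrightarrow> Q y \<longrightarrow> x \<ominus>\<^bsub>middle E\<^esub> y \<in> U)"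
    unfolding X.tvs_Cauchy_filter_iff_nbhd0 by auto
  have "tvs_Cauchy_filter Z (filtermap (proj E) F)"
    unfolding Z.tvs_Cauchy_filter_iff_nbhd0
  proof (intro conjI allI impI)
    show "filtermap (proj E) F \<noteq> bot" using F(1) by (simp add: filtermap_bot_iff)
    show "\<forall>\<^sub>F x in filtermap (proj E) F. x \<in> carrier Z"
      unfolding eventually_filtermap using F(2) by (rule eventually_mono) auto
    fix U assume "nbhd0 Z U"
    from FC[OF nbhd0_proj_vimage[OF this]] obtain Q where Q: "eventually Q F"
      "\<And>x y. Q x \<Longrightarrow> Q y \<Longrightarrow> x \<ominus>\<^bsub>middle E\<^esub> y \<in> {x \<in> carrier (middle E). proj E x \<in> U}" by auto
    let ?Q = "\<lambda>z. \<exists>x\<in>carrier (middle E). Q x \<and> z = proj E x"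
    have "eventually ?Q (filtermap (proj E) F)"
      unfolding eventually_filtermap using eventually_conj[OF F(2) Q(1)] by (rule eventually_mono) auto
    moreover have "z \<ominus>\<^bsub>Z\<^esub> z' \<in> U" if zz: "?Q z" "?Q z'" for z z'
    proof -
      obtain x x' where "x \<in> carrier (middle E)" "Q x" "z = proj E x"
        "x' \<in> carrier (middle E)" "Q x'" "z' = proj E x'" using zz by auto
      then show ?thesis using Q(2)[of x x'] by (simp add: p.diff)
    qed
    ultimately show "\<exists>Q. eventually Q (filtermap (proj E) F) \<and> (\<forall>x y. Q x \<longrightarrow> Q y \<longrightarrow> x \<ominus>\<^bsub>Z\<^esub> y \<in> U)"
      by (intro exI[of _ ?Q]) auto
  qed
  then obtain z where "limitin (topo Z) (\<lambda>x. x) z (filtermap (proj E) F)"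
    using assms(2) unfolding tvs_complete_def by metis
  then have z: "z \<in> carrier Z" "\<And>U. nbhd0 Z U \<Longrightarrow> \<forall>\<^sub>F x in F. proj E x \<ominus>\<^bsub>Z\<^esub> z \<in> U"
    unfolding Z.limitin_iff_nbhd0 eventually_filtermap by (auto elim!: eventually_mono)
  obtain a where a: "a \<in> carrier (middle E)" "proj E a = z" using proj_surjE[OF z(1)] by metis
  define d where "d x y = x \<ominus>\<^bsub>middle E\<^esub> a \<ominus>\<^bsub>middle E\<^esub> incl E y" for x y
  have d_closed: "d x y \<in> carrier (middle E)" if "x \<in> carrier (middle E)" "y \<in> carrier Y" for x y
    using that a by (simp add: d_def)
  have lift: "\<exists>y\<in>carrier Y. d x y \<in> U"
    if lf: "nbhd0 (middle E) U" "x \<in> carrier (middle E)" "proj E x \<ominus>\<^bsub>Z\<^esub> z \<in> proj E ` U" for U x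
  proof -
    obtain u where u: "u \<in> U" "proj E x \<ominus>\<^bsub>Z\<^esub> z = proj E u" using lf(3) by auto
    have uc: "u \<in> carrier (middle E)" using X.nbhd0_subset lf(1) u(1) by metis
    have "proj E (x \<ominus>\<^bsub>middle E\<^esub> a \<ominus>\<^bsub>middle E\<^esub> u) = \<zero>\<^bsub>Z\<^esub>"
      using lf(2) a uc u(2) by (simp add: p.diff)
    moreover have "x \<ominus>\<^bsub>middle E\<^esub> a \<ominus>\<^bsub>middle E\<^esub> u \<in> carrier (middle E)" using lf(2) a uc by simp
    ultimately obtain y where y: "y \<in> carrier Y" "x \<ominus>\<^bsub>middle E\<^esub> a \<ominus>\<^bsub>middle E\<^esub> u = incl E y"
      using proj_zeroE by metis
    have "d x y = u"
      unfolding d_def y(2)[symmetric] using lf(2) a uc by (simp add: X.diff_diff_self)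
    then show ?thesis using u y by auto
  qed
  \<comment> \<open>the points of \<open>Y\<close> within \<open>U\<close> of some \<open>x - a\<close> with \<open>Q x\<close>; these sets generate the filter on \<open>Y\<close>\<close>
  define S where "S Q U = {y \<in> carrier Y. \<exists>x\<in>carrier (middle E). Q x \<and> d x y \<in> U}" for Q U
  define B where "B = {S Q U |Q U. eventually Q F \<and> nbhd0 (middle E) U}"
  have "\<exists>R\<in>B. R \<subseteq> A \<inter> A'" if AA: "A \<in> B" "A' \<in> B" for A A'
  proof -
    obtain Q U Q' U' where "A = S Q U" "eventually Q F" "nbhd0 (middle E) U"
      "A' = S Q' U'" "eventually Q' F" "nbhd0 (middle E) U'" using AA unfolding B_def by auto
    then have "S (\<lambda>x. Q x \<and> Q' x) (U \<inter> U') \<in> B" "S (\<lambda>x. Q x \<and> Q' x) (U \<inter> U') \<subseteq> A \<inter> A'"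
      unfolding B_def using eventually_conj X.nbhd0_Int by (blast, auto simp: S_def)
    then show ?thesis by auto
  qed
  moreover have "S (\<lambda>_. True) (carrier (middle E)) \<in> B" unfolding B_def
    using X.nbhd0_carrier by (blast intro: always_eventually)
  ultimately obtain H where "\<And>P. eventually P H \<longleftrightarrow> (\<exists>S\<in>B. \<forall>x\<in>S. P x)"
    using filter_from_base[of B] by (metis empty_iff)
  then have H: "eventually P H \<longleftrightarrow>
      (\<exists>Q U. eventually Q F \<and> nbhd0 (middle E) U \<and> (\<forall>y\<in>S Q U. P y))" for P
    unfolding B_def by auto
  have near: "\<forall>\<^sub>F x in F. x \<in> carrier (middle E) \<and> (\<exists>y\<in>carrier Y. d x y \<in> U)"
    if U: "nbhd0 (middle E) U" for U
    using F(2) z(2)[OF nbhd0_proj_image[OF U]] by eventually_elim (use lift[OF U] in auto)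
  have "tvs_Cauchy_filter Y H"
    unfolding Y.tvs_Cauchy_filter_iff_nbhd0
  proof (intro conjI allI impI)
    show "H \<noteq> bot"
      unfolding trivial_limit_def H
    proof (intro notI, elim exE conjE)
      fix Q U assume QU: "eventually Q F" "nbhd0 (middle E) U" "\<forall>y\<in>S Q U. False"
      have "\<forall>\<^sub>F x in F. False"
        using near[OF QU(2)] QU(1) by eventually_elim (use QU(3) in \<open>auto simp: S_def\<close>)
      then show False using F(1) by (simp add: trivial_limit_def)
    qed
    show "\<forall>\<^sub>F x in H. x \<in> carrier Y" unfolding H
      by (rule exI[of _ "\<lambda>_. True"], rule exI[of _ "carrier (middle E)"]) (simp add: S_def)
    fix U assume "nbhd0 Y U"
    then obtain A where A: "nbhd0 (middle E) A" "\<And>y. y \<in> carrier Y \<Longrightarrow> incl E y \<in> A \<Longrightarrow> y \<in> U"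
      using incl_openE by metis
    obtain A' where A': "nbhd0 (middle E) A'" "\<And>x y. x \<in> A' \<Longrightarrow> y \<in> A' \<Longrightarrow> x \<ominus>\<^bsub>middle E\<^esub> y \<in> A"
      using X.nbhd0_halve_balanced[OF A(1)] by metis
    obtain T where T: "nbhd0 (middle E) T" "\<And>x y. x \<in> T \<Longrightarrow> y \<in> T \<Longrightarrow> x \<ominus>\<^bsub>middle E\<^esub> y \<in> A'"
      using X.nbhd0_halve_balanced[OF A'(1)] by metis
    obtain Q where Q: "eventually Q F" "\<And>x y. Q x \<Longrightarrow> Q y \<Longrightarrow> x \<ominus>\<^bsub>middle E\<^esub> y \<in> A'"
      using FC[OF A'(1)] by metis
    have "y \<ominus>\<^bsub>Y\<^esub> y' \<in> U" if yy: "y \<in> S Q T" "y' \<in> S Q T" for y y'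
    proof -
      obtain x x' where x: "y \<in> carrier Y" "x \<in> carrier (middle E)" "Q x" "d x y \<in> T"
        "y' \<in> carrier Y" "x' \<in> carrier (middle E)" "Q x'" "d x' y' \<in> T" using yy unfolding S_def by auto
      have "(x \<ominus>\<^bsub>middle E\<^esub> x') \<ominus>\<^bsub>middle E\<^esub> (d x y \<ominus>\<^bsub>middle E\<^esub> d x' y') \<in> A"
        using x by (intro A'(2) Q(2) T(2))
      moreover have "d x y \<ominus>\<^bsub>middle E\<^esub> d x' y' =
          (x \<ominus>\<^bsub>middle E\<^esub> x') \<ominus>\<^bsub>middle E\<^esub> (incl E y \<ominus>\<^bsub>middle E\<^esub> incl E y')"
        unfolding d_def using x a
        by (subst X.diff_diff_diff) (simp_all add: X.diff_diff_cancel_right)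
      ultimately have "incl E (y \<ominus>\<^bsub>Y\<^esub> y') \<in> A"
        using x by (simp add: X.diff_diff_self i.diff)
      then show ?thesis using A(2) x by simp
    qed
    moreover have "eventually (\<lambda>y. y \<in> S Q T) H" unfolding H using Q(1) T(1) by auto
    ultimately show "\<exists>Q. eventually Q H \<and> (\<forall>x y. Q x \<longrightarrow> Q y \<longrightarrow> x \<ominus>\<^bsub>Y\<^esub> y \<in> U)"
      by (intro exI[of _ "\<lambda>y. y \<in> S Q T"]) simp
  qed
  then obtain y where "limitin (topo Y) (\<lambda>x. x) y H" using assms(1) unfolding tvs_complete_def by metis
  then have y: "y \<in> carrier Y" "\<And>U. nbhd0 Y U \<Longrightarrow> \<forall>\<^sub>F x in H. x \<in> carrier Y \<and> x \<ominus>\<^bsub>Y\<^esub> y \<in> U"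
    unfolding Y.limitin_iff_nbhd0 by auto
  have "limitin (topo (middle E)) (\<lambda>x. x) (a \<oplus>\<^bsub>middle E\<^esub> incl E y) F"
    unfolding X.limitin_iff_nbhd0
  proof (intro conjI allI impI)
    show "a \<oplus>\<^bsub>middle E\<^esub> incl E y \<in> carrier (middle E)" using a y by simp
    fix U assume "nbhd0 (middle E) U"
    then obtain U' where U': "nbhd0 (middle E) U'" "\<And>x y. x \<in> U' \<Longrightarrow> y \<in> U' \<Longrightarrow> x \<oplus>\<^bsub>middle E\<^esub> y \<in> U"
      using X.nbhd0_halve by metis
    obtain Q V where QV: "eventually Q F" "nbhd0 (middle E) V"
      "\<And>y'. y' \<in> S Q V \<Longrightarrow> y' \<in> carrier Y \<and> y' \<ominus>\<^bsub>Y\<^esub> y \<in> {y \<in> carrier Y. incl E y \<in> U'}"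
      using y(2)[OF nbhd0_incl_vimage[OF U'(1)]] unfolding H by blast
    show "\<forall>\<^sub>F x in F. x \<in> carrier (middle E) \<and> x \<ominus>\<^bsub>middle E\<^esub> (a \<oplus>\<^bsub>middle E\<^esub> incl E y) \<in> U"
      using near[OF X.nbhd0_Int[OF QV(2) U'(1)]] QV(1)
    proof eventually_elim
      case (elim x)
      then obtain y' where y': "x \<in> carrier (middle E)" "y' \<in> carrier Y" "d x y' \<in> V" "d x y' \<in> U'" by auto
      with elim have "y' \<in> S Q V" unfolding S_def by auto
      from QV(3)[OF this] y y' have "incl E y' \<ominus>\<^bsub>middle E\<^esub> incl E y \<in> U'" by (simp add: i.diff)
      with U'(2) y'(4) have "d x y' \<oplus>\<^bsub>middle E\<^esub> (incl E y' \<ominus>\<^bsub>middle E\<^esub> incl E y) \<in> U" by metis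
      moreover have "d x y' \<oplus>\<^bsub>middle E\<^esub> (incl E y' \<ominus>\<^bsub>middle E\<^esub> incl E y) =
          x \<ominus>\<^bsub>middle E\<^esub> a \<ominus>\<^bsub>middle E\<^esub> incl E y"
        unfolding d_def using y y' a by (simp add: X.diff_add_diff)
      moreover have "\<dots> = x \<ominus>\<^bsub>middle E\<^esub> (a \<oplus>\<^bsub>middle E\<^esub> incl E y)"
        using y y' a by (simp add: a_minus_def X.minus_add X.a_assoc)
      ultimately show ?case using y' by simp
    qed
  qed
  then show "\<exists>l. limitin (topo (middle E)) (\<lambda>x. x) l F" ..
qed

subsection \<open>Morphisms of extensions that are the identity on the subspace\<close>

text \<open>For \<open>j\<close> the identity this is the relation that defines equivalence of extensions.\<close>

definition restriction_map ::
  "'y tvs \<Rightarrow> ('z \<Rightarrow> 'w) \<Rightarrow> ('y, 'u, 'z) extension \<Rightarrow> ('y, 'x, 'w) extension \<Rightarrow> ('u \<Rightarrow> 'x) \<Rightarrow> bool"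
  where
  "restriction_map Y j E' E R \<longleftrightarrow> continuous_linear (middle E') (middle E) R \<and>
     (\<forall>y\<in>carrier Y. R (incl E' y) = incl E y) \<and>
     (\<forall>x\<in>carrier (middle E'). proj E (R x) = j (proj E' x))"

lemma ext_equiv_iff: "ext_equiv Z Y E E' \<longleftrightarrow> (\<exists>T. restriction_map Y (\<lambda>z. z) E E' T)"
  by (simp add: ext_equiv_def restriction_map_def)

locale restriction = E': tvs_extension Z Y E' + E: tvs_extension W Y E
  for Z :: "'z tvs" and Y :: "'y tvs" and E' :: "('y, 'u, 'z) extension"
    and W :: "'w tvs" and E :: "('y, 'x, 'w) extension" +
  fixes j :: "'z \<Rightarrow> 'w" and R :: "'u \<Rightarrow> 'x"
  assumes j: "tvs_embedding Z W j" and R: "restriction_map Y j E' E R"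
begin

sublocale j: pretvs_map Z W j
  using j by (intro pretvs_mapI E'.Z.pretvs_axioms E.Z.pretvs_axioms)
    (simp add: tvs_embedding_def continuous_linear_def)

sublocale R: pretvs_map "middle E'" "middle E" R
  using R by (intro pretvs_mapI E'.X.pretvs_axioms E.X.pretvs_axioms)
    (simp add: restriction_map_def continuous_linear_def)

lemma j_inj: "z \<in> carrier Z \<Longrightarrow> z' \<in> carrier Z \<Longrightarrow> j z = j z' \<longleftrightarrow> z = z'"
  using j by (auto simp: tvs_embedding_def inj_on_def)

lemma R_incl [simp]: "y \<in> carrier Y \<Longrightarrow> R (incl E' y) = incl E y"
  using R by (simp add: restriction_map_def)

lemma proj_R [simp]: "x \<in> carrier (middle E') \<Longrightarrow> proj E (R x) = j (proj E' x)"
  using R by (simp add: restriction_map_def)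

lemma R_surjE:
  assumes "x \<in> carrier (middle E)" "z \<in> carrier Z" "proj E x = j z"
  obtains x' where "x' \<in> carrier (middle E')" "R x' = x" "proj E' x' = z"
proof -
  obtain a where a: "a \<in> carrier (middle E')" "proj E' a = z" using E'.proj_surjE assms(2) by metis
  have "proj E (x \<ominus>\<^bsub>middle E\<^esub> R a) = \<zero>\<^bsub>W\<^esub>" using a assms by (simp add: E.p.diff)
  then obtain y where y: "y \<in> carrier Y" "x \<ominus>\<^bsub>middle E\<^esub> R a = incl E y"
    using E.proj_zeroE[of "x \<ominus>\<^bsub>middle E\<^esub> R a"] a assms by auto
  have "R (a \<oplus>\<^bsub>middle E'\<^esub> incl E' y) = R a \<oplus>\<^bsub>middle E\<^esub> (x \<ominus>\<^bsub>middle E\<^esub> R a)"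
    using a y by (simp add: R.add)
  also have "\<dots> = x" using a assms by simp
  finally have "R (a \<oplus>\<^bsub>middle E'\<^esub> incl E' y) = x" .
  moreover have "proj E' (a \<oplus>\<^bsub>middle E'\<^esub> incl E' y) = z" using a y assms(2) by (simp add: E'.p.add)
  ultimately show thesis using that[of "a \<oplus>\<^bsub>middle E'\<^esub> incl E' y"] a y by simp
qed

text \<open>
  Only the continuity of the inverse needs an idea. Let \<open>R x\<close> be small and with small projection. As
  \<open>j\<close> is an embedding and \<open>proj E'\<close> is open, \<open>x\<close> has the same projection as some small \<open>v\<close>. Then
  \<open>x - v\<close> lies in \<open>Y\<close>, and it is small because its image \<open>R x - R v\<close> is small and both inclusions
  of \<open>Y\<close> are embeddings. So \<open>x = v + (x - v)\<close> is small.
\<close>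

lemma R_embedding: "tvs_embedding (middle E') (middle E) R"
  unfolding tvs_embedding_def
proof (intro conjI allI impI)
  show "continuous_linear (middle E') (middle E) R" using R by (simp add: restriction_map_def)
  show inj: "inj_on R (carrier (middle E'))"
  proof (rule R.inj_onI)
    fix x assume x: "x \<in> carrier (middle E')" "R x = \<zero>\<^bsub>middle E\<^esub>"
    then have "j (proj E' x) = j \<zero>\<^bsub>Z\<^esub>" by (metis proj_R E.p.zero j.zero)
    then have "proj E' x = \<zero>\<^bsub>Z\<^esub>" using x by (simp add: j_inj del: j.zero)
    then obtain y where y: "y \<in> carrier Y" "x = incl E' y" using E'.proj_zeroE x(1) by metis
    then have "incl E y = incl E \<zero>\<^bsub>Y\<^esub>" using x(2) by simp
    then have "y = \<zero>\<^bsub>Y\<^esub>" using y(1) by (simp add: E.incl_inj del: E.i.zero)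
    then show "x = \<zero>\<^bsub>middle E'\<^esub>" using y by simp
  qed
  fix U assume "nbhd0 (middle E') U"
  then obtain V where V: "nbhd0 (middle E') V" "\<And>x y. x \<in> V \<Longrightarrow> y \<in> V \<Longrightarrow> x \<oplus>\<^bsub>middle E'\<^esub> y \<in> U"
    using E'.X.nbhd0_halve by metis
  obtain O' where O': "nbhd0 (middle E) O'"
    "\<And>y. y \<in> carrier Y \<Longrightarrow> incl E y \<in> O' \<Longrightarrow> y \<in> {y \<in> carrier Y. incl E' y \<in> V}"
    using E.incl_openE[OF E'.nbhd0_incl_vimage[OF V(1)]] by blast
  obtain A where A: "nbhd0 (middle E) A" "\<And>x y. x \<in> A \<Longrightarrow> y \<in> A \<Longrightarrow> x \<ominus>\<^bsub>middle E\<^esub> y \<in> O'"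
    using E.X.nbhd0_halve_balanced[OF O'(1)] by metis
  define V' where "V' = V \<inter> {x \<in> carrier (middle E'). R x \<in> A}"
  have "nbhd0 (middle E') V'"
    unfolding V'_def
    by (intro E'.X.nbhd0_Int V(1) continuous_linear_nbhd0[OF E'.X.pretvs_axioms E.X.pretvs_axioms _ A(1)])
      (use R in \<open>simp add: restriction_map_def\<close>)
  then have "nbhd0 Z (proj E' ` V')" by (rule E'.nbhd0_proj_image)
  then obtain G where G: "nbhd0 W G" "\<And>z. z \<in> carrier Z \<Longrightarrow> j z \<in> G \<Longrightarrow> z \<in> proj E' ` V'"
    using j unfolding tvs_embedding_def by metis
  let ?O = "A \<inter> {x \<in> carrier (middle E). proj E x \<in> G}"
  have "nbhd0 (middle E) ?O" by (intro E.X.nbhd0_Int A(1) E.nbhd0_proj_vimage G(1))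
  moreover have "x \<in> U" if x: "x \<in> carrier (middle E')" "R x \<in> ?O" for x
  proof -
    have "proj E' x \<in> proj E' ` V'" using G(2)[of "proj E' x"] x by simp
    then obtain v where v: "v \<in> V'" "proj E' x = proj E' v" by auto
    have vc: "v \<in> carrier (middle E')" "v \<in> V" "R v \<in> A" using v(1) by (auto simp: V'_def)
    have "proj E' (x \<ominus>\<^bsub>middle E'\<^esub> v) = \<zero>\<^bsub>Z\<^esub>" using x(1) vc(1) v(2) by (simp add: E'.p.diff)
    then obtain y where y: "y \<in> carrier Y" "x \<ominus>\<^bsub>middle E'\<^esub> v = incl E' y"
      using E'.proj_zeroE[of "x \<ominus>\<^bsub>middle E'\<^esub> v"] x(1) vc(1) by auto
    have "R x \<ominus>\<^bsub>middle E\<^esub> R v \<in> O'" using A(2) x(2) vc(3) by auto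
    moreover have "R x \<ominus>\<^bsub>middle E\<^esub> R v = incl E y"
      using x(1) vc(1) y by (metis R.diff R_incl)
    ultimately have "incl E' y \<in> V" using O'(2)[OF y(1)] by simp
    then have "v \<oplus>\<^bsub>middle E'\<^esub> (x \<ominus>\<^bsub>middle E'\<^esub> v) \<in> U" using V(2) vc(2) y(2) by simp
    then show "x \<in> U" using x(1) vc(1) by simp
  qed
  ultimately show "\<exists>O'. nbhd0 (middle E) O' \<and> (\<forall>x\<in>carrier (middle E'). R x \<in> O' \<longrightarrow> x \<in> U)"
    by (intro exI[of _ ?O]) auto
qed

lemma R_dense:
  assumes "dense_image Z W j" shows "dense_image (middle E') (middle E) R"
  unfolding dense_image_def
proof (intro ballI allI impI)
  fix x U assume x: "x \<in> carrier (middle E)" and U: "nbhd0 (middle E) U"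
  have "proj E x \<in> carrier W" using x by simp
  then obtain z where z: "z \<in> carrier Z" "j z \<ominus>\<^bsub>W\<^esub> proj E x \<in> proj E ` U"
    using assms E.nbhd0_proj_image[OF U] unfolding dense_image_def by metis
  then obtain u where u: "u \<in> U" "j z \<ominus>\<^bsub>W\<^esub> proj E x = proj E u" by auto
  have uc: "u \<in> carrier (middle E)" using u E.X.nbhd0_subset[OF U] by simp
  have "proj E (x \<oplus>\<^bsub>middle E\<^esub> u) = j z"
    using x uc z(1) by (simp add: E.p.add flip: u(2))
  then obtain x' where "x' \<in> carrier (middle E')" "R x' = x \<oplus>\<^bsub>middle E\<^esub> u"
    using R_surjE[OF _ z(1)] x uc by (metis E.X.a_closed)
  then show "\<exists>x'\<in>carrier (middle E'). R x' \<ominus>\<^bsub>middle E\<^esub> x \<in> U"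
    using x uc u(1) by (intro bexI[of _ x']) simp_all
qed

end

text \<open>Both middle spaces are embedded with the same image, the preimage of \<open>j Z\<close> under the
  projection of \<open>E\<close>.\<close>

lemma restrictions_equivalent:
  assumes "restriction Z Y E1 W E j R1" "restriction Z Y E2 W E j R2"
  shows "ext_equiv Z Y E1 E2"
proof -
  interpret R1: restriction Z Y E1 W E j R1 by fact
  interpret R2: restriction Z Y E2 W E j R2 by fact
  have "R1 ` carrier (middle E1) \<subseteq> R2 ` carrier (middle E2)"
  proof
    fix x assume "x \<in> R1 ` carrier (middle E1)"
    then obtain a where a: "a \<in> carrier (middle E1)" "x = R1 a" by auto
    then obtain b where "b \<in> carrier (middle E2)" "R2 b = x"
      using R2.R_surjE[of x "proj E1 a"] by auto
    then show "x \<in> R2 ` carrier (middle E2)" by auto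
  qed
  then obtain T where T: "continuous_linear (middle E1) (middle E2) T"
    "\<And>a. a \<in> carrier (middle E1) \<Longrightarrow> R2 (T a) = R1 a"
    using factor_through_embedding[OF R1.E'.X.pretvs_axioms R2.E'.X.pretvs_axioms R1.E.X.pretvs_axioms
        R2.R_embedding] R1.R unfolding restriction_map_def by metis
  have Tc: "T a \<in> carrier (middle E2)" if "a \<in> carrier (middle E1)" for a
    using T(1) that by (auto simp: continuous_linear_def tvs_linear_def)
  have inj: "inj_on R2 (carrier (middle E2))" using R2.R_embedding by (simp add: tvs_embedding_def)
  have "restriction_map Y (\<lambda>z. z) E1 E2 T"
    unfolding restriction_map_def
  proof (intro conjI ballI T(1))
    show "T (incl E1 y) = incl E2 y" if "y \<in> carrier Y" for y
      using that T(2) Tc by (intro inj_onD[OF inj]) simp_all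
    show "proj E2 (T x) = proj E1 x" if x: "x \<in> carrier (middle E1)" for x
      using R2.proj_R[OF Tc[OF x]] R1.proj_R[OF x] T(2)[OF x] x Tc by (simp add: R1.j_inj)
  qed
  then show ?thesis unfolding ext_equiv_iff by metis
qed

text \<open>\<open>E\<close> and \<open>E'\<close> are both restrictions of \<open>E'\<close> along the identity.\<close>

lemma ext_equiv_sym:
  assumes "pretvs Z" "pretvs Y" "is_extension Z Y E" "is_extension Z Y E'" "ext_equiv Z Y E E'"
  shows "ext_equiv Z Y E' E"
proof -
  obtain R where R: "restriction_map Y (\<lambda>z. z) E E' R" using assms(5) unfolding ext_equiv_iff by metis
  have "restriction_map Y (\<lambda>z. z) E' E' (\<lambda>x. x)"
    by (simp add: restriction_map_def continuous_linear_id)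
  with R have "restriction Z Y E' Z E' (\<lambda>z. z) (\<lambda>x. x)" "restriction Z Y E Z E' (\<lambda>z. z) R"
    using assms by (simp_all add: restriction_def restriction_axioms_def tvs_extension_def
        tvs_extension_axioms_def tvs_embedding_id)
  then show ?thesis by (rule restrictions_equivalent)
qed

section \<open>Neighbourhood bases and non-Hausdorff presentations\<close>

text \<open>The classical conditions under which sets form a neighbourhood base of zero of a vector
  topology.\<close>

locale tvs_base = real_module V for V :: "'a tvs" (structure) +
  fixes B :: "'a set set"
  assumes nonempty: "B \<noteq> {}"
    and subset: "S \<in> B \<Longrightarrow> x \<in> S \<Longrightarrow> x \<in> carrier V"
    and directed: "S \<in> B \<Longrightarrow> T \<in> B \<Longrightarrow> \<exists>R\<in>B. R \<subseteq> S \<inter> T"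
    and halve: "S \<in> B \<Longrightarrow> \<exists>T\<in>B. \<forall>x\<in>T. \<forall>y\<in>T. x \<oplus> y \<in> S"
    and balanced: "S \<in> B \<Longrightarrow> \<bar>r\<bar> \<le> 1 \<Longrightarrow> x \<in> S \<Longrightarrow> r \<odot> x \<in> S"
    and absorbing: "S \<in> B \<Longrightarrow> x \<in> carrier V \<Longrightarrow> \<exists>e>0. e \<odot> x \<in> S"
begin

lemma zero_in: "S \<in> B \<Longrightarrow> \<zero> \<in> S"
  using absorbing[of S \<zero>] by auto

lemma minus_in: "S \<in> B \<Longrightarrow> x \<in> S \<Longrightarrow> \<ominus> x \<in> S"
  using balanced[of S "-1" x] subset[of S x] by (simp add: minus_one_smult)

lemma absorb_all:
  assumes "S \<in> B" "x \<in> carrier V"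
  obtains e where "e > 0" "\<And>r. \<bar>r\<bar> \<le> e \<Longrightarrow> r \<odot> x \<in> S"
proof -
  obtain e where e: "e > 0" "e \<odot> x \<in> S" using absorbing[OF assms] by auto
  have "r \<odot> x \<in> S" if "\<bar>r\<bar> \<le> e" for r
    using balanced[OF assms(1) _ e(2), of "r / e"] that e(1) assms(2) by (simp add: smult_smult)
  with e(1) show thesis using that by metis
qed

text \<open>For \<open>k = 0\<close> this is balancedness; each halving gains a factor of two, since
  \<open>r x = (r / 2) (x + x)\<close>.\<close>

lemma scale:
  assumes "S \<in> B"
  shows "\<exists>T\<in>B. \<forall>r x. \<bar>r\<bar> \<le> 2 ^ k \<longrightarrow> x \<in> T \<longrightarrow> r \<odot> x \<in> S"
proof (induction k)
  case 0
  show ?case using assms balanced by (intro bexI[of _ S]) auto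
next
  case (Suc k)
  then obtain T where T: "T \<in> B" "\<And>r x. \<bar>r\<bar> \<le> 2 ^ k \<Longrightarrow> x \<in> T \<Longrightarrow> r \<odot> x \<in> S" by auto
  obtain T' where T': "T' \<in> B" "\<And>x y. x \<in> T' \<Longrightarrow> y \<in> T' \<Longrightarrow> x \<oplus> y \<in> T" using halve[OF T(1)] by auto
  have "r \<odot> x \<in> S" if "\<bar>r\<bar> \<le> 2 ^ Suc k" "x \<in> T'" for r x
  proof -
    have xc: "x \<in> carrier V" using subset T'(1) that(2) by metis
    have "(r / 2) \<odot> (x \<oplus> x) \<in> S" using T(2) T'(2)[OF that(2) that(2)] that(1) by simp
    moreover have "(r / 2) \<odot> (x \<oplus> x) = (r / 2 + r / 2) \<odot> x"
      using xc by (simp only: smult_add_left smult_add_right)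
    ultimately show ?thesis by simp
  qed
  with T'(1) show ?case by (intro bexI[of _ T']) auto
qed

definition base_topology :: "'a topology" where
  "base_topology = topology (\<lambda>A. A \<subseteq> carrier V \<and> (\<forall>a\<in>A. \<exists>S\<in>B. \<forall>b\<in>S. a \<oplus> b \<in> A))"

lemma openin_base_topology:
  "openin base_topology A \<longleftrightarrow> A \<subseteq> carrier V \<and> (\<forall>a\<in>A. \<exists>S\<in>B. \<forall>b\<in>S. a \<oplus> b \<in> A)"
proof -
  have "istopology (\<lambda>A. A \<subseteq> carrier V \<and> (\<forall>a\<in>A. \<exists>S\<in>B. \<forall>b\<in>S. a \<oplus> b \<in> A))" (is "istopology ?P")
    unfolding istopology_def
  proof (intro conjI allI impI)
    fix A A' assume AA: "?P A" "?P A'"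
    show "A \<inter> A' \<subseteq> carrier V" using AA by auto
    show "\<forall>a\<in>A \<inter> A'. \<exists>S\<in>B. \<forall>b\<in>S. a \<oplus> b \<in> A \<inter> A'"
    proof
      fix a assume "a \<in> A \<inter> A'"
      then have "\<exists>S\<in>B. \<forall>b\<in>S. a \<oplus> b \<in> A" "\<exists>T\<in>B. \<forall>b\<in>T. a \<oplus> b \<in> A'" using AA by simp_all
      then obtain S T where ST: "S \<in> B" "\<forall>b\<in>S. a \<oplus> b \<in> A" "T \<in> B" "\<forall>b\<in>T. a \<oplus> b \<in> A'" by metis
      obtain R where "R \<in> B" "R \<subseteq> S \<inter> T" using directed[OF ST(1,3)] by auto
      then show "\<exists>S\<in>B. \<forall>b\<in>S. a \<oplus> b \<in> A \<inter> A'" using ST by (intro bexI[of _ R]) auto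
    qed
  next
    fix K assume K: "\<forall>A\<in>K. ?P A"
    then show "\<Union>K \<subseteq> carrier V" by auto
    show "\<forall>a\<in>\<Union>K. \<exists>S\<in>B. \<forall>b\<in>S. a \<oplus> b \<in> \<Union>K"
    proof
      fix a assume "a \<in> \<Union>K"
      then obtain A where A: "A \<in> K" "a \<in> A" by auto
      with K have "\<exists>S\<in>B. \<forall>b\<in>S. a \<oplus> b \<in> A" by simp
      then obtain S where "S \<in> B" "\<forall>b\<in>S. a \<oplus> b \<in> A" by metis
      then show "\<exists>S\<in>B. \<forall>b\<in>S. a \<oplus> b \<in> \<Union>K" using A by (intro bexI[of _ S]) auto
    qed
  qed
  then show ?thesis by (simp add: base_topology_def topology_inverse')
qed

lemma topspace_base_topology: "topspace base_topology = carrier V"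
proof (rule antisym)
  show "topspace base_topology \<subseteq> carrier V"
    using openin_topspace[of base_topology] unfolding openin_base_topology by simp
  have "openin base_topology (carrier V)"
    unfolding openin_base_topology using nonempty subset by auto
  then show "carrier V \<subseteq> topspace base_topology" by (rule openin_subset)
qed

text \<open>A translate \<open>x + S\<close> need not be open; its interior consists of the \<open>a\<close> that lie in it together
  with some \<open>a + T\<close>.\<close>

lemma base_interior:
  assumes x: "x \<in> carrier V" and S: "S \<in> B"
  obtains A where "openin base_topology A" "x \<in> A" "\<And>a. a \<in> A \<Longrightarrow> a \<ominus> x \<in> S"
proof
  let ?A = "{a \<in> carrier V. \<exists>T\<in>B. \<forall>b\<in>T. (a \<oplus> b) \<ominus> x \<in> S}"
  show "openin base_topology ?A"
    unfolding openin_base_topology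
  proof (intro conjI ballI)
    fix a assume "a \<in> ?A"
    then obtain T where a: "a \<in> carrier V" "T \<in> B" "\<forall>b\<in>T. (a \<oplus> b) \<ominus> x \<in> S" by auto
    obtain R where R: "R \<in> B" "\<forall>x\<in>R. \<forall>y\<in>R. x \<oplus> y \<in> T" using halve[OF a(2)] by auto
    show "\<exists>S\<in>B. \<forall>b\<in>S. a \<oplus> b \<in> ?A"
    proof (rule bexI[OF _ R(1)], intro ballI CollectI conjI)
      fix b assume b: "b \<in> R"
      then have bc: "b \<in> carrier V" using subset R(1) by metis
      show "a \<oplus> b \<in> carrier V" using a(1) bc by simp
      show "\<exists>T\<in>B. \<forall>c\<in>T. a \<oplus> b \<oplus> c \<ominus> x \<in> S"
      proof (rule bexI[OF _ R(1)], rule ballI)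
        fix c assume c: "c \<in> R"
        then have "c \<in> carrier V" using subset R(1) by metis
        then show "a \<oplus> b \<oplus> c \<ominus> x \<in> S" using a bc R(2) b c by (simp add: a_assoc)
      qed
    qed
  qed auto
  show "x \<in> ?A" using x S subset by (intro CollectI conjI bexI[of _ S]) auto
  show "a \<ominus> x \<in> S" if a: "a \<in> ?A" for a
  proof -
    obtain T where "a \<in> carrier V" "T \<in> B" "\<forall>b\<in>T. (a \<oplus> b) \<ominus> x \<in> S" using a by auto
    then show ?thesis using zero_in[of T] by force
  qed
qed

lemma pretvs_base_topology:
  assumes V: "topo V = base_topology"
  shows "pretvs V"
proof (unfold_locales)
  show "topspace (topo V) = carrier V" using V topspace_base_topology by simp
  show "continuous_map (prod_topology (topo V) (topo V)) (topo V) (\<lambda>(x, y). x \<oplus> y)"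
    unfolding V
  proof (rule continuous_map[THEN iffD2], intro conjI allI impI)
    show "(\<lambda>(x, y). x \<oplus> y) ` topspace (prod_topology base_topology base_topology) \<subseteq> topspace base_topology"
      by (auto simp: topspace_base_topology)
    fix A assume A: "openin base_topology A"
    show "openin (prod_topology base_topology base_topology)
        {q \<in> topspace (prod_topology base_topology base_topology). (case q of (x, y) \<Rightarrow> x \<oplus> y) \<in> A}"
      unfolding openin_prod_topology_alt
    proof (intro allI impI)
      fix x y assume "(x, y) \<in> {q \<in> topspace (prod_topology base_topology base_topology).
          (case q of (x, y) \<Rightarrow> x \<oplus> y) \<in> A}"
      then have xy: "x \<in> carrier V" "y \<in> carrier V" "x \<oplus> y \<in> A" by (auto simp: topspace_base_topology)
      then obtain S where S: "S \<in> B" "\<forall>b\<in>S. x \<oplus> y \<oplus> b \<in> A" using A unfolding openin_base_topology by auto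
      obtain T where T: "T \<in> B" "\<forall>x\<in>T. \<forall>y\<in>T. x \<oplus> y \<in> S" using halve[OF S(1)] by auto
      obtain G where G: "openin base_topology G" "x \<in> G" "\<And>a. a \<in> G \<Longrightarrow> a \<ominus> x \<in> T"
        using base_interior[OF xy(1) T(1)] by metis
      obtain H where H: "openin base_topology H" "y \<in> H" "\<And>a. a \<in> H \<Longrightarrow> a \<ominus> y \<in> T"
        using base_interior[OF xy(2) T(1)] by metis
      have "a \<oplus> b \<in> A \<and> a \<in> carrier V \<and> b \<in> carrier V" if ab: "a \<in> G" "b \<in> H" for a b
      proof -
        have c: "a \<in> carrier V" "b \<in> carrier V"
          using ab G(1) H(1) unfolding openin_base_topology by auto
        have "x \<oplus> y \<oplus> ((a \<ominus> x) \<oplus> (b \<ominus> y)) \<in> A" using S T G H ab by auto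
        moreover have "x \<oplus> y \<oplus> ((a \<ominus> x) \<oplus> (b \<ominus> y)) = a \<oplus> b"
          using c xy by (simp flip: add_diff_add)
        ultimately show ?thesis using c by simp
      qed
      then have "G \<times> H \<subseteq> {q \<in> topspace (prod_topology base_topology base_topology).
          (case q of (x, y) \<Rightarrow> x \<oplus> y) \<in> A}" by (auto simp: topspace_base_topology)
      with G H show "\<exists>G H. openin base_topology G \<and> openin base_topology H \<and> x \<in> G \<and> y \<in> H \<and>
        G \<times> H \<subseteq> {q \<in> topspace (prod_topology base_topology base_topology).
          (case q of (x, y) \<Rightarrow> x \<oplus> y) \<in> A}" by (intro exI[of _ G] exI[of _ H] conjI)
    qed
  qed
  show "continuous_map (prod_topology euclideanreal (topo V)) (topo V) (\<lambda>(r, x). r \<odot> x)"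
    unfolding V
  proof (rule continuous_map[THEN iffD2], intro conjI allI impI)
    show "(\<lambda>(r, x). r \<odot> x) ` topspace (prod_topology euclideanreal base_topology) \<subseteq> topspace base_topology"
      by (auto simp: topspace_base_topology)
    fix A assume A: "openin base_topology A"
    show "openin (prod_topology euclideanreal base_topology)
        {q \<in> topspace (prod_topology euclideanreal base_topology). (case q of (r, y) \<Rightarrow> r \<odot> y) \<in> A}"
      unfolding openin_prod_topology_alt
    proof (intro allI impI)
      fix r x assume "(r, x) \<in> {q \<in> topspace (prod_topology euclideanreal base_topology).
          (case q of (x, y) \<Rightarrow> x \<odot> y) \<in> A}"
      then have rx: "x \<in> carrier V" "r \<odot> x \<in> A" by (auto simp: topspace_base_topology)
      then obtain S where S: "S \<in> B" "\<forall>b\<in>S. r \<odot> x \<oplus> b \<in> A" using A unfolding openin_base_topology by auto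
      obtain T where T: "T \<in> B" "\<forall>x\<in>T. \<forall>y\<in>T. x \<oplus> y \<in> S" using halve[OF S(1)] by auto
      obtain e where e: "e > 0" "\<And>s. \<bar>s\<bar> \<le> e \<Longrightarrow> s \<odot> x \<in> T" using absorb_all[OF T(1) rx(1)] by metis
      obtain k :: nat where k: "\<bar>r\<bar> + e < 2 ^ k" using real_arch_pow[of 2 "\<bar>r\<bar> + e"] by auto
      obtain R where R: "R \<in> B" "\<And>s x. \<bar>s\<bar> \<le> 2 ^ k \<Longrightarrow> x \<in> R \<Longrightarrow> s \<odot> x \<in> T"
        using scale[OF T(1), of k] by metis
      obtain G where G: "openin base_topology G" "x \<in> G" "\<And>a. a \<in> G \<Longrightarrow> a \<ominus> x \<in> R"
        using base_interior[OF rx(1) R(1)] by metis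
      have "s \<odot> a \<in> A \<and> a \<in> carrier V" if sa: "s \<in> ball r e" "a \<in> G" for s a
      proof -
        have c: "a \<in> carrier V" using sa G(1) unfolding openin_base_topology by auto
        have s: "\<bar>s - r\<bar> \<le> e" "\<bar>s\<bar> \<le> 2 ^ k" using sa(1) k by (auto simp: dist_real_def)
        have "r \<odot> x \<oplus> (s \<odot> (a \<ominus> x) \<oplus> (s - r) \<odot> x) \<in> A"
          using S T R(2)[OF s(2) G(3)[OF sa(2)]] e(2)[OF s(1)] by auto
        moreover have "s \<odot> (a \<ominus> x) \<oplus> (s - r) \<odot> x = s \<odot> a \<ominus> r \<odot> x"
          using c rx smult_add_left[of x s "-r"]
          by (simp add: smult_diff minus_smult flip: a_minus_def) (simp add: diff_add_diff)
        ultimately show ?thesis using c rx by simp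
      qed
      then have "ball r e \<times> G \<subseteq> {q \<in> topspace (prod_topology euclideanreal base_topology).
          (case q of (r, y) \<Rightarrow> r \<odot> y) \<in> A}" by (auto simp: topspace_base_topology)
      with G e(1) show "\<exists>H G. openin euclideanreal H \<and> openin base_topology G \<and> r \<in> H \<and> x \<in> G \<and>
        H \<times> G \<subseteq> {q \<in> topspace (prod_topology euclideanreal base_topology).
          (case q of (r, y) \<Rightarrow> r \<odot> y) \<in> A}" by (intro exI[of _ "ball r e"] exI[of _ G] conjI) auto
    qed
  qed
qed

lemma nbhd0_base_topology:
  assumes V: "topo V = base_topology"
  shows "nbhd0 V U \<longleftrightarrow> U \<subseteq> carrier V \<and> (\<exists>S\<in>B. S \<subseteq> U)"
proof
  assume "nbhd0 V U"
  then obtain A where A: "U \<subseteq> carrier V" "openin base_topology A" "\<zero> \<in> A" "A \<subseteq> U"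
    unfolding nbhd0_def V by auto
  then obtain S where S: "S \<in> B" "\<forall>b\<in>S. \<zero> \<oplus> b \<in> A" unfolding openin_base_topology by auto
  have "S \<subseteq> U"
  proof
    fix b assume "b \<in> S"
    then have "\<zero> \<oplus> b \<in> A" "b \<in> carrier V" using S subset by auto
    then show "b \<in> U" using A(4) by auto
  qed
  with A(1) S(1) show "U \<subseteq> carrier V \<and> (\<exists>S\<in>B. S \<subseteq> U)" by auto
next
  assume "U \<subseteq> carrier V \<and> (\<exists>S\<in>B. S \<subseteq> U)"
  then obtain S where S: "U \<subseteq> carrier V" "S \<in> B" "S \<subseteq> U" by auto
  obtain A where A: "openin base_topology A" "\<zero> \<in> A" "\<And>a. a \<in> A \<Longrightarrow> a \<ominus> \<zero> \<in> S"
    using base_interior[OF _ S(2), of \<zero>] by auto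
  have "A \<subseteq> U"
  proof
    fix a assume "a \<in> A"
    then have "a \<ominus> \<zero> \<in> S" "a \<in> carrier V" using A(1,3) unfolding openin_base_topology by auto
    then show "a \<in> U" using S(3) by auto
  qed
  with A S(1) show "nbhd0 V U" unfolding nbhd0_def V by auto
qed

end

lemma (in pretvs) HausdorffI:
  assumes "\<And>x. x \<in> carrier V \<Longrightarrow> (\<And>U. nbhd0 V U \<Longrightarrow> x \<in> U) \<Longrightarrow> x = \<zero>"
  shows "Hausdorff_space (topo V)"
  unfolding Hausdorff_space_def topspace
proof (intro allI impI, elim conjE)
  fix x y assume xy: "x \<in> carrier V" "y \<in> carrier V" "x \<noteq> y"
  then have "y \<ominus> x \<noteq> \<zero>" by (metis diff_eq_zero_iff)
  with assms[of "y \<ominus> x"] xy obtain U where U: "nbhd0 V U" "y \<ominus> x \<notin> U" by auto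
  obtain U' where U': "nbhd0 V U'" "\<And>x y. x \<in> U' \<Longrightarrow> y \<in> U' \<Longrightarrow> x \<ominus> y \<in> U"
    using nbhd0_halve_balanced[OF U(1)] by metis
  obtain A where A: "openin (topo V) A" "x \<in> A" "\<And>a. a \<in> A \<Longrightarrow> a \<ominus> x \<in> U'"
    using openin_translate_nbhd0[OF U'(1) xy(1)] by metis
  obtain A' where A': "openin (topo V) A'" "y \<in> A'" "\<And>a. a \<in> A' \<Longrightarrow> a \<ominus> y \<in> U'"
    using openin_translate_nbhd0[OF U'(1) xy(2)] by metis
  have "disjnt A A'"
  proof (clarsimp simp: disjnt_iff)
    fix a assume a: "a \<in> A" "a \<in> A'"
    then have "a \<in> carrier V" using A(1) openin_subset by fastforce
    moreover have "(a \<ominus> x) \<ominus> (a \<ominus> y) \<in> U" using U'(2) A(3) A'(3) a by simp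
    ultimately show False using U(2) xy by (simp add: diff_diff_cancel_left)
  qed
  with A A' show "\<exists>A A'. openin (topo V) A \<and> openin (topo V) A' \<and> x \<in> A \<and> y \<in> A' \<and> disjnt A A'"
    by (intro exI[of _ A] exI[of _ A']) auto
qed

subsection \<open>Extensions presented by a space that need not be Hausdorff\<close>

text \<open>
  The space \<open>C\<close>, with the topology given by the base \<open>B\<close>, becomes the middle space of an
  extension after dividing out the closure \<open>\<Inter>B\<close> of zero. Accordingly \<open>kernel\<close> asks for exactness
  only up to \<open>\<Inter>B\<close>. Instead of forming cosets, the quotient is realised on pairs in
  \<open>carrier Y \<times> carrier Z\<close>: this is the type on which the members of \<open>extensions Z Y\<close> live.
\<close>

locale pre_extension = C: tvs_base C B + i: linear_map Y C i + p: linear_map C Z p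
  for Z :: "'z tvs" and Y :: "'y tvs" and C :: "'c tvs" and i :: "'y \<Rightarrow> 'c" and p :: "'c \<Rightarrow> 'z"
    and B :: "'c set set" +
  assumes Y: "is_tvs Y" and Z: "is_tvs Z"
    and i_continuous: "S \<in> B \<Longrightarrow> nbhd0 Y {y \<in> carrier Y. i y \<in> S}"
    and i_open: "nbhd0 Y U \<Longrightarrow> \<exists>S\<in>B. \<forall>y\<in>carrier Y. i y \<in> S \<longrightarrow> y \<in> U"
    and p_continuous: "nbhd0 Z G \<Longrightarrow> \<exists>S\<in>B. p ` S \<subseteq> G"
    and p_open: "S \<in> B \<Longrightarrow> nbhd0 Z (p ` S)"
    and p_i: "y \<in> carrier Y \<Longrightarrow> p (i y) = \<zero>\<^bsub>Z\<^esub>"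
    and kernel: "c \<in> carrier C \<Longrightarrow> p c = \<zero>\<^bsub>Z\<^esub> \<Longrightarrow> \<exists>y\<in>carrier Y. \<forall>S\<in>B. c \<ominus>\<^bsub>C\<^esub> i y \<in> S"
begin

text \<open>The image of \<open>p\<close> is a linear subspace and a neighbourhood of zero.\<close>

lemma p_surjE:
  assumes z: "z \<in> carrier Z" obtains c where "c \<in> carrier C" "p c = z"
proof -
  interpret Z: pretvs Z using Z by (simp add: is_tvs_iff)
  obtain S where S: "S \<in> B" using C.nonempty by auto
  obtain e where e: "e > 0" "\<And>r. \<bar>r\<bar> \<le> e \<Longrightarrow> r \<odot>\<^bsub>Z\<^esub> z \<in> p ` S"
    using Z.nbhd0_absorbing[OF p_open[OF S] z] by metis
  from e(1) e(2)[of e] obtain c where c: "c \<in> S" "e \<odot>\<^bsub>Z\<^esub> z = p c" by auto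
  have cc: "c \<in> carrier C" using C.subset S c(1) by metis
  have "p ((1/e) \<odot>\<^bsub>C\<^esub> c) = (1/e) \<odot>\<^bsub>Z\<^esub> (e \<odot>\<^bsub>Z\<^esub> z)" using c cc by (simp add: p.smult)
  also have "\<dots> = z" using e(1) z by (simp add: p.W.smult_smult)
  finally show thesis using that cc by (metis C.smult_closed)
qed

definition null :: "'c set" where "null = \<Inter>B"

lemma null_closed: "n \<in> null \<Longrightarrow> n \<in> carrier C"
  unfolding null_def using C.nonempty C.subset by auto

lemma null_add: "m \<in> null \<Longrightarrow> n \<in> null \<Longrightarrow> m \<oplus>\<^bsub>C\<^esub> n \<in> null"
  unfolding null_def using C.halve by (auto, metis)

lemma null_minus: "n \<in> null \<Longrightarrow> \<ominus>\<^bsub>C\<^esub> n \<in> null"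
  unfolding null_def using C.minus_in by auto

lemma null_diff: "m \<in> null \<Longrightarrow> n \<in> null \<Longrightarrow> m \<ominus>\<^bsub>C\<^esub> n \<in> null"
  by (simp add: a_minus_def null_add null_minus)

lemma null_zero: "\<zero>\<^bsub>C\<^esub> \<in> null"
  unfolding null_def using C.zero_in by auto

lemma null_smult: 
  assumes "n \<in> null" shows "r \<odot>\<^bsub>C\<^esub> n \<in> null"
  unfolding null_def
proof
  fix S assume S: "S \<in> B"
  obtain k :: nat where k: "\<bar>r\<bar> < 2 ^ k" using real_arch_pow[of 2 "\<bar>r\<bar>"] by auto
  obtain T where T: "T \<in> B" "\<And>r x. \<bar>r\<bar> \<le> 2 ^ k \<Longrightarrow> x \<in> T \<Longrightarrow> r \<odot>\<^bsub>C\<^esub> x \<in> S"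
    using C.scale[OF S, of k] by metis
  then show "r \<odot>\<^bsub>C\<^esub> n \<in> S" using k assms by (auto simp: null_def)
qed

lemma p_null: 
  assumes "n \<in> null" shows "p n = \<zero>\<^bsub>Z\<^esub>"
proof (rule is_tvs_separated[OF Z])
  show "p n \<in> carrier Z" using assms null_closed by simp
  fix U assume "nbhd0 Z U"
  then show "p n \<in> U" using p_continuous assms unfolding null_def by auto
qed

lemma i_null:
  assumes "y \<in> carrier Y" "i y \<in> null" shows "y = \<zero>\<^bsub>Y\<^esub>"
proof (rule is_tvs_separated[OF Y assms(1)])
  fix U assume "nbhd0 Y U"
  then show "y \<in> U" using i_open assms unfolding null_def by auto
qed

lemma i_null_cancel:
  assumes "y \<in> carrier Y" "y' \<in> carrier Y" "i y \<ominus>\<^bsub>C\<^esub> i y' \<in> null" shows "y = y'"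
  using i_null[of "y \<ominus>\<^bsub>Y\<^esub> y'"] assms by (simp add: i.diff i.V.diff_eq_zero_iff)

text \<open>
  An arbitrary section of \<open>p\<close>, neither linear nor continuous, picks from each class modulo \<open>null\<close> one
  representative of the form \<open>rep (y, z)\<close>; the class is encoded by that pair.
\<close>

definition sect :: "'z \<Rightarrow> 'c" where "sect z = (SOME c. c \<in> carrier C \<and> p c = z)"

lemma sect: "z \<in> carrier Z \<Longrightarrow> sect z \<in> carrier C \<and> p (sect z) = z"
  unfolding sect_def by (rule someI_ex) (metis p_surjE)

definition rep :: "'y \<times> 'z \<Rightarrow> 'c" where "rep m = i (fst m) \<oplus>\<^bsub>C\<^esub> sect (snd m)"

definition cls :: "'c \<Rightarrow> 'y \<times> 'z" where
  "cls c = (THE m. m \<in> carrier Y \<times> carrier Z \<and> c \<ominus>\<^bsub>C\<^esub> rep m \<in> null)"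

lemma rep_closed: "m \<in> carrier Y \<times> carrier Z \<Longrightarrow> rep m \<in> carrier C"
  using sect by (auto simp: rep_def)

lemma p_rep: "m \<in> carrier Y \<times> carrier Z \<Longrightarrow> p (rep m) = snd m"
  using sect by (auto simp: rep_def p.add p_i)

lemma rep_unique:
  assumes m: "m \<in> carrier Y \<times> carrier Z" and m': "m' \<in> carrier Y \<times> carrier Z"
    and c: "c \<in> carrier C" and n: "c \<ominus>\<^bsub>C\<^esub> rep m \<in> null" "c \<ominus>\<^bsub>C\<^esub> rep m' \<in> null"
  shows "m = m'"
proof -
  have "p c \<ominus>\<^bsub>Z\<^esub> snd m = \<zero>\<^bsub>Z\<^esub>" "p c \<ominus>\<^bsub>Z\<^esub> snd m' = \<zero>\<^bsub>Z\<^esub>"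
    using p_null[OF n(1)] p_null[OF n(2)] c m m' rep_closed p_rep by (auto simp: p.diff)
  then have s: "snd m = snd m'" using c m m' p.W.diff_eq_zero_iff
    by (metis mem_Times_iff p.closed)
  have "(c \<ominus>\<^bsub>C\<^esub> rep m') \<ominus>\<^bsub>C\<^esub> (c \<ominus>\<^bsub>C\<^esub> rep m) \<in> null" by (rule null_diff[OF n(2) n(1)])
  then have "rep m \<ominus>\<^bsub>C\<^esub> rep m' \<in> null"
    using c m m' rep_closed by (simp add: C.diff_diff_cancel_left)
  then have "i (fst m) \<ominus>\<^bsub>C\<^esub> i (fst m') \<in> null"
    using m m' sect s unfolding rep_def by (auto simp: C.add_diff_add)
  then have "fst m = fst m'" using m m' by (intro i_null_cancel) auto
  with s show ?thesis by (simp add: prod_eq_iff)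
qed

lemma cls:
  assumes c: "c \<in> carrier C"
  shows "cls c \<in> carrier Y \<times> carrier Z \<and> c \<ominus>\<^bsub>C\<^esub> rep (cls c) \<in> null"
  unfolding cls_def
proof (rule theI')
  have sc: "sect (p c) \<in> carrier C" "p (sect (p c)) = p c" using sect c by auto
  then obtain y where y: "y \<in> carrier Y" "\<forall>S\<in>B. (c \<ominus>\<^bsub>C\<^esub> sect (p c)) \<ominus>\<^bsub>C\<^esub> i y \<in> S"
    using kernel[of "c \<ominus>\<^bsub>C\<^esub> sect (p c)"] c by (auto simp: p.diff)
  have "(c \<ominus>\<^bsub>C\<^esub> sect (p c)) \<ominus>\<^bsub>C\<^esub> i y = c \<ominus>\<^bsub>C\<^esub> rep (y, p c)"
    using c sc y by (simp add: rep_def a_minus_def C.minus_add C.a_ac)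
  then have "c \<ominus>\<^bsub>C\<^esub> rep (y, p c) \<in> null" using y by (simp add: null_def)
  moreover have "(y, p c) \<in> carrier Y \<times> carrier Z" using y c by simp
  ultimately show "\<exists>!m. m \<in> carrier Y \<times> carrier Z \<and> c \<ominus>\<^bsub>C\<^esub> rep m \<in> null"
    using rep_unique[OF _ _ c] by (intro ex1I[of _ "(y, p c)"]) auto
qed

lemma cls_eq_iff:
  assumes "c \<in> carrier C" "d \<in> carrier C"
  shows "cls c = cls d \<longleftrightarrow> c \<ominus>\<^bsub>C\<^esub> d \<in> null"
proof
  assume "cls c = cls d"
  then have "(c \<ominus>\<^bsub>C\<^esub> rep (cls c)) \<ominus>\<^bsub>C\<^esub> (d \<ominus>\<^bsub>C\<^esub> rep (cls c)) \<in> null"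
    using cls assms by (metis null_diff)
  then show "c \<ominus>\<^bsub>C\<^esub> d \<in> null" using assms cls rep_closed by (simp add: C.diff_diff_cancel_right)
next
  assume cd: "c \<ominus>\<^bsub>C\<^esub> d \<in> null"
  have "(c \<ominus>\<^bsub>C\<^esub> d) \<oplus>\<^bsub>C\<^esub> (d \<ominus>\<^bsub>C\<^esub> rep (cls d)) \<in> null" using cd cls assms by (intro null_add) auto
  then have "c \<ominus>\<^bsub>C\<^esub> rep (cls d) \<in> null" using assms cls rep_closed by (simp add: C.diff_add_diff)
  then show "cls c = cls d" using rep_unique assms cls by metis
qed

lemma cls_rep: "m \<in> carrier Y \<times> carrier Z \<Longrightarrow> cls (rep m) = m"
  using rep_unique[of "cls (rep m)" m "rep m"] cls rep_closed null_zero by simp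

lemma snd_cls: "c \<in> carrier C \<Longrightarrow> snd (cls c) = p c"
  using cls_eq_iff[of c "rep (cls c)"] p_null[of "c \<ominus>\<^bsub>C\<^esub> rep (cls c)"] cls[of c] rep_closed[of "cls c"] p_rep[of "cls c"]
  by (simp add: p.diff p.W.diff_eq_zero_iff mem_Times_iff)

text \<open>The topology is \<open>base_topology\<close> for the base of images of members of \<open>B\<close>, written out; it is
  identified with it in \<open>topo_pre_middle\<close>.\<close>

definition pre_middle :: "('y \<times> 'z) tvs" where
  "pre_middle = \<lparr>carrier = carrier Y \<times> carrier Z,
     monoid.mult = undefined, one = undefined,
     zero = cls \<zero>\<^bsub>C\<^esub>,
     add = (\<lambda>m m'. cls (rep m \<oplus>\<^bsub>C\<^esub> rep m')),
     smult = (\<lambda>r m. cls (r \<odot>\<^bsub>C\<^esub> rep m)),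
     topo = topology (\<lambda>A. A \<subseteq> carrier Y \<times> carrier Z \<and>
       (\<forall>a\<in>A. \<exists>S\<in>B. \<forall>b\<in>S. cls (rep a \<oplus>\<^bsub>C\<^esub> rep (cls b)) \<in> A))\<rparr>"

lemma pre_middle_sel:
  "carrier pre_middle = carrier Y \<times> carrier Z"
  "\<zero>\<^bsub>pre_middle\<^esub> = cls \<zero>\<^bsub>C\<^esub>"
  by (simp_all add: pre_middle_def)

lemma cls_add:
  assumes "c \<in> carrier C" "d \<in> carrier C"
  shows "cls c \<oplus>\<^bsub>pre_middle\<^esub> cls d = cls (c \<oplus>\<^bsub>C\<^esub> d)"
proof -
  have r: "rep (cls c) \<in> carrier C" "rep (cls d) \<in> carrier C" using assms cls rep_closed by auto
  have "(c \<ominus>\<^bsub>C\<^esub> rep (cls c)) \<oplus>\<^bsub>C\<^esub> (d \<ominus>\<^bsub>C\<^esub> rep (cls d)) \<in> null"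
    using assms cls by (intro null_add) auto
  then have "cls (c \<oplus>\<^bsub>C\<^esub> d) = cls (rep (cls c) \<oplus>\<^bsub>C\<^esub> rep (cls d))"
    using assms r by (simp add: cls_eq_iff C.add_diff_add)
  then show ?thesis by (simp add: pre_middle_def)
qed

lemma cls_smult:
  assumes "c \<in> carrier C"
  shows "r \<odot>\<^bsub>pre_middle\<^esub> cls c = cls (r \<odot>\<^bsub>C\<^esub> c)"
proof -
  have r: "rep (cls c) \<in> carrier C" using assms cls rep_closed by auto
  have "r \<odot>\<^bsub>C\<^esub> (c \<ominus>\<^bsub>C\<^esub> rep (cls c)) \<in> null"
    using assms cls by (intro null_smult) auto
  then have "cls (r \<odot>\<^bsub>C\<^esub> c) = cls (r \<odot>\<^bsub>C\<^esub> rep (cls c))"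
    using assms r by (simp add: cls_eq_iff C.smult_diff)
  then show ?thesis by (simp add: pre_middle_def)
qed

lemma cls_surjE:
  assumes "m \<in> carrier pre_middle" obtains c where "c \<in> carrier C" "m = cls c"
  by (metis assms cls_rep rep_closed pre_middle_sel(1) that)

lemma cls_closed: "c \<in> carrier C \<Longrightarrow> cls c \<in> carrier pre_middle"
  using cls by (simp add: pre_middle_sel)

lemma carrier_pre_middle: "carrier pre_middle = cls ` carrier C"
proof (intro equalityI subsetI)
  fix m assume "m \<in> carrier pre_middle"
  then obtain c where "c \<in> carrier C" "m = cls c" by (rule cls_surjE)
  then show "m \<in> cls ` carrier C" by simp
qed (auto simp: cls_closed)

lemma real_module_pre_middle: "real_module pre_middle"
  by (rule real_moduleI)
    (auto simp: carrier_pre_middle cls_add cls_smult pre_middle_sel(2) C.a_ac C.smult_add_left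
      C.smult_add_right C.smult_smult)

lemma tvs_base_pre_middle: "tvs_base pre_middle ((`) cls ` B)"
proof (intro tvs_base.intro tvs_base_axioms.intro real_module_pre_middle)
  show "(`) cls ` B \<noteq> {}" using C.nonempty by simp
  show "m \<in> carrier pre_middle" if "S \<in> (`) cls ` B" "m \<in> S" for S m
    using that cls_closed C.subset by auto
  show "\<exists>R\<in>(`) cls ` B. R \<subseteq> S \<inter> T" if "S \<in> (`) cls ` B" "T \<in> (`) cls ` B" for S T
  proof -
    obtain S' T' where ST: "S' \<in> B" "T' \<in> B" "S = cls ` S'" "T = cls ` T'" using \<open>S \<in> _\<close> \<open>T \<in> _\<close> by auto
    then obtain R where "R \<in> B" "R \<subseteq> S' \<inter> T'" using C.directed by metis
    then show ?thesis using ST by (intro bexI[of _ "cls ` R"]) auto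
  qed
  show "\<exists>T\<in>(`) cls ` B. \<forall>x\<in>T. \<forall>y\<in>T. x \<oplus>\<^bsub>pre_middle\<^esub> y \<in> S" if "S \<in> (`) cls ` B" for S
  proof -
    obtain S' where S: "S' \<in> B" "S = cls ` S'" using \<open>S \<in> _\<close> by auto
    then obtain T where T: "T \<in> B" "\<forall>x\<in>T. \<forall>y\<in>T. x \<oplus>\<^bsub>C\<^esub> y \<in> S'" using C.halve by metis
    then have "x \<in> carrier C" if "x \<in> T" for x using that C.subset by metis
    then show ?thesis using S T by (intro bexI[of _ "cls ` T"]) (auto simp: cls_add)
  qed
  show "r \<odot>\<^bsub>pre_middle\<^esub> x \<in> S" if "S \<in> (`) cls ` B" "\<bar>r\<bar> \<le> 1" "x \<in> S" for S r x
    using that C.subset C.balanced by (auto simp: cls_smult)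
  show "\<exists>e>0. e \<odot>\<^bsub>pre_middle\<^esub> x \<in> S" if "S \<in> (`) cls ` B" "x \<in> carrier pre_middle" for S x
  proof -
    obtain S' c where S: "S' \<in> B" "S = cls ` S'" "c \<in> carrier C" "x = cls c"
      using \<open>S \<in> _\<close> \<open>x \<in> _\<close> unfolding carrier_pre_middle by auto
    then obtain e where "e > 0" "e \<odot>\<^bsub>C\<^esub> c \<in> S'" using C.absorbing by metis
    then show ?thesis using S by (auto simp: cls_smult)
  qed
qed

lemma topo_pre_middle: "topo pre_middle = tvs_base.base_topology pre_middle ((`) cls ` B)"
  unfolding tvs_base.base_topology_def[OF tvs_base_pre_middle] by (simp add: pre_middle_def)

lemma pretvs_pre_middle: "pretvs pre_middle"
  by (rule tvs_base.pretvs_base_topology[OF tvs_base_pre_middle topo_pre_middle])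

lemma nbhd0_pre_middle:
  "nbhd0 pre_middle U \<longleftrightarrow> U \<subseteq> carrier pre_middle \<and> (\<exists>S\<in>B. cls ` S \<subseteq> U)"
  unfolding tvs_base.nbhd0_base_topology[OF tvs_base_pre_middle topo_pre_middle] by auto

text \<open>The set \<open>S\<close> need not be saturated for \<open>null\<close>, but it contains the saturation of a half of it.\<close>

lemma cls_mem_imageD:
  assumes "c \<in> carrier C" "T \<in> B" "\<forall>x\<in>T. \<forall>y\<in>T. x \<oplus>\<^bsub>C\<^esub> y \<in> S" "cls c \<in> cls ` T"
  shows "c \<in> S"
proof -
  obtain t where t: "t \<in> T" "cls c = cls t" using assms(4) by auto
  then have tc: "t \<in> carrier C" using C.subset assms(2) by metis
  then have "c \<ominus>\<^bsub>C\<^esub> t \<in> T" using t assms(1,2) by (simp add: cls_eq_iff null_def)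
  then have "t \<oplus>\<^bsub>C\<^esub> (c \<ominus>\<^bsub>C\<^esub> t) \<in> S" using assms(3) t(1) by simp
  then show ?thesis using tc assms(1) by simp
qed

lemma is_tvs_pre_middle: "is_tvs pre_middle"
proof -
  interpret M: pretvs pre_middle by (rule pretvs_pre_middle)
  have "Hausdorff_space (topo pre_middle)"
  proof (rule M.HausdorffI)
    fix m assume m: "m \<in> carrier pre_middle" "\<And>U. nbhd0 pre_middle U \<Longrightarrow> m \<in> U"
    then obtain c where c: "c \<in> carrier C" "m = cls c" using cls_surjE by metis
    have "c \<in> null" unfolding null_def
    proof
      fix S assume "S \<in> B"
      then obtain T where T: "T \<in> B" "\<forall>x\<in>T. \<forall>y\<in>T. x \<oplus>\<^bsub>C\<^esub> y \<in> S" using C.halve by metis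
      have "nbhd0 pre_middle (cls ` T)"
        unfolding nbhd0_pre_middle using T(1) C.subset cls_closed by auto
      then have "cls c \<in> cls ` T" using m(2) c(2) by simp
      then show "c \<in> S" using cls_mem_imageD[OF c(1) T] by simp
    qed
    then have "cls c = cls \<zero>\<^bsub>C\<^esub>" using c(1) by (simp add: cls_eq_iff)
    then show "m = \<zero>\<^bsub>pre_middle\<^esub>" using c(2) by (simp add: pre_middle_sel)
  qed
  then show ?thesis by (simp add: is_tvs_iff pretvs_pre_middle)
qed

definition pre_ext :: "('y, 'y \<times> 'z, 'z) extension" where
  "pre_ext = \<lparr>middle = pre_middle, incl = (\<lambda>y. cls (i y)), proj = snd\<rparr>"

lemma pre_ext_sel:
  "middle pre_ext = pre_middle" "incl pre_ext = (\<lambda>y. cls (i y))" "proj pre_ext = snd"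
  by (simp_all add: pre_ext_def)

lemma cls_linear: "tvs_linear C pre_middle cls"
  unfolding tvs_linear_def by (auto simp: cls_closed cls_add cls_smult)

theorem is_extension_pre_ext: "is_extension Z Y pre_ext"
proof (rule is_extensionI, unfold pre_ext_sel)
  show "pretvs Z" "is_tvs Y" "is_tvs pre_middle" using Y Z is_tvs_pre_middle by (auto simp: is_tvs_iff)
  show "tvs_linear Y pre_middle (\<lambda>y. cls (i y))" by (rule tvs_linear_compose[OF i.linear cls_linear])
  show "tvs_linear pre_middle Z snd"
    unfolding tvs_linear_def carrier_pre_middle
    by (auto simp: cls_add cls_smult snd_cls p.add p.smult)
  show "nbhd0 Y {y \<in> carrier Y. cls (i y) \<in> U}" if "nbhd0 pre_middle U" for U
  proof -
    interpret Y: pretvs Y using Y by (simp add: is_tvs_iff)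
    obtain S where S: "S \<in> B" "cls ` S \<subseteq> U" using \<open>nbhd0 _ U\<close> unfolding nbhd0_pre_middle by auto
    show ?thesis by (rule Y.nbhd0_mono[OF i_continuous[OF S(1)]]) (use S in auto)
  qed
  show "\<exists>O'. nbhd0 pre_middle O' \<and> (\<forall>y\<in>carrier Y. cls (i y) \<in> O' \<longrightarrow> y \<in> U)" if "nbhd0 Y U" for U
  proof -
    obtain S where S: "S \<in> B" "\<forall>y\<in>carrier Y. i y \<in> S \<longrightarrow> y \<in> U" using i_open[OF \<open>nbhd0 Y U\<close>] by auto
    then obtain T where T: "T \<in> B" "\<forall>x\<in>T. \<forall>y\<in>T. x \<oplus>\<^bsub>C\<^esub> y \<in> S" using C.halve by metis
    have "nbhd0 pre_middle (cls ` T)"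
      unfolding nbhd0_pre_middle using T(1) C.subset cls_closed by auto
    then show ?thesis using cls_mem_imageD[OF _ T] S by (intro exI[of _ "cls ` T"]) auto
  qed
  show "nbhd0 pre_middle {x \<in> carrier pre_middle. snd x \<in> U}" if "nbhd0 Z U" for U
  proof -
    obtain S where S: "S \<in> B" "p ` S \<subseteq> U" using p_continuous[OF \<open>nbhd0 Z U\<close>] by auto
    have "cls ` S \<subseteq> {x \<in> carrier pre_middle. snd x \<in> U}"
      using S C.subset[OF S(1)] cls_closed snd_cls by auto
    then show ?thesis unfolding nbhd0_pre_middle using S(1) by auto
  qed
  show "nbhd0 Z (snd ` U)" if "nbhd0 pre_middle U" for U
  proof -
    interpret Z: pretvs Z using Z by (simp add: is_tvs_iff)
    obtain S where S: "S \<in> B" "cls ` S \<subseteq> U" "U \<subseteq> carrier pre_middle"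
      using \<open>nbhd0 _ U\<close> unfolding nbhd0_pre_middle by auto
    have "p ` S = snd ` (cls ` S)" using C.subset[OF S(1)] snd_cls by (force simp: image_image)
    then show ?thesis by (intro Z.nbhd0_mono[OF p_open[OF S(1)]]) (use S pre_middle_sel in auto)
  qed
  show "snd (cls (i y)) = \<zero>\<^bsub>Z\<^esub>" if "y \<in> carrier Y" for y
    using that by (simp add: snd_cls p_i)
  show "x \<in> (\<lambda>y. cls (i y)) ` carrier Y" if "x \<in> carrier pre_middle" "snd x = \<zero>\<^bsub>Z\<^esub>" for x
  proof -
    obtain c where c: "c \<in> carrier C" "x = cls c" using \<open>x \<in> _\<close> cls_surjE by metis
    then have "p c = \<zero>\<^bsub>Z\<^esub>" using \<open>snd x = _\<close> snd_cls by simp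
    then obtain y where y: "y \<in> carrier Y" "\<forall>S\<in>B. c \<ominus>\<^bsub>C\<^esub> i y \<in> S" using kernel c(1) by metis
    then have "cls c = cls (i y)" using c(1) by (simp add: cls_eq_iff null_def)
    then show ?thesis using y(1) c(2) by (auto simp: pre_ext_sel)
  qed
qed

end

section \<open>Pull-backs and transport\<close>

lemma prod_tvs_sel [simp]:
  "carrier (prod_tvs V W) = carrier V \<times> carrier W"
  "\<zero>\<^bsub>prod_tvs V W\<^esub> = (\<zero>\<^bsub>V\<^esub>, \<zero>\<^bsub>W\<^esub>)"
  "(x, y) \<oplus>\<^bsub>prod_tvs V W\<^esub> (x', y') = (x \<oplus>\<^bsub>V\<^esub> x', y \<oplus>\<^bsub>W\<^esub> y')"
  "r \<odot>\<^bsub>prod_tvs V W\<^esub> (x, y) = (r \<odot>\<^bsub>V\<^esub> x, r \<odot>\<^bsub>W\<^esub> y)"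
  "topo (prod_tvs V W) = prod_topology (topo V) (topo W)"
  by (simp_all add: prod_tvs_def)

lemma sub_tvs_sel [simp]:
  "carrier (sub_tvs V S) = S"
  "\<zero>\<^bsub>sub_tvs V S\<^esub> = \<zero>\<^bsub>V\<^esub>"
  "x \<oplus>\<^bsub>sub_tvs V S\<^esub> y = x \<oplus>\<^bsub>V\<^esub> y"
  "r \<odot>\<^bsub>sub_tvs V S\<^esub> x = r \<odot>\<^bsub>V\<^esub> x"
  "topo (sub_tvs V S) = subtopology (topo V) S"
  by (simp_all add: sub_tvs_def)

lemma real_module_prod_tvs:
  assumes "real_module V" "real_module W"
  shows "real_module (prod_tvs V W)"
proof -
  interpret V: real_module V by fact
  interpret W: real_module W by fact
  show ?thesis
    by (rule real_moduleI)
      (auto simp: V.a_ac W.a_ac V.smult_add_left V.smult_add_right V.smult_smult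
        W.smult_add_left W.smult_add_right W.smult_smult)
qed

lemma pretvs_prod_tvs:
  assumes "pretvs V" "pretvs W"
  shows "pretvs (prod_tvs V W)"
proof -
  interpret V: pretvs V by fact
  interpret W: pretvs W by fact
  let ?P = "prod_topology (topo V) (topo W)"
  have "continuous_map (prod_topology ?P ?P) (topo V) (\<lambda>q. fst (fst q) \<oplus>\<^bsub>V\<^esub> fst (snd q))"
    by (intro V.continuous_add_comp continuous_map_compose[OF continuous_map_fst continuous_map_fst, unfolded o_def]
        continuous_map_compose[OF continuous_map_snd continuous_map_fst, unfolded o_def])
  moreover have "continuous_map (prod_topology ?P ?P) (topo W) (\<lambda>q. snd (fst q) \<oplus>\<^bsub>W\<^esub> snd (snd q))"
    by (intro W.continuous_add_comp continuous_map_compose[OF continuous_map_fst continuous_map_snd, unfolded o_def]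
        continuous_map_compose[OF continuous_map_snd continuous_map_snd, unfolded o_def])
  ultimately have add: "continuous_map (prod_topology ?P ?P) ?P (\<lambda>(x, y). x \<oplus>\<^bsub>prod_tvs V W\<^esub> y)"
    by (simp add: continuous_map_pairwise prod_tvs_def o_def case_prod_beta)
  have "continuous_map (prod_topology euclideanreal ?P) (topo V) (\<lambda>q. fst q \<odot>\<^bsub>V\<^esub> fst (snd q))"
    by (intro V.continuous_smult_comp continuous_map_fst
        continuous_map_compose[OF continuous_map_snd continuous_map_fst, unfolded o_def])
  moreover have "continuous_map (prod_topology euclideanreal ?P) (topo W) (\<lambda>q. fst q \<odot>\<^bsub>W\<^esub> snd (snd q))"
    by (intro W.continuous_smult_comp continuous_map_fst
        continuous_map_compose[OF continuous_map_snd continuous_map_snd, unfolded o_def])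
  ultimately have "continuous_map (prod_topology euclideanreal ?P) ?P (\<lambda>(r, x). r \<odot>\<^bsub>prod_tvs V W\<^esub> x)"
    by (simp add: continuous_map_pairwise prod_tvs_def o_def case_prod_beta)
  with add show ?thesis
    by (simp add: pretvs_def pretvs_axioms_def real_module_prod_tvs V.real_module_axioms W.real_module_axioms)
qed

lemma nbhd0_prod_tvs:
  assumes "pretvs V" "pretvs W"
  shows "nbhd0 (prod_tvs V W) S \<longleftrightarrow>
    S \<subseteq> carrier V \<times> carrier W \<and> (\<exists>A G. nbhd0 V A \<and> nbhd0 W G \<and> A \<times> G \<subseteq> S)"
proof
  interpret V: pretvs V by fact
  interpret W: pretvs W by fact
  assume "nbhd0 (prod_tvs V W) S"
  then obtain T where S: "S \<subseteq> carrier V \<times> carrier W" and T: "openin (prod_topology (topo V) (topo W)) T"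
    "(\<zero>\<^bsub>V\<^esub>, \<zero>\<^bsub>W\<^esub>) \<in> T" "T \<subseteq> S" unfolding nbhd0_def by auto
  from T(1,2) obtain A G where "openin (topo V) A" "openin (topo W) G" "\<zero>\<^bsub>V\<^esub> \<in> A" "\<zero>\<^bsub>W\<^esub> \<in> G" "A \<times> G \<subseteq> T"
    unfolding openin_prod_topology_alt by metis
  then show "S \<subseteq> carrier V \<times> carrier W \<and> (\<exists>A G. nbhd0 V A \<and> nbhd0 W G \<and> A \<times> G \<subseteq> S)"
    using S T(3) V.openin_nbhd0 W.openin_nbhd0 by (meson order_trans)
next
  assume "S \<subseteq> carrier V \<times> carrier W \<and> (\<exists>A G. nbhd0 V A \<and> nbhd0 W G \<and> A \<times> G \<subseteq> S)"
  then obtain A G where S: "S \<subseteq> carrier V \<times> carrier W" "nbhd0 V A" "nbhd0 W G" "A \<times> G \<subseteq> S" by metis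
  obtain A' where A: "openin (topo V) A'" "\<zero>\<^bsub>V\<^esub> \<in> A'" "A' \<subseteq> A" using S(2) unfolding nbhd0_def by metis
  obtain G' where G: "openin (topo W) G'" "\<zero>\<^bsub>W\<^esub> \<in> G'" "G' \<subseteq> G" using S(3) unfolding nbhd0_def by metis
  show "nbhd0 (prod_tvs V W) S"
    unfolding nbhd0_def using A G S
    by (intro conjI exI[of _ "A' \<times> G'"]) (auto simp: openin_prod_Times_iff)
qed

definition linear_subspace :: "'a tvs \<Rightarrow> 'a set \<Rightarrow> bool" where
  "linear_subspace V S \<longleftrightarrow> S \<subseteq> carrier V \<and> \<zero>\<^bsub>V\<^esub> \<in> S \<and>
     (\<forall>x\<in>S. \<forall>y\<in>S. x \<oplus>\<^bsub>V\<^esub> y \<in> S) \<and> (\<forall>r. \<forall>x\<in>S. r \<odot>\<^bsub>V\<^esub> x \<in> S)"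

lemma pretvs_sub_tvs:
  assumes "pretvs V" and S: "linear_subspace V S"
  shows "pretvs (sub_tvs V S)"
proof -
  interpret V: pretvs V by fact
  have Sc: "x \<in> S \<Longrightarrow> x \<in> carrier V" for x using S by (auto simp: linear_subspace_def)
  have Ss: "S \<subseteq> carrier V" using Sc by auto
  have rm: "real_module (sub_tvs V S)"
    by (rule real_moduleI)
      (use S in \<open>auto simp: linear_subspace_def Sc V.a_ac V.smult_add_left V.smult_add_right V.smult_smult\<close>)
  have "continuous_map (prod_topology (subtopology (topo V) S) (subtopology (topo V) S)) (topo V) (\<lambda>(x, y). x \<oplus>\<^bsub>V\<^esub> y)"
    using V.continuous_add continuous_map_from_subtopology unfolding prod_topology_subtopology subtopology_subtopology by metis
  then have a: "continuous_map (prod_topology (subtopology (topo V) S) (subtopology (topo V) S)) (subtopology (topo V) S)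
      (\<lambda>(x, y). x \<oplus>\<^bsub>V\<^esub> y)"
    using S Ss by (auto simp: continuous_map_in_subtopology linear_subspace_def)
  have "continuous_map (prod_topology euclideanreal (subtopology (topo V) S)) (topo V) (\<lambda>(r, y). r \<odot>\<^bsub>V\<^esub> y)"
    using V.continuous_smult continuous_map_from_subtopology unfolding prod_topology_subtopology by metis
  then have b: "continuous_map (prod_topology euclideanreal (subtopology (topo V) S)) (subtopology (topo V) S)
      (\<lambda>(r, y). r \<odot>\<^bsub>V\<^esub> y)"
    using S Ss by (auto simp: continuous_map_in_subtopology linear_subspace_def)
  from a b show ?thesis using rm Ss by (simp add: pretvs_def pretvs_axioms_def Int_absorb1)
qed

lemma nbhd0_sub_tvs:
  assumes "pretvs V" and S: "linear_subspace V S"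
  shows "nbhd0 (sub_tvs V S) U \<longleftrightarrow> U \<subseteq> S \<and> (\<exists>A. nbhd0 V A \<and> A \<inter> S \<subseteq> U)"
proof
  interpret V: pretvs V by fact
  assume "nbhd0 (sub_tvs V S) U"
  then obtain T where U: "U \<subseteq> S" "openin (subtopology (topo V) S) T" "\<zero>\<^bsub>V\<^esub> \<in> T" "T \<subseteq> U"
    unfolding nbhd0_def by auto
  then obtain A where "openin (topo V) A" "T = A \<inter> S" unfolding openin_subtopology by metis
  then show "U \<subseteq> S \<and> (\<exists>A. nbhd0 V A \<and> A \<inter> S \<subseteq> U)" using U V.openin_nbhd0 by auto
next
  assume "U \<subseteq> S \<and> (\<exists>A. nbhd0 V A \<and> A \<inter> S \<subseteq> U)"
  then obtain A where A: "U \<subseteq> S" "nbhd0 V A" "A \<inter> S \<subseteq> U" by metis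
  then obtain A' where "openin (topo V) A'" "\<zero>\<^bsub>V\<^esub> \<in> A'" "A' \<subseteq> A" unfolding nbhd0_def by metis
  then show "nbhd0 (sub_tvs V S) U" unfolding nbhd0_def using A S
    by (intro conjI exI[of _ "A' \<inter> S"]) (auto simp: linear_subspace_def openin_subtopology)
qed

lemma pullback_ext_sel [simp]:
  "carrier (middle (pullback_ext Z' f E)) =
     {(x, w). x \<in> carrier (middle E) \<and> w \<in> carrier Z' \<and> proj E x = f w}"
  "(x, w) \<oplus>\<^bsub>middle (pullback_ext Z' f E)\<^esub> (x', w') = (x \<oplus>\<^bsub>middle E\<^esub> x', w \<oplus>\<^bsub>Z'\<^esub> w')"
  "r \<odot>\<^bsub>middle (pullback_ext Z' f E)\<^esub> (x, w) = (r \<odot>\<^bsub>middle E\<^esub> x, r \<odot>\<^bsub>Z'\<^esub> w)"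
  "\<zero>\<^bsub>middle (pullback_ext Z' f E)\<^esub> = (\<zero>\<^bsub>middle E\<^esub>, \<zero>\<^bsub>Z'\<^esub>)"
  "incl (pullback_ext Z' f E) = (\<lambda>y. (incl E y, \<zero>\<^bsub>Z'\<^esub>))"
  "proj (pullback_ext Z' f E) = snd"
  by (simp_all add: pullback_ext_def)

text \<open>Here \<open>proj E\<close> may be any linear map, so that this also covers products of extensions, which
  are pulled back along the diagonal.\<close>

locale pullback_data = p: linear_map "middle E" Z "proj E" + f: linear_map Z' Z f
    + X: pretvs "middle E" + Z': pretvs Z'
  for E :: "('y, 'x, 'z) extension" and Z :: "'z tvs" and Z' :: "'w tvs" and f
begin

lemma subspace:
  "linear_subspace (prod_tvs (middle E) Z')
     {(x, w). x \<in> carrier (middle E) \<and> w \<in> carrier Z' \<and> proj E x = f w}"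
  unfolding linear_subspace_def by (auto simp: p.add p.smult f.add f.smult)

lemma pretvs_pullback: "pretvs (middle (pullback_ext Z' f E))"
  using pretvs_sub_tvs[OF pretvs_prod_tvs[OF X.pretvs_axioms Z'.pretvs_axioms] subspace]
  by (simp add: pullback_ext_def)

lemma nbhd0_pullback:
  "nbhd0 (middle (pullback_ext Z' f E)) U \<longleftrightarrow>
     U \<subseteq> carrier (middle (pullback_ext Z' f E)) \<and>
     (\<exists>A G. nbhd0 (middle E) A \<and> nbhd0 Z' G \<and>
        (\<forall>x\<in>A. \<forall>w\<in>G. proj E x = f w \<longrightarrow> (x, w) \<in> U))" (is "_ \<longleftrightarrow> ?R")
proof -
  let ?S = "{(x, w). x \<in> carrier (middle E) \<and> w \<in> carrier Z' \<and> proj E x = f w}"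
  have P: "pretvs (prod_tvs (middle E) Z')" by (rule pretvs_prod_tvs[OF X.pretvs_axioms Z'.pretvs_axioms])
  have "nbhd0 (middle (pullback_ext Z' f E)) U \<longleftrightarrow>
      U \<subseteq> ?S \<and> (\<exists>A. nbhd0 (prod_tvs (middle E) Z') A \<and> A \<inter> ?S \<subseteq> U)"
    using nbhd0_sub_tvs[OF P subspace] by (simp add: pullback_ext_def)
  also have "\<dots> \<longleftrightarrow> ?R"
    unfolding nbhd0_prod_tvs[OF X.pretvs_axioms Z'.pretvs_axioms] pullback_ext_sel
  proof (intro conj_cong refl iffI; elim exE conjE)
    fix A B G assume "A \<inter> ?S \<subseteq> U" "nbhd0 (middle E) B" "nbhd0 Z' G" "B \<times> G \<subseteq> A"
    then show "\<exists>A G. nbhd0 (middle E) A \<and> nbhd0 Z' G \<and> (\<forall>x\<in>A. \<forall>w\<in>G. proj E x = f w \<longrightarrow> (x, w) \<in> U)"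
      using X.nbhd0_subset Z'.nbhd0_subset by (intro exI[of _ B] exI[of _ G]) auto
  next
    fix A G assume "nbhd0 (middle E) A" "nbhd0 Z' G" "\<forall>x\<in>A. \<forall>w\<in>G. proj E x = f w \<longrightarrow> (x, w) \<in> U"
    then show "\<exists>A. (A \<subseteq> carrier (middle E) \<times> carrier Z' \<and>
        (\<exists>Aa G. nbhd0 (middle E) Aa \<and> nbhd0 Z' G \<and> Aa \<times> G \<subseteq> A)) \<and> A \<inter> ?S \<subseteq> U"
      using X.nbhd0_subset Z'.nbhd0_subset by (intro exI[of _ "A \<times> G"] conjI exI[of _ A] exI[of _ G]) auto
  qed
  finally show ?thesis .
qed

lemma fst_continuous_linear: "continuous_linear (middle (pullback_ext Z' f E)) (middle E) fst"
proof (rule continuous_linearI[OF pretvs_pullback X.pretvs_axioms])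
  show "tvs_linear (middle (pullback_ext Z' f E)) (middle E) fst" by (auto simp: tvs_linear_def)
  show "nbhd0 (middle (pullback_ext Z' f E)) {q \<in> carrier (middle (pullback_ext Z' f E)). fst q \<in> U}"
    if "nbhd0 (middle E) U" for U
    unfolding nbhd0_pullback using that X.nbhd0_subset[OF that]
    by (intro conjI exI[of _ U] exI[of _ "carrier Z'"]) auto
qed

end

lemma pullback_extension:
  assumes Y: "is_tvs Y" and Z': "is_tvs Z'" and Z: "pretvs Z" and E: "is_extension Z Y E"
    and f: "continuous_linear Z' Z f"
  shows "is_extension Z' Y (pullback_ext Z' f E)"
    and "restriction_map Y f (pullback_ext Z' f E) E fst"
proof -
  have p: "pretvs Y" "pretvs Z'" using Y Z' by (auto simp: is_tvs_iff)
  have "tvs_extension Z Y E" using p Z E by (simp add: tvs_extension_def tvs_extension_axioms_def)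
  then interpret E: tvs_extension Z Y E .
  have "pretvs_map Z' Z f" using p Z f by (intro pretvs_mapI) (simp_all add: continuous_linear_def)
  then interpret f: pretvs_map Z' Z f .
  interpret D: pullback_data E Z Z' f ..
  let ?P = "pullback_ext Z' f E"
  show "restriction_map Y f ?P E fst"
    using D.fst_continuous_linear by (auto simp: restriction_map_def)
  show "is_extension Z' Y ?P"
  proof (rule is_extensionI[OF p(2) Y])
    have "Hausdorff_space (prod_topology (topo (middle E)) (topo Z'))"
      using E.middle_tvs Z' by (simp add: is_tvs_iff Hausdorff_space_prod_topology)
    then show "is_tvs (middle ?P)"
      using D.pretvs_pullback
      by (simp add: is_tvs_iff) (simp add: pullback_ext_def Hausdorff_space_subtopology)
    show "tvs_linear Y (middle ?P) (incl ?P)"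
      by (auto simp: tvs_linear_def E.i.add E.i.smult)
    show "tvs_linear (middle ?P) Z' (proj ?P)"
      by (auto simp: tvs_linear_def)
    show "nbhd0 Y {y \<in> carrier Y. incl ?P y \<in> U}" if U: "nbhd0 (middle ?P) U" for U
    proof -
      obtain A G where A: "nbhd0 (middle E) A" "nbhd0 Z' G"
        "\<forall>x\<in>A. \<forall>w\<in>G. proj E x = f w \<longrightarrow> (x, w) \<in> U" using U unfolding D.nbhd0_pullback by metis
      show ?thesis
        by (rule E.Y.nbhd0_mono[OF E.nbhd0_incl_vimage[OF A(1)]]) (use A f.V.nbhd0_zero[OF A(2)] in auto)
    qed
    show "\<exists>O'. nbhd0 (middle ?P) O' \<and> (\<forall>y\<in>carrier Y. incl ?P y \<in> O' \<longrightarrow> y \<in> U)" if U: "nbhd0 Y U" for U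
    proof -
      obtain A where A: "nbhd0 (middle E) A" "\<And>y. y \<in> carrier Y \<Longrightarrow> incl E y \<in> A \<Longrightarrow> y \<in> U"
        using E.incl_openE[OF U] by metis
      have "nbhd0 (middle ?P) {q \<in> carrier (middle ?P). fst q \<in> A}"
        unfolding D.nbhd0_pullback using A E.X.nbhd0_subset[OF A(1)]
        by (intro conjI exI[of _ A] exI[of _ "carrier Z'"]) auto
      then show ?thesis using A(2) by (intro exI[of _ "{q \<in> carrier (middle ?P). fst q \<in> A}"]) auto
    qed
    show "nbhd0 (middle ?P) {q \<in> carrier (middle ?P). proj ?P q \<in> U}" if U: "nbhd0 Z' U" for U
      unfolding D.nbhd0_pullback using U f.V.nbhd0_subset[OF U]
      by (intro conjI exI[of _ "carrier (middle E)"] exI[of _ U]) auto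
    show "nbhd0 Z' (proj ?P ` U)" if U: "nbhd0 (middle ?P) U" for U
    proof -
      obtain A G where A: "nbhd0 (middle E) A" "nbhd0 Z' G"
        "\<forall>x\<in>A. \<forall>w\<in>G. proj E x = f w \<longrightarrow> (x, w) \<in> U" using U unfolding D.nbhd0_pullback by metis
      have Uc: "U \<subseteq> carrier (middle ?P)" using U unfolding D.nbhd0_pullback by metis
      have "nbhd0 Z' (G \<inter> {w \<in> carrier Z'. f w \<in> proj E ` A})"
        by (intro f.V.nbhd0_Int A(2) continuous_linear_nbhd0[OF p(2) Z f] E.nbhd0_proj_image A(1))
      then show ?thesis
      proof (rule f.V.nbhd0_mono)
        show "G \<inter> {w \<in> carrier Z'. f w \<in> proj E ` A} \<subseteq> proj ?P ` U"
        proof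
          fix w assume "w \<in> G \<inter> {w \<in> carrier Z'. f w \<in> proj E ` A}"
          then obtain x where "w \<in> G" "x \<in> A" "proj E x = f w" by auto
          then have "(x, w) \<in> U" using A(3) by auto
          then show "w \<in> proj ?P ` U" by force
        qed
        show "proj ?P ` U \<subseteq> carrier Z'" using Uc by auto
      qed
    qed
    show "proj ?P (incl ?P y) = \<zero>\<^bsub>Z'\<^esub>" for y by simp
    show "q \<in> incl ?P ` carrier Y" if q: "q \<in> carrier (middle ?P)" "proj ?P q = \<zero>\<^bsub>Z'\<^esub>" for q
    proof -
      obtain x where x: "x \<in> carrier (middle E)" "q = (x, \<zero>\<^bsub>Z'\<^esub>)" "proj E x = \<zero>\<^bsub>Z\<^esub>" using q by auto
      then obtain y where "y \<in> carrier Y" "x = incl E y" using E.proj_zeroE by metis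
      then show ?thesis using x by auto
    qed
  qed
qed

subsection \<open>Transport of extensions\<close>

lemma (in pretvs) tvs_base_balanced:
  "tvs_base V {U. nbhd0 V U \<and> (\<forall>r x. \<bar>r\<bar> \<le> 1 \<longrightarrow> x \<in> U \<longrightarrow> r \<odot> x \<in> U)}" (is "tvs_base V ?B")
proof (intro tvs_base.intro tvs_base_axioms.intro real_module_axioms)
  have "carrier V \<in> ?B" by simp
  then show "?B \<noteq> {}" by (metis empty_iff)
  show "x \<in> carrier V" if "S \<in> ?B" "x \<in> S" for S x using that nbhd0_subset by auto
  show "\<exists>R\<in>?B. R \<subseteq> S \<inter> T" if "S \<in> ?B" "T \<in> ?B" for S T
    using that nbhd0_Int by (intro bexI[of _ "S \<inter> T"]) auto
  show "\<exists>T\<in>?B. \<forall>x\<in>T. \<forall>y\<in>T. x \<oplus> y \<in> S" if "S \<in> ?B" for S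
  proof -
    have "nbhd0 V S" using that by simp
    then obtain T where "nbhd0 V T" "\<And>x y. x \<in> T \<Longrightarrow> y \<in> T \<Longrightarrow> x \<oplus> y \<in> S"
      "\<And>r x. \<bar>r\<bar> \<le> 1 \<Longrightarrow> x \<in> T \<Longrightarrow> r \<odot> x \<in> T" using nbhd0_halve_balanced by metis
    then show ?thesis by (intro bexI[of _ T]) auto
  qed
  show "r \<odot> x \<in> S" if "S \<in> ?B" "\<bar>r\<bar> \<le> 1" "x \<in> S" for S r x using that by auto
  show "\<exists>e>0. e \<odot> x \<in> S" if S: "S \<in> ?B" "x \<in> carrier V" for S x
  proof -
    obtain e where "e > 0" "\<And>r. \<bar>r\<bar> \<le> e \<Longrightarrow> r \<odot> x \<in> S" using nbhd0_absorbing[of S x] S by auto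
    then show ?thesis by (intro exI[of _ e]) auto
  qed
qed

text \<open>This justifies restricting \<open>Ext_TVS\<close> to middle spaces on \<open>'y \<times> 'z\<close>: \<open>E\<close> presents an
  extension on that type, with the balanced neighbourhoods of zero as base.\<close>

theorem (in tvs_extension) transport:
  assumes Y: "is_tvs Y" and Z: "is_tvs Z"
  obtains E' where "E' \<in> extensions Z Y" "ext_equiv Z Y E E'"
proof -
  define B where "B = {U. nbhd0 (middle E) U \<and> (\<forall>r x. \<bar>r\<bar> \<le> 1 \<longrightarrow> x \<in> U \<longrightarrow> r \<odot>\<^bsub>middle E\<^esub> x \<in> U)}"
  have BD: "nbhd0 (middle E) S" if "S \<in> B" for S using that by (simp add: B_def)
  have BE: "\<exists>S\<in>B. S \<subseteq> U" if U: "nbhd0 (middle E) U" for U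
  proof -
    obtain S where "nbhd0 (middle E) S" "S \<subseteq> U" "\<And>r x. \<bar>r\<bar> \<le> 1 \<Longrightarrow> x \<in> S \<Longrightarrow> r \<odot>\<^bsub>middle E\<^esub> x \<in> S"
      using X.nbhd0_balanced[OF U] by metis
    then show ?thesis unfolding B_def by (intro bexI[of _ S]) auto
  qed
  have base: "tvs_base (middle E) B" unfolding B_def by (rule X.tvs_base_balanced)
  have "pre_extension Z Y (middle E) (incl E) (proj E) B"
  proof (intro pre_extension.intro pre_extension_axioms.intro base i.linear_map_axioms p.linear_map_axioms Y Z)
    show "nbhd0 Y {y \<in> carrier Y. incl E y \<in> S}" if "S \<in> B" for S using BD[OF that] by (rule nbhd0_incl_vimage)
    show "nbhd0 Z (proj E ` S)" if "S \<in> B" for S using BD[OF that] by (rule nbhd0_proj_image)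
    show "\<exists>S\<in>B. \<forall>y\<in>carrier Y. incl E y \<in> S \<longrightarrow> y \<in> U" if U: "nbhd0 Y U" for U
    proof -
      obtain A where A: "nbhd0 (middle E) A" "\<And>y. y \<in> carrier Y \<Longrightarrow> incl E y \<in> A \<Longrightarrow> y \<in> U"
        using incl_openE[OF U] by metis
      obtain S where "S \<in> B" "S \<subseteq> A" using BE[OF A(1)] by metis
      then show ?thesis using A(2) by (intro bexI[of _ S]) auto
    qed
    show "\<exists>S\<in>B. proj E ` S \<subseteq> G" if G: "nbhd0 Z G" for G
    proof -
      obtain S where "S \<in> B" "S \<subseteq> {x \<in> carrier (middle E). proj E x \<in> G}" using BE[OF nbhd0_proj_vimage[OF G]] by metis
      then show ?thesis by (intro bexI[of _ S]) auto
    qed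
    show "\<exists>y\<in>carrier Y. \<forall>S\<in>B. c \<ominus>\<^bsub>middle E\<^esub> incl E y \<in> S"
      if c: "c \<in> carrier (middle E)" "proj E c = \<zero>\<^bsub>Z\<^esub>" for c
    proof -
      obtain y where "y \<in> carrier Y" "c = incl E y" using proj_zeroE[OF c] by metis
      then show ?thesis using BD X.nbhd0_zero c(1) by (intro bexI[of _ y]) auto
    qed
  qed simp
  then interpret P: pre_extension Z Y "middle E" "incl E" "proj E" B .
  have "restriction_map Y (\<lambda>z. z) E P.pre_ext P.cls"
    unfolding restriction_map_def P.pre_ext_sel
  proof (intro conjI ballI refl)
    show "continuous_linear (middle E) P.pre_middle P.cls"
    proof (rule continuous_linearI[OF X.pretvs_axioms P.pretvs_pre_middle P.cls_linear])
      fix U assume "nbhd0 P.pre_middle U"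
      then obtain S where S: "S \<in> B" "P.cls ` S \<subseteq> U" unfolding P.nbhd0_pre_middle by metis
      show "nbhd0 (middle E) {x \<in> carrier (middle E). P.cls x \<in> U}"
        by (rule X.nbhd0_mono[OF BD[OF S(1)]]) (use S(2) X.nbhd0_subset[OF BD[OF S(1)]] in auto)
    qed
    show "snd (P.cls x) = proj E x" if "x \<in> carrier (middle E)" for x using that by (rule P.snd_cls)
  qed
  then show thesis using that[of P.pre_ext] P.is_extension_pre_ext
    unfolding ext_equiv_iff extensions_def by auto
qed

lemma restriction_map_compose:
  assumes "restriction_map Y j E1 E2 R" "restriction_map Y k E2 E3 S"
  shows "restriction_map Y (\<lambda>z. k (j z)) E1 E3 (\<lambda>x. S (R x))"
proof -
  have "R x \<in> carrier (middle E2)" if "x \<in> carrier (middle E1)" for x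
    using assms(1) that by (auto simp: restriction_map_def continuous_linear_def tvs_linear_def)
  then show ?thesis
    using assms continuous_linear_compose[of "middle E1" "middle E2" R "middle E3" S]
    unfolding restriction_map_def by simp
qed

section \<open>Extending an extension from a dense subspace\<close>

lemma (in pretvs) countable_nbhd0_base:
  assumes "metrizable_space (topo V)"
  shows "\<exists>A :: nat \<Rightarrow> 'a set. (\<forall>n. nbhd0 V (A n)) \<and> (\<forall>U. nbhd0 V U \<longrightarrow> (\<exists>n. A n \<subseteq> U))"
proof -
  have "first_countable (topo V)" using assms by (rule metrizable_imp_first_countable)
  then obtain C where C: "countable C" "\<And>S. S \<in> C \<Longrightarrow> openin (topo V) S"
    "\<And>U. openin (topo V) U \<Longrightarrow> \<zero> \<in> U \<Longrightarrow> \<exists>S\<in>C. \<zero> \<in> S \<and> S \<subseteq> U"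
    unfolding first_countable_def topspace by (metis zero_closed)
  define D where "D = {S \<in> C. \<zero> \<in> S}"
  have "openin (topo V) (carrier V)" using openin_topspace[of "topo V"] by simp
  then have ne: "D \<noteq> {}" using C(3)[of "carrier V"] unfolding D_def by auto
  have D: "countable D" using C(1) unfolding D_def by simp
  show ?thesis
  proof (intro exI[of _ "from_nat_into D"] conjI allI impI)
    show "nbhd0 V (from_nat_into D n)" for n
      using from_nat_into[OF ne, of n] C(2) by (auto simp: D_def openin_nbhd0)
    fix U assume "nbhd0 V U"
    then obtain O' where O': "openin (topo V) O'" "\<zero> \<in> O'" "O' \<subseteq> U" unfolding nbhd0_def by metis
    then obtain S where S: "S \<in> D" "S \<subseteq> U" using C(3)[OF O'(1,2)] unfolding D_def by auto
    then show "\<exists>n. from_nat_into D n \<subseteq> U" using from_nat_into_surj[OF D S(1)] by auto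
  qed
qed

text \<open>Known as a string in the theory of topological vector spaces.\<close>

definition nbhd_string :: "'a tvs \<Rightarrow> (nat \<Rightarrow> 'a set) \<Rightarrow> bool" where
  "nbhd_string V A \<longleftrightarrow> (\<forall>n. nbhd0 V (A n) \<and>
     (\<forall>r x. \<bar>r\<bar> \<le> 1 \<longrightarrow> x \<in> A n \<longrightarrow> r \<odot>\<^bsub>V\<^esub> x \<in> A n) \<and>
     (\<forall>x\<in>A (Suc n). \<forall>y\<in>A (Suc n). x \<oplus>\<^bsub>V\<^esub> y \<in> A n))"

text \<open>Such a sequence can be chosen below any prescribed neighbourhoods, by repeated halving.\<close>

lemma (in pretvs) nbhd_string_exists:
  assumes "\<And>n::nat. nbhd0 V (U n)"
  shows "\<exists>A. nbhd_string V A \<and> (\<forall>n. A n \<subseteq> U n)"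
proof -
  let ?P = "\<lambda>n S. nbhd0 V S \<and> (\<forall>r x. \<bar>r\<bar> \<le> 1 \<longrightarrow> x \<in> S \<longrightarrow> r \<odot> x \<in> S) \<and> S \<subseteq> U n"
  let ?Q = "\<lambda>(n::nat) S S'. \<forall>x\<in>S'. \<forall>y\<in>S'. x \<oplus> y \<in> S"
  have "\<exists>A. \<forall>n. ?P n (A n) \<and> ?Q n (A n) (A (Suc n))"
  proof (rule dependent_nat_choice)
    obtain S where "nbhd0 V S" "S \<subseteq> U 0" "\<And>r x. \<bar>r\<bar> \<le> 1 \<Longrightarrow> x \<in> S \<Longrightarrow> r \<odot> x \<in> S"
      using nbhd0_balanced[OF assms] by metis
    then show "\<exists>S. ?P 0 S" by (intro exI[of _ S]) simp
    fix S n assume "?P n S"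
    then have "nbhd0 V (S \<inter> U (Suc n))" using nbhd0_Int assms by simp
    then obtain T where "nbhd0 V T" "T \<subseteq> S \<inter> U (Suc n)" "\<And>x y. x \<in> T \<Longrightarrow> y \<in> T \<Longrightarrow> x \<oplus> y \<in> S \<inter> U (Suc n)"
      "\<And>r x. \<bar>r\<bar> \<le> 1 \<Longrightarrow> x \<in> T \<Longrightarrow> r \<odot> x \<in> T" using nbhd0_halve_balanced by metis
    then show "\<exists>T. ?P (Suc n) T \<and> ?Q n S T" by (intro exI[of _ T]) simp
  qed
  then obtain A where "\<forall>n. ?P n (A n) \<and> ?Q n (A n) (A (Suc n))" by metis
  then show ?thesis by (intro exI[of _ A]) (simp add: nbhd_string_def)
qed

locale neighbourhood_string = pretvs V for V :: "'a tvs" (structure) + 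
  fixes A :: "nat \<Rightarrow> 'a set"
  assumes string: "nbhd_string V A"
begin

lemma nbhd: "nbhd0 V (A n)" using string by (simp add: nbhd_string_def)
lemma closed: "x \<in> A n \<Longrightarrow> x \<in> carrier V" using nbhd nbhd0_subset by metis
lemma add: "x \<in> A (Suc n) \<Longrightarrow> y \<in> A (Suc n) \<Longrightarrow> x \<oplus> y \<in> A n"
  using string by (simp add: nbhd_string_def)
lemma balanced: "\<bar>r\<bar> \<le> 1 \<Longrightarrow> x \<in> A n \<Longrightarrow> r \<odot> x \<in> A n"
  using string by (simp add: nbhd_string_def)
lemma zero: "\<zero> \<in> A n" using nbhd nbhd0_zero by metis
lemma minus: "x \<in> A n \<Longrightarrow> \<ominus> x \<in> A n"
  using balanced[of "-1" x n] closed[of x n] by (simp add: minus_one_smult)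
lemma diff: "x \<in> A (Suc n) \<Longrightarrow> y \<in> A (Suc n) \<Longrightarrow> x \<ominus> y \<in> A n"
  by (simp add: a_minus_def add minus)
lemma Suc_subset: "x \<in> A (Suc n) \<Longrightarrow> x \<in> A n"
  using add[of x n \<zero>] zero closed by simp
lemma mono: "m \<le> n \<Longrightarrow> x \<in> A n \<Longrightarrow> x \<in> A m"
proof (induction rule: dec_induct)
  case (step n) then show ?case using Suc_subset by simp
qed
lemma smult: "\<exists>l. \<forall>x\<in>A l. r \<odot> x \<in> A n"
proof -
  obtain k :: nat where k: "\<bar>r\<bar> < 2 ^ k" using real_arch_pow[of 2 "\<bar>r\<bar>"] by auto
  have "\<forall>(r::real) x. \<bar>r\<bar> \<le> 2 ^ k \<longrightarrow> x \<in> A (n + k) \<longrightarrow> r \<odot> x \<in> A n" for k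
  proof (induction k)
    case 0 then show ?case using balanced by simp
  next
    case (Suc k)
    show ?case
    proof (intro allI impI)
      fix r :: real and x assume r: "\<bar>r\<bar> \<le> 2 ^ Suc k" and x: "x \<in> A (n + Suc k)"
      have xc: "x \<in> carrier V" using closed x by metis
      have "(r / 2) \<odot> (x \<oplus> x) \<in> A n" using Suc add[of x "n + k" x] x r by simp
      moreover have "(r / 2) \<odot> (x \<oplus> x) = (r / 2 + r / 2) \<odot> x"
        using xc by (simp only: smult_add_left smult_add_right)
      ultimately show "r \<odot> x \<in> A n" by simp
    qed
  qed
  then show ?thesis using k by (meson less_imp_le)
qed

end

text \<open>
  \<open>A_base\<close> is what keeps the kernel of the new projection from becoming larger than \<open>Y\<close>, and
  \<open>H_A\<close> is what makes the new projection open.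
\<close>

locale completion_step = E: tvs_extension Z Y E + WS: neighbourhood_string "middle E" A + HS: neighbourhood_string W H
  + j: pretvs_map Z W j
  for Z :: "'z tvs" and Y :: "'y tvs" and E :: "('y, 'x, 'z) extension" and W :: "'w tvs"
    and A :: "nat \<Rightarrow> 'x set" and H :: "nat \<Rightarrow> 'w set" and j :: "'z \<Rightarrow> 'w" +
  assumes Y_tvs: "is_tvs Y" and W_tvs: "is_tvs W" and Y_complete: "tvs_complete Y"
    and A_base: "nbhd0 Y U \<Longrightarrow> \<exists>n. \<forall>y\<in>carrier Y. incl E y \<in> A n \<longrightarrow> y \<in> U"
    and H_A: "z \<in> carrier Z \<Longrightarrow> j z \<in> H n \<Longrightarrow> z \<in> proj E ` A n"
    and j_cont: "continuous_linear Z W j" and dense: "dense_image Z W j"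
begin

abbreviation "X \<equiv> middle E"

text \<open>
  The first component is only Cauchy for the countable system \<open>A\<close>, not for the topology of \<open>X\<close>. The
  remaining information on the limit is the point \<open>w\<close>, which is kept as a second component.
\<close>

definition Cauchy_pairs :: "((nat \<Rightarrow> 'x) \<times> 'w) set" where
  "Cauchy_pairs = {(x, w). (\<forall>n. x n \<in> carrier X) \<and> w \<in> carrier W \<and>
     (\<forall>k. \<exists>N. \<forall>m\<ge>N. \<forall>n\<ge>N. x m \<ominus>\<^bsub>X\<^esub> x n \<in> A k) \<and>
     (\<forall>k. \<exists>N. \<forall>n\<ge>N. j (proj E (x n)) \<ominus>\<^bsub>W\<^esub> w \<in> H k)}"

definition C :: "((nat \<Rightarrow> 'x) \<times> 'w) tvs" where
  "C = \<lparr>carrier = Cauchy_pairs, monoid.mult = undefined, one = undefined,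
     zero = (\<lambda>n. \<zero>\<^bsub>X\<^esub>, \<zero>\<^bsub>W\<^esub>),
     add = (\<lambda>(x, v) (y, w). (\<lambda>n. x n \<oplus>\<^bsub>X\<^esub> y n, v \<oplus>\<^bsub>W\<^esub> w)),
     smult = (\<lambda>r (x, w). (\<lambda>n. r \<odot>\<^bsub>X\<^esub> x n, r \<odot>\<^bsub>W\<^esub> w)),
     topo = undefined\<rparr>"

lemma C_sel [simp]:
  "carrier C = Cauchy_pairs" "\<zero>\<^bsub>C\<^esub> = (\<lambda>n. \<zero>\<^bsub>X\<^esub>, \<zero>\<^bsub>W\<^esub>)"
  "(x, v) \<oplus>\<^bsub>C\<^esub> (y, w) = (\<lambda>n. x n \<oplus>\<^bsub>X\<^esub> y n, v \<oplus>\<^bsub>W\<^esub> w)"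
  "r \<odot>\<^bsub>C\<^esub> (x, w) = (\<lambda>n. r \<odot>\<^bsub>X\<^esub> x n, r \<odot>\<^bsub>W\<^esub> w)"
  by (simp_all add: C_def)

lemma Cauchy_pairsD:
  assumes "(x, w) \<in> Cauchy_pairs"
  shows "x n \<in> carrier X" "w \<in> carrier W"
    "\<exists>N. \<forall>m\<ge>N. \<forall>n\<ge>N. x m \<ominus>\<^bsub>X\<^esub> x n \<in> A k"
    "\<exists>N. \<forall>n\<ge>N. j (proj E (x n)) \<ominus>\<^bsub>W\<^esub> w \<in> H k"
  using assms by (auto simp: Cauchy_pairs_def)

lemma Cauchy_pairsI:
  assumes "\<And>n. x n \<in> carrier X" "w \<in> carrier W"
    "\<And>k. \<exists>N. \<forall>m\<ge>N. \<forall>n\<ge>N. x m \<ominus>\<^bsub>X\<^esub> x n \<in> A k"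
    "\<And>k. \<exists>N. \<forall>n\<ge>N. j (proj E (x n)) \<ominus>\<^bsub>W\<^esub> w \<in> H k"
  shows "(x, w) \<in> Cauchy_pairs"
  using assms by (auto simp: Cauchy_pairs_def)

lemma Cauchy_pairs_add:
  assumes xv: "(x, v) \<in> Cauchy_pairs" and yw: "(y, w) \<in> Cauchy_pairs"
  shows "(\<lambda>n. x n \<oplus>\<^bsub>X\<^esub> y n, v \<oplus>\<^bsub>W\<^esub> w) \<in> Cauchy_pairs"
proof (rule Cauchy_pairsI)
  note c = Cauchy_pairsD(1,2)[OF xv] Cauchy_pairsD(1,2)[OF yw]
  show "x n \<oplus>\<^bsub>X\<^esub> y n \<in> carrier X" "v \<oplus>\<^bsub>W\<^esub> w \<in> carrier W" for n using c by simp_all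
  fix k
  obtain N where N: "\<And>m n. m \<ge> N \<Longrightarrow> n \<ge> N \<Longrightarrow> x m \<ominus>\<^bsub>X\<^esub> x n \<in> A (Suc k)"
    using Cauchy_pairsD(3)[OF xv] by metis
  obtain M where M: "\<And>m n. m \<ge> M \<Longrightarrow> n \<ge> M \<Longrightarrow> y m \<ominus>\<^bsub>X\<^esub> y n \<in> A (Suc k)"
    using Cauchy_pairsD(3)[OF yw] by metis
  show "\<exists>N. \<forall>m\<ge>N. \<forall>n\<ge>N. (x m \<oplus>\<^bsub>X\<^esub> y m) \<ominus>\<^bsub>X\<^esub> (x n \<oplus>\<^bsub>X\<^esub> y n) \<in> A k"
    using WS.add[OF N M] c by (intro exI[of _ "max M N"]) (simp add: E.X.add_diff_add)
  obtain N where N: "\<And>n. n \<ge> N \<Longrightarrow> j (proj E (x n)) \<ominus>\<^bsub>W\<^esub> v \<in> H (Suc k)"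
    using Cauchy_pairsD(4)[OF xv] by metis
  obtain M where M: "\<And>n. n \<ge> M \<Longrightarrow> j (proj E (y n)) \<ominus>\<^bsub>W\<^esub> w \<in> H (Suc k)"
    using Cauchy_pairsD(4)[OF yw] by metis
  show "\<exists>N. \<forall>n\<ge>N. j (proj E (x n \<oplus>\<^bsub>X\<^esub> y n)) \<ominus>\<^bsub>W\<^esub> (v \<oplus>\<^bsub>W\<^esub> w) \<in> H k"
    using HS.add[OF N M] c
    by (intro exI[of _ "max M N"]) (simp add: HS.add_diff_add E.p.add j.add)
qed

lemma Cauchy_pairs_smult:
  assumes xv: "(x, v) \<in> Cauchy_pairs"
  shows "(\<lambda>n. r \<odot>\<^bsub>X\<^esub> x n, r \<odot>\<^bsub>W\<^esub> v) \<in> Cauchy_pairs"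
proof (rule Cauchy_pairsI)
  note c = Cauchy_pairsD(1,2)[OF xv]
  show "r \<odot>\<^bsub>X\<^esub> x n \<in> carrier X" "r \<odot>\<^bsub>W\<^esub> v \<in> carrier W" for n using c by simp_all
  fix k
  obtain l where l: "\<And>x. x \<in> A l \<Longrightarrow> r \<odot>\<^bsub>X\<^esub> x \<in> A k" using WS.smult by metis
  obtain N where N: "\<And>m n. m \<ge> N \<Longrightarrow> n \<ge> N \<Longrightarrow> x m \<ominus>\<^bsub>X\<^esub> x n \<in> A l"
    using Cauchy_pairsD(3)[OF xv] by metis
  show "\<exists>N. \<forall>m\<ge>N. \<forall>n\<ge>N. r \<odot>\<^bsub>X\<^esub> x m \<ominus>\<^bsub>X\<^esub> r \<odot>\<^bsub>X\<^esub> x n \<in> A k"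
    using l[OF N] c by (intro exI[of _ N]) (simp add: E.X.smult_diff)
  obtain l where l: "\<And>x. x \<in> H l \<Longrightarrow> r \<odot>\<^bsub>W\<^esub> x \<in> H k" using HS.smult by metis
  obtain N where N: "\<And>n. n \<ge> N \<Longrightarrow> j (proj E (x n)) \<ominus>\<^bsub>W\<^esub> v \<in> H l"
    using Cauchy_pairsD(4)[OF xv] by metis
  show "\<exists>N. \<forall>n\<ge>N. j (proj E (r \<odot>\<^bsub>X\<^esub> x n)) \<ominus>\<^bsub>W\<^esub> r \<odot>\<^bsub>W\<^esub> v \<in> H k"
    using l[OF N] c
    by (intro exI[of _ N]) (simp add: HS.smult_diff E.p.smult j.smult)
qed

lemma const_Cauchy_pair: "x \<in> carrier X \<Longrightarrow> (\<lambda>n. x, j (proj E x)) \<in> Cauchy_pairs"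
  by (rule Cauchy_pairsI) (simp_all add: WS.zero HS.zero)

lemma real_module_C: "real_module C"
proof (rule real_moduleI)
  show "\<zero>\<^bsub>C\<^esub> \<in> carrier C" using const_Cauchy_pair[of "\<zero>\<^bsub>X\<^esub>"] by simp
qed (auto simp: Cauchy_pairs_add Cauchy_pairs_smult fun_eq_iff Cauchy_pairsD
    E.X.a_ac HS.a_ac E.X.smult_add_left E.X.smult_add_right E.X.smult_smult
    HS.smult_add_left HS.smult_add_right HS.smult_smult)

lemma C_diff:
  assumes "(x, v) \<in> Cauchy_pairs" "(y, w) \<in> Cauchy_pairs"
  shows "(x, v) \<ominus>\<^bsub>C\<^esub> (y, w) = (\<lambda>n. x n \<ominus>\<^bsub>X\<^esub> y n, v \<ominus>\<^bsub>W\<^esub> w)"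
proof -
  interpret C: real_module C by (rule real_module_C)
  have "\<ominus>\<^bsub>C\<^esub> (y, w) = (\<lambda>n. \<ominus>\<^bsub>X\<^esub> y n, \<ominus>\<^bsub>W\<^esub> w)"
    using C.minus_one_smult[of "(y, w)"] assms(2) Cauchy_pairsD[OF assms(2)]
    by (simp add: E.X.minus_one_smult HS.minus_one_smult)
  then show ?thesis by (simp add: a_minus_def)
qed

definition strip :: "nat \<Rightarrow> 'w set \<Rightarrow> ((nat \<Rightarrow> 'x) \<times> 'w) set" where
  "strip k G = {(x, w). (x, w) \<in> Cauchy_pairs \<and> w \<in> G \<and> (\<exists>N. \<forall>n\<ge>N. x n \<in> A k)}"

definition strips :: "((nat \<Rightarrow> 'x) \<times> 'w) set set" where
  "strips = {strip k G |k G. nbhd0 W G \<and> (\<forall>r x. \<bar>r\<bar> \<le> 1 \<longrightarrow> x \<in> G \<longrightarrow> r \<odot>\<^bsub>W\<^esub> x \<in> G)}"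

lemma stripsE:
  assumes "S \<in> strips"
  obtains k G where "S = strip k G" "nbhd0 W G" "\<forall>r x. \<bar>r\<bar> \<le> 1 \<longrightarrow> x \<in> G \<longrightarrow> r \<odot>\<^bsub>W\<^esub> x \<in> G"
  using assms unfolding strips_def by auto

lemma stripsI:
  "nbhd0 W G \<Longrightarrow> (\<And>r x. \<bar>r\<bar> \<le> 1 \<Longrightarrow> x \<in> G \<Longrightarrow> r \<odot>\<^bsub>W\<^esub> x \<in> G) \<Longrightarrow> strip k G \<in> strips"
  unfolding strips_def by auto

lemma stripI: "(x, w) \<in> Cauchy_pairs \<Longrightarrow> w \<in> G \<Longrightarrow> (\<And>n. n \<ge> N \<Longrightarrow> x n \<in> A k) \<Longrightarrow> (x, w) \<in> strip k G"
  unfolding strip_def by auto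

lemma stripE:
  assumes "(x, w) \<in> strip k G"
  obtains N where "(x, w) \<in> Cauchy_pairs" "w \<in> G" "\<forall>n\<ge>N. x n \<in> A k"
  using assms unfolding strip_def by auto

lemma tvs_base_C: "tvs_base C strips"
proof (intro tvs_base.intro tvs_base_axioms.intro real_module_C)
  have "strip 0 (carrier W) \<in> strips" by (rule stripsI) auto
  then show "strips \<noteq> {}" by (metis empty_iff)
  show "c \<in> carrier C" if "S \<in> strips" "c \<in> S" for S c
    using that by (auto elim!: stripsE simp: strip_def)
  show "\<exists>R\<in>strips. R \<subseteq> S \<inter> T" if ST: "S \<in> strips" "T \<in> strips" for S T
  proof -
    obtain k G where S: "S = strip k G" "nbhd0 W G" "\<forall>r x. \<bar>r\<bar> \<le> 1 \<longrightarrow> x \<in> G \<longrightarrow> r \<odot>\<^bsub>W\<^esub> x \<in> G"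
      using ST(1) by (rule stripsE)
    obtain l G' where T: "T = strip l G'" "nbhd0 W G'" "\<forall>r x. \<bar>r\<bar> \<le> 1 \<longrightarrow> x \<in> G' \<longrightarrow> r \<odot>\<^bsub>W\<^esub> x \<in> G'"
      using ST(2) by (rule stripsE)
    have "strip (max k l) (G \<inter> G') \<in> strips" using S T by (intro stripsI HS.nbhd0_Int) auto
    moreover have "strip (max k l) (G \<inter> G') \<subseteq> S \<inter> T"
      unfolding S(1) T(1) strip_def using WS.mono[of k "max k l"] WS.mono[of l "max k l"] by fastforce
    ultimately show ?thesis by metis
  qed
  show "\<exists>T\<in>strips. \<forall>c\<in>T. \<forall>d\<in>T. c \<oplus>\<^bsub>C\<^esub> d \<in> S" if ST: "S \<in> strips" for S
  proof -
    obtain k G where S: "S = strip k G" "nbhd0 W G" using ST by (metis stripsE)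
    obtain G' where G: "nbhd0 W G'" "\<And>x y. x \<in> G' \<Longrightarrow> y \<in> G' \<Longrightarrow> x \<oplus>\<^bsub>W\<^esub> y \<in> G"
       "\<And>r x. \<bar>r\<bar> \<le> 1 \<Longrightarrow> x \<in> G' \<Longrightarrow> r \<odot>\<^bsub>W\<^esub> x \<in> G'" using HS.nbhd0_halve_balanced[OF S(2)] by metis
    have "strip (Suc k) G' \<in> strips" using G by (intro stripsI) auto
    moreover have "c \<oplus>\<^bsub>C\<^esub> d \<in> S" if cd: "c \<in> strip (Suc k) G'" "d \<in> strip (Suc k) G'" for c d
    proof -
      obtain x v y w where e: "c = (x, v)" "d = (y, w)" by (metis surj_pair)
      obtain N where N: "(x, v) \<in> Cauchy_pairs" "v \<in> G'" "\<forall>n\<ge>N. x n \<in> A (Suc k)"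
        using cd(1) unfolding e by (rule stripE)
      obtain M where M: "(y, w) \<in> Cauchy_pairs" "w \<in> G'" "\<forall>n\<ge>M. y n \<in> A (Suc k)"
        using cd(2) unfolding e by (rule stripE)
      show ?thesis unfolding S(1) e C_sel
        by (rule stripI[where N = "max M N"])
          (use N M G(2) WS.add in \<open>auto intro: Cauchy_pairs_add\<close>)
    qed
    ultimately show ?thesis by (intro bexI[of _ "strip (Suc k) G'"]) auto
  qed
  show "r \<odot>\<^bsub>C\<^esub> c \<in> S" if ST: "S \<in> strips" "\<bar>r\<bar> \<le> 1" "c \<in> S" for S r c
  proof -
    obtain k G where S: "S = strip k G" "nbhd0 W G" "\<forall>r x. \<bar>r\<bar> \<le> 1 \<longrightarrow> x \<in> G \<longrightarrow> r \<odot>\<^bsub>W\<^esub> x \<in> G"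
      using ST(1) by (rule stripsE)
    obtain x v where e: "c = (x, v)" by (metis surj_pair)
    obtain N where N: "(x, v) \<in> Cauchy_pairs" "v \<in> G" "\<forall>n\<ge>N. x n \<in> A k"
      using ST(3) unfolding e S(1) by (rule stripE)
    show ?thesis unfolding S(1) e C_sel
      by (rule stripI[where N = N]) (use N S(3) ST(2) WS.balanced in \<open>auto intro: Cauchy_pairs_smult\<close>)
  qed
  show "\<exists>e>0. e \<odot>\<^bsub>C\<^esub> c \<in> S" if ST: "S \<in> strips" "c \<in> carrier C" for S c
  proof -
    obtain k G where S: "S = strip k G" "nbhd0 W G" "\<forall>r x. \<bar>r\<bar> \<le> 1 \<longrightarrow> x \<in> G \<longrightarrow> r \<odot>\<^bsub>W\<^esub> x \<in> G"
      using ST(1) by (rule stripsE)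
    obtain x w where e: "c = (x, w)" by (metis surj_pair)
    have xw: "(x, w) \<in> Cauchy_pairs" using ST(2) e by simp
    obtain N where N: "\<And>m n. m \<ge> N \<Longrightarrow> n \<ge> N \<Longrightarrow> x m \<ominus>\<^bsub>X\<^esub> x n \<in> A (Suc k)"
      using Cauchy_pairsD(3)[OF xw] by metis
    obtain a where a: "a > 0" "\<And>r. \<bar>r\<bar> \<le> a \<Longrightarrow> r \<odot>\<^bsub>X\<^esub> x N \<in> A (Suc k)"
      using E.X.nbhd0_absorbing[OF WS.nbhd Cauchy_pairsD(1)[OF xw]] by metis
    obtain b where b: "b > 0" "\<And>r. \<bar>r\<bar> \<le> b \<Longrightarrow> r \<odot>\<^bsub>W\<^esub> w \<in> G"
      using HS.nbhd0_absorbing[OF S(2) Cauchy_pairsD(2)[OF xw]] by metis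
    define r where "r = min 1 (min a b)"
    have r: "r > 0" "\<bar>r\<bar> \<le> 1" "\<bar>r\<bar> \<le> a" "\<bar>r\<bar> \<le> b" using a(1) b(1) by (auto simp: r_def)
    have "r \<odot>\<^bsub>X\<^esub> x n \<in> A k" if n: "n \<ge> N" for n
    proof -
      have "r \<odot>\<^bsub>X\<^esub> (x n \<ominus>\<^bsub>X\<^esub> x N) \<oplus>\<^bsub>X\<^esub> r \<odot>\<^bsub>X\<^esub> x N \<in> A k"
        by (intro WS.add WS.balanced r a(2) N n order_refl)
      then show ?thesis using Cauchy_pairsD(1)[OF xw] by (simp add: E.X.smult_diff)
    qed
    then have "r \<odot>\<^bsub>C\<^esub> c \<in> S" unfolding S(1) e C_sel
      using b(2)[OF r(4)] Cauchy_pairs_smult[OF xw] by (intro stripI[where N = N]) auto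
    with r(1) show ?thesis by metis
  qed
qed

text \<open>The index drops by one only once, however many steps are added up, because the steps shrink
  geometrically.\<close>

lemma telescope:
  assumes x: "\<And>n. x n \<in> carrier X" and d: "\<And>n. x (Suc n) \<ominus>\<^bsub>X\<^esub> x n \<in> A (Suc k + n)"
  shows "x (n + d) \<ominus>\<^bsub>X\<^esub> x n \<in> A (k + n)"
proof (induction d arbitrary: n)
  case 0
  show ?case using x by (simp add: WS.zero)
next
  case (Suc d)
  have "(x (Suc n + d) \<ominus>\<^bsub>X\<^esub> x (Suc n)) \<oplus>\<^bsub>X\<^esub> (x (Suc n) \<ominus>\<^bsub>X\<^esub> x n) \<in> A (k + n)"
    using Suc[of "Suc n"] d[of n] by (intro WS.add) simp_all
  then show ?case using x by (simp add: E.X.diff_add_diff)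
qed

text \<open>
  Approximate \<open>w\<close> by points \<open>z n\<close> of \<open>Z\<close>, within \<open>H (k + 3 + n)\<close>. Consecutive differences lie in
  \<open>H (k + 2 + n)\<close>, hence lift to \<open>u n \<in> A (k + 2 + n)\<close>, and the lifts add up to a Cauchy sequence.
  The telescoping sum costs one index and the initial term another one, which leaves \<open>A k\<close>.
  So the projection from Cauchy pairs is open, hence onto.
\<close>

lemma lift_point:
  assumes w: "w \<in> H (k + 3)"
  obtains x where "(x, w) \<in> Cauchy_pairs" "\<And>n. x n \<in> A k"
proof -
  have wc: "w \<in> carrier W" using w HS.closed by metis
  have "\<exists>z\<in>carrier Z. j z \<ominus>\<^bsub>W\<^esub> w \<in> H (k + 3 + n)" for n
    using dense wc HS.nbhd unfolding dense_image_def by metis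
  then obtain z where z: "\<And>n. z n \<in> carrier Z" "\<And>n. j (z n) \<ominus>\<^bsub>W\<^esub> w \<in> H (k + 3 + n)" by metis
  have "\<exists>u\<in>A (k + 2 + n). proj E u = z (Suc n) \<ominus>\<^bsub>Z\<^esub> z n" for n
  proof -
    have "(j (z (Suc n)) \<ominus>\<^bsub>W\<^esub> w) \<ominus>\<^bsub>W\<^esub> (j (z n) \<ominus>\<^bsub>W\<^esub> w) \<in> H (k + 2 + n)"
    proof (rule HS.diff)
      show "j (z (Suc n)) \<ominus>\<^bsub>W\<^esub> w \<in> H (Suc (k + 2 + n))"
        using HS.Suc_subset z(2)[of "Suc n"] by (simp add: numeral_3_eq_3)
      show "j (z n) \<ominus>\<^bsub>W\<^esub> w \<in> H (Suc (k + 2 + n))"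
        using z(2)[of n] by (simp add: numeral_3_eq_3)
    qed
    then have "j (z (Suc n) \<ominus>\<^bsub>Z\<^esub> z n) \<in> H (k + 2 + n)"
      using z(1) wc by (simp add: HS.diff_diff_cancel_right j.diff)
    then have "z (Suc n) \<ominus>\<^bsub>Z\<^esub> z n \<in> proj E ` A (k + 2 + n)" using z(1) by (intro H_A) auto
    then show ?thesis by auto
  qed
  then obtain u where u: "\<And>n. u n \<in> A (k + 2 + n)" "\<And>n. proj E (u n) = z (Suc n) \<ominus>\<^bsub>Z\<^esub> z n" by metis
  have uc: "u n \<in> carrier X" for n using u(1) WS.closed by metis
  have "(j (z 0) \<ominus>\<^bsub>W\<^esub> w) \<oplus>\<^bsub>W\<^esub> w \<in> H (k + 2)"
    using z(2)[of 0] w by (intro HS.add) (simp_all add: numeral_3_eq_3)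
  then have "j (z 0) \<in> H (k + 2)" using z(1) wc by simp
  then have "z 0 \<in> proj E ` A (k + 2)" using z(1) by (intro H_A)
  then obtain a where a: "a \<in> A (k + 2)" "proj E a = z 0" by auto
  have ac: "a \<in> carrier X" using a WS.closed by metis
  define x where "x n = rec_nat a (\<lambda>n y. y \<oplus>\<^bsub>X\<^esub> u n) n" for n
  have x0: "x 0 = a" and xS: "x (Suc n) = x n \<oplus>\<^bsub>X\<^esub> u n" for n by (simp_all add: x_def)
  have xc: "x n \<in> carrier X" for n by (induction n) (simp_all add: x0 xS ac uc)
  have px: "proj E (x n) = z n" for n
    by (induction n) (simp_all add: x0 xS a xc uc E.p.add u z)
  have tel: "x (n + d) \<ominus>\<^bsub>X\<^esub> x n \<in> A (Suc k + n)" for n d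
    by (rule telescope[OF xc]) (use u(1) uc xc in \<open>simp add: xS\<close>)
  have "(x, w) \<in> Cauchy_pairs"
  proof (rule Cauchy_pairsI[OF xc wc])
    fix l
    have "x m \<ominus>\<^bsub>X\<^esub> x n \<in> A l" if "m \<ge> l" "n \<ge> l" for m n
    proof -
      have "x m \<ominus>\<^bsub>X\<^esub> x l \<in> A (Suc k + l)" "x n \<ominus>\<^bsub>X\<^esub> x l \<in> A (Suc k + l)"
        using tel[of l "m - l"] tel[of l "n - l"] that by simp_all
      then have "(x m \<ominus>\<^bsub>X\<^esub> x l) \<ominus>\<^bsub>X\<^esub> (x n \<ominus>\<^bsub>X\<^esub> x l) \<in> A (k + l)"
        unfolding add_Suc by (rule WS.diff)
      then show ?thesis using xc WS.mono[of l "k + l"] by (simp add: E.X.diff_diff_cancel_right)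
    qed
    then show "\<exists>N. \<forall>m\<ge>N. \<forall>n\<ge>N. x m \<ominus>\<^bsub>X\<^esub> x n \<in> A l" by metis
    have "j (proj E (x n)) \<ominus>\<^bsub>W\<^esub> w \<in> H l" if "n \<ge> l" for n
      using HS.mono[OF _ z(2)[of n], of l] that by (simp add: px)
    then show "\<exists>N. \<forall>n\<ge>N. j (proj E (x n)) \<ominus>\<^bsub>W\<^esub> w \<in> H l" by metis
  qed
  moreover have "x n \<in> A k" for n
  proof -
    have "a \<oplus>\<^bsub>X\<^esub> (x n \<ominus>\<^bsub>X\<^esub> a) \<in> A k"
      using WS.mono[OF _ a(1), of "Suc k"] tel[of 0 n] by (intro WS.add) (simp_all add: x0)
    then show ?thesis using ac xc by simp
  qed
  ultimately show thesis using that by metis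
qed

text \<open>
  As the projections tend to zero, for every \<open>k\<close> some late term of \<open>x\<close> is within \<open>A k\<close> of some
  \<open>incl E (y k)\<close>. The \<open>y k\<close> form a Cauchy sequence in \<open>Y\<close>, because the \<open>A k\<close> induce the topology of
  \<open>Y\<close>, and its limit is the limit of \<open>x\<close>.
\<close>

lemma kernel_limit:
  assumes x: "(x, \<zero>\<^bsub>W\<^esub>) \<in> Cauchy_pairs"
  obtains y where "y \<in> carrier Y" "\<And>k. \<exists>N. \<forall>n\<ge>N. x n \<ominus>\<^bsub>X\<^esub> incl E y \<in> A k"
proof -
  note xc = Cauchy_pairsD(1)[OF x]
  have "\<exists>N y. y \<in> carrier Y \<and> x N \<ominus>\<^bsub>X\<^esub> incl E y \<in> A k \<and> (\<forall>m\<ge>N. \<forall>n\<ge>N. x m \<ominus>\<^bsub>X\<^esub> x n \<in> A k)" for k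
  proof -
    obtain N where N: "\<And>m n. m \<ge> N \<Longrightarrow> n \<ge> N \<Longrightarrow> x m \<ominus>\<^bsub>X\<^esub> x n \<in> A k"
      using Cauchy_pairsD(3)[OF x] by metis
    obtain M where M: "\<And>n. n \<ge> M \<Longrightarrow> j (proj E (x n)) \<ominus>\<^bsub>W\<^esub> \<zero>\<^bsub>W\<^esub> \<in> H k"
      using Cauchy_pairsD(4)[OF x] by metis
    let ?x = "x (max M N)"
    have "j (proj E ?x) \<in> H k" using M[of "max M N"] xc by simp
    then have "proj E ?x \<in> proj E ` A k" using xc by (intro H_A) auto
    then obtain u where u: "u \<in> A k" "proj E ?x = proj E u" by auto
    have uc: "u \<in> carrier X" using u(1) WS.closed by metis
    have "proj E (?x \<ominus>\<^bsub>X\<^esub> u) = \<zero>\<^bsub>Z\<^esub>" using u xc uc by (simp add: E.p.diff)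
    then obtain y where y: "y \<in> carrier Y" "?x \<ominus>\<^bsub>X\<^esub> u = incl E y"
      using E.proj_zeroE[of "?x \<ominus>\<^bsub>X\<^esub> u"] xc uc by auto
    have "?x \<ominus>\<^bsub>X\<^esub> incl E y = u" unfolding y(2)[symmetric] using xc uc by (simp add: E.X.diff_diff_self)
    then show ?thesis using y(1) u(1) N by (intro exI[of _ "max M N"] exI[of _ y]) auto
  qed
  then obtain N y where Ny: "\<And>k. y k \<in> carrier Y" "\<And>k. x (N k) \<ominus>\<^bsub>X\<^esub> incl E (y k) \<in> A k"
    "\<And>k m n. m \<ge> N k \<Longrightarrow> n \<ge> N k \<Longrightarrow> x m \<ominus>\<^bsub>X\<^esub> x n \<in> A k" by metis
  have ydiff: "incl E (y a \<ominus>\<^bsub>Y\<^esub> y b) \<in> A k" if ab: "a \<ge> k + 3" "b \<ge> k + 3" for a b k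
  proof -
    \<comment> \<open>compare both approximations with a common later term of \<open>x\<close>\<close>
    define m where "m = max (N a) (N b)"
    have 1: "x (N a) \<ominus>\<^bsub>X\<^esub> x m \<in> A (Suc (Suc (Suc k)))" "x (N b) \<ominus>\<^bsub>X\<^esub> x m \<in> A (Suc (Suc (Suc k)))"
      "x (N a) \<ominus>\<^bsub>X\<^esub> incl E (y a) \<in> A (Suc (Suc (Suc k)))" "x (N b) \<ominus>\<^bsub>X\<^esub> incl E (y b) \<in> A (Suc (Suc (Suc k)))"
      using WS.mono[of "k+3" a] WS.mono[of "k+3" b] ab Ny(2)[of a] Ny(2)[of b] Ny(3)[of a "N a" m] Ny(3)[of b "N b" m]
      by (auto simp: m_def numeral_3_eq_3)
    have "((x (N a) \<ominus>\<^bsub>X\<^esub> x m) \<ominus>\<^bsub>X\<^esub> (x (N b) \<ominus>\<^bsub>X\<^esub> x m)) \<ominus>\<^bsub>X\<^esub>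
       ((x (N a) \<ominus>\<^bsub>X\<^esub> incl E (y a)) \<ominus>\<^bsub>X\<^esub> (x (N b) \<ominus>\<^bsub>X\<^esub> incl E (y b))) \<in> A (Suc k)"
      by (rule WS.diff[OF WS.diff[OF 1(1,2)] WS.diff[OF 1(3,4)]])
    moreover have "((x (N a) \<ominus>\<^bsub>X\<^esub> x m) \<ominus>\<^bsub>X\<^esub> (x (N b) \<ominus>\<^bsub>X\<^esub> x m)) \<ominus>\<^bsub>X\<^esub>
       ((x (N a) \<ominus>\<^bsub>X\<^esub> incl E (y a)) \<ominus>\<^bsub>X\<^esub> (x (N b) \<ominus>\<^bsub>X\<^esub> incl E (y b))) = incl E (y a \<ominus>\<^bsub>Y\<^esub> y b)"
      using xc Ny(1)
      by (simp add: E.X.diff_diff_cancel_right E.X.diff_diff_diff[of "x (N a)" "incl E (y a)"]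
          E.X.diff_diff_self E.i.diff)
    ultimately show ?thesis using WS.Suc_subset by simp
  qed
  have "tvs_Cauchy_filter Y (filtermap y sequentially)"
    unfolding E.Y.tvs_Cauchy_filter_iff_nbhd0
  proof (intro conjI allI impI)
    show "filtermap y sequentially \<noteq> bot" by (simp add: filtermap_bot_iff)
    show "\<forall>\<^sub>F x in filtermap y sequentially. x \<in> carrier Y" by (simp add: eventually_filtermap Ny(1))
    fix U assume "nbhd0 Y U"
    then obtain k where k: "\<And>y. y \<in> carrier Y \<Longrightarrow> incl E y \<in> A k \<Longrightarrow> y \<in> U" using A_base by metis
    let ?Q = "\<lambda>v. \<exists>a\<ge>k+3. v = y a"
    have "eventually ?Q (filtermap y sequentially)"
      unfolding eventually_filtermap eventually_sequentially by auto
    moreover have "v \<ominus>\<^bsub>Y\<^esub> v' \<in> U" if vv: "?Q v" "?Q v'" for v v'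
    proof -
      obtain a b where "a \<ge> k + 3" "v = y a" "b \<ge> k + 3" "v' = y b" using vv by auto
      then show ?thesis using k ydiff Ny(1) by simp
    qed
    ultimately show "\<exists>Q. eventually Q (filtermap y sequentially) \<and> (\<forall>v v'. Q v \<longrightarrow> Q v' \<longrightarrow> v \<ominus>\<^bsub>Y\<^esub> v' \<in> U)"
      by (intro exI[of _ ?Q]) simp
  qed
  then obtain l where "limitin (topo Y) (\<lambda>x. x) l (filtermap y sequentially)"
    using Y_complete unfolding tvs_complete_def by metis
  then have l: "l \<in> carrier Y"
    and lim: "\<forall>U. nbhd0 Y U \<longrightarrow> (\<exists>M. \<forall>a\<ge>M. y a \<in> carrier Y \<and> y a \<ominus>\<^bsub>Y\<^esub> l \<in> U)"
    unfolding E.Y.limitin_iff_nbhd0 eventually_filtermap eventually_sequentially by simp_all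
  have "\<exists>M. \<forall>n\<ge>M. x n \<ominus>\<^bsub>X\<^esub> incl E l \<in> A k" for k
  proof -
    obtain M where M: "\<forall>a\<ge>M. y a \<in> carrier Y \<and> y a \<ominus>\<^bsub>Y\<^esub> l \<in> {y \<in> carrier Y. incl E y \<in> A (Suc k)}"
      using lim[rule_format, OF E.nbhd0_incl_vimage[OF WS.nbhd]] by (rule exE)
    define a where "a = max M (k + 2)"
    have a: "a \<ge> M" "a \<ge> Suc (Suc k)" by (auto simp: a_def)
    have "x n \<ominus>\<^bsub>X\<^esub> incl E l \<in> A k" if n: "n \<ge> N a" for n
    proof -
      have "x n \<ominus>\<^bsub>X\<^esub> x (N a) \<in> A (Suc (Suc k))" "x (N a) \<ominus>\<^bsub>X\<^esub> incl E (y a) \<in> A (Suc (Suc k))"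
        using WS.mono[OF a(2)] Ny(2)[of a] Ny(3)[OF n order_refl] by auto
      then have "(x n \<ominus>\<^bsub>X\<^esub> x (N a)) \<oplus>\<^bsub>X\<^esub> (x (N a) \<ominus>\<^bsub>X\<^esub> incl E (y a)) \<in> A (Suc k)" by (rule WS.add)
      then have 1: "x n \<ominus>\<^bsub>X\<^esub> incl E (y a) \<in> A (Suc k)" using xc Ny(1) by (simp add: E.X.diff_add_diff)
      have 2: "incl E (y a) \<ominus>\<^bsub>X\<^esub> incl E l \<in> A (Suc k)" using M a(1) Ny(1) l by (auto simp: E.i.diff)
      from WS.add[OF 1 2] show ?thesis using xc Ny(1) l by (simp add: E.X.diff_add_diff)
    qed
    then show ?thesis by metis
  qed
  with l show thesis using that by metis
qed

lemma pre_extension_C: "pre_extension W Y C (\<lambda>y. (\<lambda>n. incl E y, \<zero>\<^bsub>W\<^esub>)) snd strips"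
proof (intro pre_extension.intro pre_extension_axioms.intro tvs_base_C Y_tvs W_tvs
    linear_map.intro linear_map_axioms.intro E.Y.real_module_axioms real_module_C HS.real_module_axioms)
  have inC: "(\<lambda>n. incl E y, \<zero>\<^bsub>W\<^esub>) \<in> Cauchy_pairs" if "y \<in> carrier Y" for y
    using const_Cauchy_pair[of "incl E y"] that by simp
  then show "tvs_linear Y C (\<lambda>y. (\<lambda>n. incl E y, \<zero>\<^bsub>W\<^esub>))"
    by (auto simp: tvs_linear_def E.i.add E.i.smult)
  show "tvs_linear C W snd"
    by (auto simp: tvs_linear_def Cauchy_pairsD)
  show "nbhd0 Y {y \<in> carrier Y. (\<lambda>n. incl E y, \<zero>\<^bsub>W\<^esub>) \<in> S}" if S: "S \<in> strips" for S
  proof -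
    obtain k G where kG: "S = strip k G" "nbhd0 W G" using S by (metis stripsE)
    show ?thesis
      by (rule E.Y.nbhd0_mono[OF E.nbhd0_incl_vimage[OF WS.nbhd[of k]]])
        (use kG inC HS.nbhd0_zero in \<open>auto intro: stripI\<close>)
  qed
  have carr: "strip k (carrier W) \<in> strips" for k by (rule stripsI) auto
  show "\<exists>S\<in>strips. \<forall>y\<in>carrier Y. (\<lambda>n. incl E y, \<zero>\<^bsub>W\<^esub>) \<in> S \<longrightarrow> y \<in> U" if U: "nbhd0 Y U" for U
  proof -
    obtain k where k: "\<And>y. y \<in> carrier Y \<Longrightarrow> incl E y \<in> A k \<Longrightarrow> y \<in> U" using A_base[OF U] by metis
    show ?thesis
      by (rule bexI[OF _ carr[of k]]) (use k in \<open>auto simp: strip_def\<close>)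
  qed
  show "\<exists>S\<in>strips. snd ` S \<subseteq> G" if G: "nbhd0 W G" for G
  proof -
    obtain G' where G': "nbhd0 W G'" "G' \<subseteq> G" "\<And>r x. \<bar>r\<bar> \<le> 1 \<Longrightarrow> x \<in> G' \<Longrightarrow> r \<odot>\<^bsub>W\<^esub> x \<in> G'"
      using HS.nbhd0_balanced[OF G] by metis
    then show ?thesis by (intro bexI[OF _ stripsI[of G' 0]]) (auto simp: strip_def)
  qed
  show "nbhd0 W (snd ` S)" if S: "S \<in> strips" for S
  proof -
    obtain k G where kG: "S = strip k G" "nbhd0 W G" using S by (metis stripsE)
    show ?thesis
    proof (rule HS.nbhd0_mono[OF HS.nbhd0_Int[OF HS.nbhd[of "k + 3"] kG(2)]])
      show "H (k + 3) \<inter> G \<subseteq> snd ` S"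
      proof
        fix w assume w: "w \<in> H (k + 3) \<inter> G"
        then obtain x where "(x, w) \<in> Cauchy_pairs" "\<And>n. x n \<in> A k" using lift_point by blast
        then have "(x, w) \<in> S" using kG(1) w by (auto intro: stripI)
        then show "w \<in> snd ` S" by force
      qed
      show "snd ` S \<subseteq> carrier W" using kG HS.nbhd0_subset by (auto simp: strip_def)
    qed
  qed
  show "snd (\<lambda>n. incl E y, \<zero>\<^bsub>W\<^esub>) = \<zero>\<^bsub>W\<^esub>" for y by simp
  show "\<exists>y\<in>carrier Y. \<forall>S\<in>strips. c \<ominus>\<^bsub>C\<^esub> (\<lambda>n. incl E y, \<zero>\<^bsub>W\<^esub>) \<in> S"
    if c: "c \<in> carrier C" "snd c = \<zero>\<^bsub>W\<^esub>" for c
  proof -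
    obtain x where e: "c = (x, \<zero>\<^bsub>W\<^esub>)" using c(2) by (metis prod.collapse)
    have xc: "(x, \<zero>\<^bsub>W\<^esub>) \<in> Cauchy_pairs" using c(1) e by simp
    obtain y where y: "y \<in> carrier Y" "\<And>k. \<exists>N. \<forall>n\<ge>N. x n \<ominus>\<^bsub>X\<^esub> incl E y \<in> A k"
      using kernel_limit[OF xc] by metis
    interpret C: real_module C by (rule real_module_C)
    have d: "c \<ominus>\<^bsub>C\<^esub> (\<lambda>n. incl E y, \<zero>\<^bsub>W\<^esub>) = (\<lambda>n. x n \<ominus>\<^bsub>X\<^esub> incl E y, \<zero>\<^bsub>W\<^esub>)"
      unfolding e using C_diff[OF xc inC[OF y(1)]] by simp
    have dC: "(\<lambda>n. x n \<ominus>\<^bsub>X\<^esub> incl E y, \<zero>\<^bsub>W\<^esub>) \<in> Cauchy_pairs"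
      using C.minus_closed[of c "(\<lambda>n. incl E y, \<zero>\<^bsub>W\<^esub>)"] c(1) inC[OF y(1)] unfolding d by simp
    have "c \<ominus>\<^bsub>C\<^esub> (\<lambda>n. incl E y, \<zero>\<^bsub>W\<^esub>) \<in> S" if S: "S \<in> strips" for S
    proof -
      obtain k G where kG: "S = strip k G" "nbhd0 W G" using S by (metis stripsE)
      then show ?thesis unfolding d kG(1) strip_def using dC y(2)[of k] HS.nbhd0_zero by auto
    qed
    with y(1) show ?thesis by metis
  qed
qed

text \<open>The old middle space is mapped into the new one by constant sequences.\<close>

theorem extends: "\<exists>E'\<in>extensions W Y. \<exists>R. restriction_map Y j E E' R"
proof -
  interpret P: pre_extension W Y C "\<lambda>y. (\<lambda>n. incl E y, \<zero>\<^bsub>W\<^esub>)" snd strips by (rule pre_extension_C)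
  let ?c = "\<lambda>x. (\<lambda>n. x, j (proj E x))"
  have c: "tvs_linear X C ?c"
    by (auto simp: tvs_linear_def const_Cauchy_pair E.p.add E.p.smult j.add j.smult)
  have "restriction_map Y j E P.pre_ext (\<lambda>x. P.cls (?c x))"
    unfolding restriction_map_def P.pre_ext_sel
  proof (intro conjI ballI)
    show "continuous_linear X P.pre_middle (\<lambda>x. P.cls (?c x))"
    proof (rule continuous_linearI[OF E.X.pretvs_axioms P.pretvs_pre_middle tvs_linear_compose[OF c P.cls_linear]])
      fix U assume "nbhd0 P.pre_middle U"
      then obtain S where S: "S \<in> strips" "P.cls ` S \<subseteq> U" unfolding P.nbhd0_pre_middle by metis
      obtain k G where kG: "S = strip k G" "nbhd0 W G" using S(1) by (metis stripsE)
      \<comment> \<open>the second component of a strip is controlled through the continuity of \<open>j\<close> and \<open>proj E\<close>\<close>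
      let ?N = "A k \<inter> {x \<in> carrier X. proj E x \<in> {z \<in> carrier Z. j z \<in> G}}"
      have "nbhd0 X ?N"
        by (intro E.X.nbhd0_Int WS.nbhd E.nbhd0_proj_vimage
            continuous_linear_nbhd0[OF E.Z.pretvs_axioms HS.pretvs_axioms j_cont kG(2)])
      then show "nbhd0 X {x \<in> carrier X. P.cls (?c x) \<in> U}"
      proof (rule E.X.nbhd0_mono)
        show "?N \<subseteq> {x \<in> carrier X. P.cls (?c x) \<in> U}"
        proof
          fix x assume x: "x \<in> ?N"
          then have "?c x \<in> S" unfolding kG(1) by (intro stripI const_Cauchy_pair) auto
          then show "x \<in> {x \<in> carrier X. P.cls (?c x) \<in> U}" using S(2) x by auto
        qed
      qed auto
    qed
    show "P.cls (?c (incl E y)) = P.cls (\<lambda>n. incl E y, \<zero>\<^bsub>W\<^esub>)" if "y \<in> carrier Y" for y using that by simp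
    show "snd (P.cls (?c x)) = j (proj E x)" if "x \<in> carrier X" for x
      using that P.snd_cls[of "?c x"] const_Cauchy_pair by simp
  qed
  then show ?thesis using P.is_extension_pre_ext unfolding extensions_def by auto
qed

end

theorem (in tvs_extension) extends_to_dense_superspace:
  assumes Y: "is_tvs Y" and W: "is_tvs W" and compl: "tvs_complete Y"
    and metr: "metrizable_space (topo Y)"
    and j: "tvs_embedding Z W j" and dense: "dense_image Z W j"
  shows "\<exists>E'\<in>extensions W Y. \<exists>R. restriction_map Y j E E' R"
proof -
  interpret W: pretvs W using W by (simp add: is_tvs_iff)
  interpret j: pretvs_map Z W j
    using j by (intro pretvs_mapI Z.pretvs_axioms W.pretvs_axioms) (simp add: tvs_embedding_def continuous_linear_def)
  obtain D :: "nat \<Rightarrow> 'y set" where D: "\<forall>n. nbhd0 Y (D n)" "\<forall>U. nbhd0 Y U \<longrightarrow> (\<exists>n. D n \<subseteq> U)"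
    using Y.countable_nbhd0_base[OF metr] by metis
  have "\<exists>O'. nbhd0 (middle E) O' \<and> (\<forall>y\<in>carrier Y. incl E y \<in> O' \<longrightarrow> y \<in> D n)" for n
    using incl_openE[OF D(1)[rule_format, of n]] by metis
  then obtain O' where O': "\<And>n. nbhd0 (middle E) (O' n)"
    "\<And>n y. y \<in> carrier Y \<Longrightarrow> incl E y \<in> O' n \<Longrightarrow> y \<in> D n" by metis
  obtain A where A: "nbhd_string (middle E) A" "\<forall>n. A n \<subseteq> O' n"
    using X.nbhd_string_exists[of O', OF O'(1)] by metis
  interpret WS: neighbourhood_string "middle E" A by unfold_locales (rule A(1))
  have "\<exists>G. nbhd0 W G \<and> (\<forall>z\<in>carrier Z. j z \<in> G \<longrightarrow> z \<in> proj E ` A n)" for n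
    using j nbhd0_proj_image[OF WS.nbhd[of n]] unfolding tvs_embedding_def by metis
  then obtain G where G: "\<And>n. nbhd0 W (G n)"
    "\<And>n z. z \<in> carrier Z \<Longrightarrow> j z \<in> G n \<Longrightarrow> z \<in> proj E ` A n" by metis
  obtain H where H: "nbhd_string W H" "\<forall>n. H n \<subseteq> G n"
    using W.nbhd_string_exists[of G, OF G(1)] by metis
  interpret HS: neighbourhood_string W H by unfold_locales (rule H(1))
  interpret completion_step Z Y E W A H j
  proof unfold_locales
    show "\<exists>n. \<forall>y\<in>carrier Y. incl E y \<in> A n \<longrightarrow> y \<in> U" if U: "nbhd0 Y U" for U
    proof -
      obtain n where n: "D n \<subseteq> U" using D(2) U by metis
      show ?thesis using n O'(2)[of _ n] A(2) by (intro exI[of _ n]) (meson subsetD)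
    qed
    show "z \<in> proj E ` A n" if "z \<in> carrier Z" "j z \<in> H n" for z n
      using G(2)[OF that(1), of n] H(2) that(2) by (meson subsetD)
    show "continuous_linear Z W j" using j by (simp add: tvs_embedding_def)
  qed fact+
  show ?thesis by (rule extends)
qed

section \<open>Push-outs and Baer sums by mapping properties\<close>

text \<open>
  The push-out is accessed only through the continuous linear maps out of it, so this locale
  provides what is needed to construct such maps.
\<close>

locale linear_subspace_quotient = pretvs V for V :: "'a tvs" (structure) +
  fixes N :: "'a set"
  assumes subspace: "linear_subspace V N"
begin

lemma N_closed: "n \<in> N \<Longrightarrow> n \<in> carrier V"
  using subspace by (auto simp: linear_subspace_def)

lemma N_minus:
  assumes n: "n \<in> N" shows "\<ominus> n \<in> N"
proof -
  have "(-1) \<odot> n \<in> N" using subspace n unfolding linear_subspace_def by metis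
  then show ?thesis using minus_one_smult[OF N_closed[OF n]] by simp
qed

lemma subgroup: "subgroup N (add_monoid V)"
proof (rule subgroup.intro)
  show "inv\<^bsub>add_monoid V\<^esub> n \<in> N" if "n \<in> N" for n
    using N_minus[OF that] by (simp add: a_inv_def)
qed (use subspace in \<open>auto simp: linear_subspace_def\<close>)

sublocale abelian_subgroup N V
  by (intro abelian_subgroupI3 additive_subgroupI subgroup abelian_group_axioms)

lemma coset_eq: "N +> x = {n \<oplus> x |n. n \<in> N}"
  unfolding a_r_coset_def' by auto

lemma coset_eqI:
  assumes "x \<in> carrier V" "n \<in> N" shows "N +> (n \<oplus> x) = N +> x"
  using a_repr_independence[OF _ assms(1) subgroup, of "n \<oplus> x"] assms(2) by (auto simp: coset_eq)

lemma the_elem_coset: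
  assumes "x \<in> carrier V" "\<And>n. n \<in> N \<Longrightarrow> F (n \<oplus> x) = F x"
  shows "the_elem (F ` (N +> x)) = F x"
proof -
  have "x \<in> N +> x"
    unfolding coset_eq using subspace assms(1)
    by (intro CollectI exI[of _ \<zero>]) (simp add: linear_subspace_def)
  then have "F x \<in> F ` (N +> x)" by (rule imageI)
  moreover have "F ` (N +> x) \<subseteq> {F x}" using assms(2) by (auto simp: coset_eq)
  ultimately have "F ` (N +> x) = {F x}" by auto
  then show ?thesis by simp
qed

lemma carrier_quotient: "carrier (quotient_tvs V N) = (\<lambda>x. N +> x) ` carrier V"
  unfolding quotient_tvs_def A_RCOSETS_def' by auto

lemma quotient_add:
  "x \<in> carrier V \<Longrightarrow> y \<in> carrier V \<Longrightarrow>
   (N +> x) \<oplus>\<^bsub>quotient_tvs V N\<^esub> (N +> y) = N +> (x \<oplus> y)"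
  by (simp add: quotient_tvs_def a_rcos_sum)

lemma quotient_smult:
  assumes x: "x \<in> carrier V"
  shows "r \<odot>\<^bsub>quotient_tvs V N\<^esub> (N +> x) = N +> (r \<odot> x)"
proof -
  have rN: "r \<odot> n \<in> N" "n \<in> carrier V" if "n \<in> N" for n
    using subspace that by (auto simp: linear_subspace_def)
  have zN: "\<zero> \<in> N" using subspace by (simp add: linear_subspace_def)
  have "set_add V N ((\<lambda>y. r \<odot> y) ` (N +> x)) = N +> (r \<odot> x)"
  proof (intro equalityI subsetI)
    fix y assume "y \<in> set_add V N ((\<lambda>y. r \<odot> y) ` (N +> x))"
    then obtain m n where "m \<in> N" "n \<in> N" "y = m \<oplus> r \<odot> (n \<oplus> x)"
      unfolding set_add_def' coset_eq by auto
    then have "y = (m \<oplus> r \<odot> n) \<oplus> r \<odot> x" "m \<oplus> r \<odot> n \<in> N"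
      using rN x subspace by (auto simp: smult_add_right a_assoc linear_subspace_def)
    then show "y \<in> N +> (r \<odot> x)" unfolding coset_eq by auto
  next
    fix y assume "y \<in> N +> (r \<odot> x)"
    then obtain n where n: "n \<in> N" "y = n \<oplus> r \<odot> x" unfolding coset_eq by auto
    have "x \<in> N +> x" unfolding coset_eq using zN x by (intro CollectI exI[of _ \<zero>]) simp
    with n show "y \<in> set_add V N ((\<lambda>y. r \<odot> y) ` (N +> x))" unfolding set_add_def' by auto
  qed
  then show ?thesis by (simp add: quotient_tvs_def)
qed

lemma quotient_linear: "tvs_linear V (quotient_tvs V N) (\<lambda>x. N +> x)"
  unfolding tvs_linear_def by (auto simp: carrier_quotient quotient_add quotient_smult)

lemma quotient_quotient_map: "quotient_map (topo V) (topo (quotient_tvs V N)) (\<lambda>x. N +> x)"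
  by (simp add: quotient_tvs_def quotient_map_quotient_topology)

lemma quotient_continuous_linear: "continuous_linear V (quotient_tvs V N) (\<lambda>x. N +> x)"
  unfolding continuous_linear_def
  using quotient_linear quotient_imp_continuous_map[OF quotient_quotient_map] by simp

lemma quotient_continuous_linearI:
  assumes T: "continuous_linear V W T'" and eq: "\<And>x. x \<in> carrier V \<Longrightarrow> T (N +> x) = T' x"
  shows "continuous_linear (quotient_tvs V N) W T"
  unfolding continuous_linear_def
proof
  show "tvs_linear (quotient_tvs V N) W T"
    using T unfolding continuous_linear_def tvs_linear_def carrier_quotient
    by (auto simp: quotient_add quotient_smult eq)
  have "continuous_map (topo V) (topo W) (T \<circ> (\<lambda>x. N +> x))"
    by (rule continuous_map_eq[of _ _ T']) (use T eq in \<open>auto simp: continuous_linear_def\<close>)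
  then show "continuous_map (topo (quotient_tvs V N)) (topo W) T"
    by (rule continuous_compose_quotient_map[OF quotient_quotient_map])
qed

end

text \<open>The universal property of the push-out: a map out of it that is the given inclusion on \<open>Y\<close> is
  determined by its restriction \<open>S\<close> to the middle space of \<open>E0\<close>.\<close>

theorem (in tvs_extension) ext_equiv_pushout_iff:
  assumes A: "real_module A" and P: "pretvs (middle E0)"
    and i0: "tvs_linear A (middle E0) (incl E0)" and p0: "tvs_linear (middle E0) Z (proj E0)"
    and ip: "\<And>a. a \<in> carrier A \<Longrightarrow> proj E0 (incl E0 a) = \<zero>\<^bsub>Z\<^esub>"
    and g: "tvs_linear A Y g"
  shows "ext_equiv Z Y (pushout_ext A Y g E0) E \<longleftrightarrow>
    (\<exists>S. continuous_linear (middle E0) (middle E) S \<and>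
       (\<forall>a\<in>carrier A. S (incl E0 a) = incl E (g a)) \<and>
       (\<forall>x\<in>carrier (middle E0). proj E (S x) = proj E0 x))"
proof -
  interpret P: pretvs "middle E0" by fact
  interpret i0: linear_map A "middle E0" "incl E0"
    using A i0 P.real_module_axioms by (simp add: linear_map_def linear_map_axioms_def)
  interpret p0: linear_map "middle E0" Z "proj E0"
    using p0 by (simp add: linear_map_def linear_map_axioms_def P.real_module_axioms Z.real_module_axioms)
  interpret g: linear_map A Y g
    using A g by (simp add: linear_map_def linear_map_axioms_def Y.real_module_axioms)
  define Q where "Q = prod_tvs Y (middle E0)"
  define N where "N = (\<lambda>a. (g a, \<ominus>\<^bsub>middle E0\<^esub> incl E0 a)) ` carrier A"
  have Qp: "pretvs Q" unfolding Q_def by (rule pretvs_prod_tvs[OF Y.pretvs_axioms P])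
  have N_add: "(g a, \<ominus>\<^bsub>middle E0\<^esub> incl E0 a) \<oplus>\<^bsub>Q\<^esub> (g b, \<ominus>\<^bsub>middle E0\<^esub> incl E0 b) =
      (g (a \<oplus>\<^bsub>A\<^esub> b), \<ominus>\<^bsub>middle E0\<^esub> incl E0 (a \<oplus>\<^bsub>A\<^esub> b))" if "a \<in> carrier A" "b \<in> carrier A" for a b
    using that by (simp add: Q_def g.add i0.add P.minus_add P.a_comm)
  have N_smult: "r \<odot>\<^bsub>Q\<^esub> (g a, \<ominus>\<^bsub>middle E0\<^esub> incl E0 a) =
      (g (r \<odot>\<^bsub>A\<^esub> a), \<ominus>\<^bsub>middle E0\<^esub> incl E0 (r \<odot>\<^bsub>A\<^esub> a))" if "a \<in> carrier A" for a r
    using that by (simp add: Q_def g.smult i0.smult P.smult_minus)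
  have N_zero: "\<zero>\<^bsub>Q\<^esub> = (g \<zero>\<^bsub>A\<^esub>, \<ominus>\<^bsub>middle E0\<^esub> incl E0 \<zero>\<^bsub>A\<^esub>)"
    by (simp add: Q_def)
  have "linear_subspace Q N"
    unfolding linear_subspace_def
  proof (intro conjI ballI allI)
    show "N \<subseteq> carrier Q" by (auto simp: N_def Q_def)
    show "\<zero>\<^bsub>Q\<^esub> \<in> N" unfolding N_zero N_def by (rule imageI) simp
    show "x \<oplus>\<^bsub>Q\<^esub> y \<in> N" if "x \<in> N" "y \<in> N" for x y
      using that unfolding N_def by (auto simp: N_add)
    show "r \<odot>\<^bsub>Q\<^esub> x \<in> N" if "x \<in> N" for x r
      using that unfolding N_def by (auto simp: N_smult)
  qed
  then interpret Q: linear_subspace_quotient Q N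
    by (simp add: linear_subspace_quotient_def linear_subspace_quotient_axioms_def Qp)
  have Qc: "carrier Q = carrier Y \<times> carrier (middle E0)" by (simp add: Q_def)
  let ?E = "pushout_ext A Y g E0"
  have sel: "middle ?E = quotient_tvs Q N" "incl ?E v = N +>\<^bsub>Q\<^esub> (v, \<zero>\<^bsub>middle E0\<^esub>)"
    "proj ?E D = the_elem ((\<lambda>(v, x). proj E0 x) ` D)" for v D
    by (simp_all add: pushout_ext_def Let_def Q_def N_def)
  have shift: "n \<oplus>\<^bsub>Q\<^esub> (v, x) = (g a \<oplus>\<^bsub>Y\<^esub> v, (\<ominus>\<^bsub>middle E0\<^esub> incl E0 a) \<oplus>\<^bsub>middle E0\<^esub> x)"
    if "n = (g a, \<ominus>\<^bsub>middle E0\<^esub> incl E0 a)" for n a v x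
    unfolding that by (simp add: Q_def)
  have projE: "proj ?E (N +>\<^bsub>Q\<^esub> (v, x)) = proj E0 x" if vx: "v \<in> carrier Y" "x \<in> carrier (middle E0)" for v x
  proof -
    have "the_elem ((\<lambda>(v, x). proj E0 x) ` (N +>\<^bsub>Q\<^esub> (v, x))) = (\<lambda>(v, x). proj E0 x) (v, x)"
    proof (rule Q.the_elem_coset)
      show "(v, x) \<in> carrier Q" using vx by (simp add: Qc)
      fix n assume "n \<in> N"
      then obtain a where a: "a \<in> carrier A" "n = (g a, \<ominus>\<^bsub>middle E0\<^esub> incl E0 a)" unfolding N_def by auto
      show "(\<lambda>(v, x). proj E0 x) (n \<oplus>\<^bsub>Q\<^esub> (v, x)) = (\<lambda>(v, x). proj E0 x) (v, x)"
        unfolding shift[OF a(2)] using a(1) vx ip by (simp add: p0.add p0.minus)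
    qed
    then show ?thesis by (simp add: sel)
  qed
  show ?thesis
  proof
    assume "ext_equiv Z Y ?E E"
    then obtain T where T: "continuous_linear (quotient_tvs Q N) (middle E) T"
      "\<forall>y\<in>carrier Y. T (N +>\<^bsub>Q\<^esub> (y, \<zero>\<^bsub>middle E0\<^esub>)) = incl E y"
      "\<forall>D\<in>carrier (quotient_tvs Q N). proj E (T D) = proj ?E D"
      unfolding ext_equiv_def by (auto simp: sel(1,2))
    define S where "S x = T (N +>\<^bsub>Q\<^esub> (\<zero>\<^bsub>Y\<^esub>, x))" for x
    have "continuous_linear (middle E0) Q (Pair \<zero>\<^bsub>Y\<^esub>)"
      unfolding continuous_linear_def tvs_linear_def Q_def
      by (auto simp: continuous_map_pairwise o_def)
    from continuous_linear_compose[OF continuous_linear_compose[OF this Q.quotient_continuous_linear] T(1)]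
    have "continuous_linear (middle E0) (middle E) S" unfolding S_def .
    moreover have "S (incl E0 a) = incl E (g a)" if a: "a \<in> carrier A" for a
    proof -
      have "(g a, \<ominus>\<^bsub>middle E0\<^esub> incl E0 a) \<oplus>\<^bsub>Q\<^esub> (\<zero>\<^bsub>Y\<^esub>, incl E0 a) = (g a, \<zero>\<^bsub>middle E0\<^esub>)"
        using a by (simp add: Q_def P.l_neg)
      then have "N +>\<^bsub>Q\<^esub> (\<zero>\<^bsub>Y\<^esub>, incl E0 a) = N +>\<^bsub>Q\<^esub> (g a, \<zero>\<^bsub>middle E0\<^esub>)"
        using Q.coset_eqI[of "(\<zero>\<^bsub>Y\<^esub>, incl E0 a)" "(g a, \<ominus>\<^bsub>middle E0\<^esub> incl E0 a)"] a
        by (simp add: Qc N_def)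
      then show ?thesis using T(2) a by (simp add: S_def)
    qed
    moreover have "proj E (S x) = proj E0 x" if "x \<in> carrier (middle E0)" for x
      using T(3) that projE[of "\<zero>\<^bsub>Y\<^esub>" x] by (simp add: S_def Q.carrier_quotient Qc)
    ultimately show "\<exists>S. continuous_linear (middle E0) (middle E) S \<and>
       (\<forall>a\<in>carrier A. S (incl E0 a) = incl E (g a)) \<and>
       (\<forall>x\<in>carrier (middle E0). proj E (S x) = proj E0 x)" by auto
  next
    assume "\<exists>S. continuous_linear (middle E0) (middle E) S \<and>
       (\<forall>a\<in>carrier A. S (incl E0 a) = incl E (g a)) \<and>
       (\<forall>x\<in>carrier (middle E0). proj E (S x) = proj E0 x)"
    then obtain S where S: "continuous_linear (middle E0) (middle E) S"
      "\<And>a. a \<in> carrier A \<Longrightarrow> S (incl E0 a) = incl E (g a)"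
      "\<And>x. x \<in> carrier (middle E0) \<Longrightarrow> proj E (S x) = proj E0 x" by auto
    interpret S: pretvs_map "middle E0" "middle E" S
      using S(1) by (intro pretvs_mapI P X.pretvs_axioms) (simp add: continuous_linear_def)
    define T' where "T' = (\<lambda>(v, x). incl E v \<oplus>\<^bsub>middle E\<^esub> S x)"
    define T where "T D = the_elem (T' ` D)" for D
    have T: "T (N +>\<^bsub>Q\<^esub> (v, x)) = incl E v \<oplus>\<^bsub>middle E\<^esub> S x"
      if vx: "v \<in> carrier Y" "x \<in> carrier (middle E0)" for v x
    proof -
      have "the_elem (T' ` (N +>\<^bsub>Q\<^esub> (v, x))) = T' (v, x)"
      proof (rule Q.the_elem_coset)
        show "(v, x) \<in> carrier Q" using vx by (simp add: Qc)
        fix n assume "n \<in> N"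
        then obtain a where a: "a \<in> carrier A" "n = (g a, \<ominus>\<^bsub>middle E0\<^esub> incl E0 a)" unfolding N_def by auto
        have "T' (n \<oplus>\<^bsub>Q\<^esub> (v, x)) =
          (incl E (g a) \<oplus>\<^bsub>middle E\<^esub> incl E v) \<oplus>\<^bsub>middle E\<^esub> ((\<ominus>\<^bsub>middle E\<^esub> incl E (g a)) \<oplus>\<^bsub>middle E\<^esub> S x)"
          unfolding shift[OF a(2)] T'_def using a(1) vx by (simp add: S.add S.minus S(2) i.add)
        also have "\<dots> = T' (v, x)"
          unfolding T'_def using a(1) vx
          by (simp add: X.a_assoc X.a_lcomm[of "incl E v" "\<ominus>\<^bsub>middle E\<^esub> incl E (g a)"] X.r_neg2)
        finally show "T' (n \<oplus>\<^bsub>Q\<^esub> (v, x)) = T' (v, x)" .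
      qed
      then show ?thesis by (simp add: T_def T'_def)
    qed
    have "tvs_linear Q (middle E) T'"
      unfolding tvs_linear_def T'_def
      by (auto simp: Q_def i.add i.smult S.add S.smult X.a_ac X.smult_add_right)
    moreover have "continuous_map (topo Q) (topo (middle E)) T'"
      unfolding T'_def case_prod_beta Q_def prod_tvs_sel
      by (intro X.continuous_add_comp continuous_map_compose[OF continuous_map_fst, unfolded o_def]
          continuous_map_compose[OF continuous_map_snd, unfolded o_def])
        (use ext S(1) in \<open>auto simp: is_extension_def continuous_linear_def\<close>)
    ultimately have "continuous_linear Q (middle E) T'" by (simp add: continuous_linear_def)
    then have "continuous_linear (quotient_tvs Q N) (middle E) T"
      by (rule Q.quotient_continuous_linearI) (use T in \<open>auto simp: Qc T'_def\<close>)
    moreover have "T (incl ?E y) = incl E y" if "y \<in> carrier Y" for y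
      using T[OF that, of "\<zero>\<^bsub>middle E0\<^esub>"] that by (simp add: sel)
    moreover have "proj E (T D) = proj ?E D" if D: "D \<in> carrier (middle ?E)" for D
    proof -
      obtain v x where vx: "v \<in> carrier Y" "x \<in> carrier (middle E0)" "D = N +>\<^bsub>Q\<^esub> (v, x)"
        using D by (auto simp: sel(1) Q.carrier_quotient Qc)
      show ?thesis unfolding vx(3) T[OF vx(1,2)] projE[OF vx(1,2)]
        using vx by (simp add: p.add S(3))
    qed
    ultimately show "ext_equiv Z Y ?E E" unfolding ext_equiv_def sel(1) by auto
  qed
qed

abbreviation fibre_product :: "'z tvs \<Rightarrow> ('y, 'x, 'z) extension \<Rightarrow> ('y, 'u, 'z) extension \<Rightarrow>
    (('x \<times> 'u) \<times> 'z) tvs" where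
  "fibre_product Z E1 E2 \<equiv> middle (pullback_ext Z (\<lambda>z. (z, z)) (prod_ext E1 E2))"

lemma prod_ext_sel [simp]:
  "middle (prod_ext E1 E2) = prod_tvs (middle E1) (middle E2)"
  "incl (prod_ext E1 E2) = map_prod (incl E1) (incl E2)"
  "proj (prod_ext E1 E2) = map_prod (proj E1) (proj E2)"
  by (simp_all add: prod_ext_def)

text \<open>A Baer map adds up the two extensions fibrewise.\<close>

definition baer_map ::
  "'z tvs \<Rightarrow> 'y tvs \<Rightarrow> ('y, 'x, 'z) extension \<Rightarrow> ('y, 'u, 'z) extension \<Rightarrow> ('y, 'v, 'z) extension
     \<Rightarrow> (('x \<times> 'u) \<times> 'z \<Rightarrow> 'v) \<Rightarrow> bool" where
  "baer_map Z Y E1 E2 E S \<longleftrightarrow> continuous_linear (fibre_product Z E1 E2) (middle E) S \<and>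
     (\<forall>y\<in>carrier Y. \<forall>y'\<in>carrier Y. S ((incl E1 y, incl E2 y'), \<zero>\<^bsub>Z\<^esub>) = incl E (y \<oplus>\<^bsub>Y\<^esub> y')) \<and>
     (\<forall>q\<in>carrier (fibre_product Z E1 E2). proj E (S q) = snd q)"

locale extension_pair = E1: tvs_extension Z Y E1 + E2: tvs_extension Z Y E2
  for Z :: "'z tvs" and Y :: "'y tvs" and E1 :: "('y, 'x, 'z) extension"
    and E2 :: "('y, 'u, 'z) extension"
begin

text \<open>This is not made a sublocale: the diagonal would contribute the rewrite rule
  \<open>(\<zero>, \<zero>) = \<zero>\<close>, which is the reverse of one for products.\<close>

lemma pullback_data: "pullback_data (prod_ext E1 E2) (prod_tvs Z Z) Z (\<lambda>z. (z, z))"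
proof (intro pullback_data.intro linear_map.intro linear_map_axioms.intro, unfold prod_ext_sel)
  show "pretvs Z" "real_module Z" using E1.Z.pretvs_axioms E1.Z.real_module_axioms .
  show "pretvs (prod_tvs (middle E1) (middle E2))"
    by (intro pretvs_prod_tvs E1.X.pretvs_axioms E2.X.pretvs_axioms)
  show "real_module (prod_tvs (middle E1) (middle E2))"
    by (intro real_module_prod_tvs E1.X.real_module_axioms E2.X.real_module_axioms)
  show "tvs_linear (prod_tvs (middle E1) (middle E2)) (prod_tvs Z Z) (map_prod (proj E1) (proj E2))"
    by (auto simp: tvs_linear_def E1.p.add E2.p.add E1.p.smult E2.p.smult)
  show "tvs_linear Z (prod_tvs Z Z) (\<lambda>z. (z, z))"
    by (auto simp: tvs_linear_def)
qed (rule real_module_prod_tvs[OF E1.Z.real_module_axioms E1.Z.real_module_axioms])+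

lemmas pretvs_fibre_product = pullback_data.pretvs_pullback[OF pullback_data]

lemma nbhd0_fibre_product:
  "nbhd0 (fibre_product Z E1 E2) U \<longleftrightarrow> U \<subseteq> carrier (fibre_product Z E1 E2) \<and>
     (\<exists>A A' G. nbhd0 (middle E1) A \<and> nbhd0 (middle E2) A' \<and> nbhd0 Z G \<and>
        (\<forall>x\<in>A. \<forall>x'\<in>A'. \<forall>z\<in>G. proj E1 x = z \<longrightarrow> proj E2 x' = z \<longrightarrow> ((x, x'), z) \<in> U))" (is "_ \<longleftrightarrow> ?R")
proof
  assume "nbhd0 (fibre_product Z E1 E2) U"
  then have Uc: "U \<subseteq> carrier (fibre_product Z E1 E2)"
    and "\<exists>B G. nbhd0 (middle (prod_ext E1 E2)) B \<and> nbhd0 Z G \<and>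
       (\<forall>x\<in>B. \<forall>z\<in>G. proj (prod_ext E1 E2) x = (z, z) \<longrightarrow> (x, z) \<in> U)"
    unfolding pullback_data.nbhd0_pullback[OF pullback_data] by (rule conjunct1, rule conjunct2)
  then obtain B G where U: "nbhd0 (prod_tvs (middle E1) (middle E2)) B" "nbhd0 Z G"
    "\<And>x z. x \<in> B \<Longrightarrow> z \<in> G \<Longrightarrow> map_prod (proj E1) (proj E2) x = (z, z) \<Longrightarrow> (x, z) \<in> U"
    unfolding prod_ext_sel by blast
  then obtain A A' where "nbhd0 (middle E1) A" "nbhd0 (middle E2) A'" "A \<times> A' \<subseteq> B"
    unfolding nbhd0_prod_tvs[OF E1.X.pretvs_axioms E2.X.pretvs_axioms] by blast
  with Uc U show ?R by (intro conjI exI[of _ A] exI[of _ A'] exI[of _ G]) auto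
next
  assume ?R
  then obtain A A' G where U: "U \<subseteq> carrier (fibre_product Z E1 E2)"
    "nbhd0 (middle E1) A" "nbhd0 (middle E2) A'" "nbhd0 Z G"
    "\<forall>x\<in>A. \<forall>x'\<in>A'. \<forall>z\<in>G. proj E1 x = z \<longrightarrow> proj E2 x' = z \<longrightarrow> ((x, x'), z) \<in> U" by blast
  have "nbhd0 (prod_tvs (middle E1) (middle E2)) (A \<times> A')"
    unfolding nbhd0_prod_tvs[OF E1.X.pretvs_axioms E2.X.pretvs_axioms]
    using U(2,3) E1.X.nbhd0_subset E2.X.nbhd0_subset by (intro conjI exI[of _ A] exI[of _ A']) auto
  then show "nbhd0 (fibre_product Z E1 E2) U"
    unfolding pullback_data.nbhd0_pullback[OF pullback_data] prod_ext_sel using U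
    by (intro conjI exI[of _ "A \<times> A'"] exI[of _ G]) auto
qed

lemma nbhd0_fibre_productE:
  assumes "nbhd0 (fibre_product Z E1 E2) U"
  obtains A A' G where "nbhd0 (middle E1) A" "nbhd0 (middle E2) A'" "nbhd0 Z G"
    "\<forall>x\<in>A. \<forall>x'\<in>A'. \<forall>z\<in>G. proj E1 x = z \<longrightarrow> proj E2 x' = z \<longrightarrow> ((x, x'), z) \<in> U"
proof -
  have "\<exists>A A' G. nbhd0 (middle E1) A \<and> nbhd0 (middle E2) A' \<and> nbhd0 Z G \<and>
        (\<forall>x\<in>A. \<forall>x'\<in>A'. \<forall>z\<in>G. proj E1 x = z \<longrightarrow> proj E2 x' = z \<longrightarrow> ((x, x'), z) \<in> U)"
    using assms unfolding nbhd0_fibre_product by (rule conjunct2)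
  then show thesis using that by (elim exE conjE) (rule that)
qed

lemma carrier_fibre_product:
  "((x, x'), z) \<in> carrier (fibre_product Z E1 E2) \<longleftrightarrow>
     x \<in> carrier (middle E1) \<and> x' \<in> carrier (middle E2) \<and> z \<in> carrier Z \<and> proj E1 x = z \<and> proj E2 x' = z"
  by auto

lemma fibre_product_cases:
  assumes "q \<in> carrier (fibre_product Z E1 E2)"
  obtains x x' z where "q = ((x, x'), z)" "x \<in> carrier (middle E1)" "x' \<in> carrier (middle E2)"
    "z \<in> carrier Z" "proj E1 x = z" "proj E2 x' = z"
  using assms by auto

lemma fibre_product_diff:
  assumes "((x, x'), z) \<in> carrier (fibre_product Z E1 E2)" "((y, y'), w) \<in> carrier (fibre_product Z E1 E2)"
  shows "((x, x'), z) \<ominus>\<^bsub>fibre_product Z E1 E2\<^esub> ((y, y'), w) =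
    ((x \<ominus>\<^bsub>middle E1\<^esub> y, x' \<ominus>\<^bsub>middle E2\<^esub> y'), z \<ominus>\<^bsub>Z\<^esub> w)"
proof -
  interpret F: pretvs "fibre_product Z E1 E2" by (rule pretvs_fibre_product)
  have "\<ominus>\<^bsub>fibre_product Z E1 E2\<^esub> ((y, y'), w) = ((\<ominus>\<^bsub>middle E1\<^esub> y, \<ominus>\<^bsub>middle E2\<^esub> y'), \<ominus>\<^bsub>Z\<^esub> w)"
    using F.minus_one_smult[OF assms(2)] assms(2)
    by (simp add: E1.X.minus_one_smult E2.X.minus_one_smult E1.Z.minus_one_smult)
  then show ?thesis by (simp add: a_minus_def)
qed

lemma snd_continuous_linear: "continuous_linear (fibre_product Z E1 E2) Z snd"
proof (rule continuous_linearI[OF pretvs_fibre_product E1.Z.pretvs_axioms])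
  show "tvs_linear (fibre_product Z E1 E2) Z snd" by (auto simp: tvs_linear_def)
  show "nbhd0 (fibre_product Z E1 E2) {q \<in> carrier (fibre_product Z E1 E2). snd q \<in> U}"
    if U: "nbhd0 Z U" for U
    unfolding nbhd0_fibre_product using U E1.Z.nbhd0_subset[OF U]
    by (intro conjI exI[of _ "carrier (middle E1)"] exI[of _ "carrier (middle E2)"] exI[of _ U]) auto
qed

lemma ext_equiv_baer_iff:
  assumes "tvs_extension Z Y E"
  shows "ext_equiv Z Y (baer_ext Z Y E1 E2) E \<longleftrightarrow> (\<exists>S. baer_map Z Y E1 E2 E S)"
proof -
  interpret E: tvs_extension Z Y E by fact
  let ?P = "pullback_ext Z (\<lambda>z. (z, z)) (prod_ext E1 E2)"
  have "ext_equiv Z Y (pushout_ext (prod_tvs Y Y) Y (\<lambda>(y, y'). y \<oplus>\<^bsub>Y\<^esub> y') ?P) E \<longleftrightarrow>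
    (\<exists>S. continuous_linear (middle ?P) (middle E) S \<and>
       (\<forall>a\<in>carrier (prod_tvs Y Y). S (incl ?P a) = incl E ((\<lambda>(y, y'). y \<oplus>\<^bsub>Y\<^esub> y') a)) \<and>
       (\<forall>x\<in>carrier (middle ?P). proj E (S x) = proj ?P x))"
  proof (rule E.ext_equiv_pushout_iff)
    show "real_module (prod_tvs Y Y)" by (intro real_module_prod_tvs E1.Y.real_module_axioms)
    show "pretvs (middle ?P)" by (rule pretvs_fibre_product)
    show "tvs_linear (prod_tvs Y Y) (middle ?P) (incl ?P)"
      by (auto simp: tvs_linear_def E1.i.add E2.i.add E1.i.smult E2.i.smult)
    show "tvs_linear (middle ?P) Z (proj ?P)" by (auto simp: tvs_linear_def)
    show "proj ?P (incl ?P a) = \<zero>\<^bsub>Z\<^esub>" for a by simp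
    show "tvs_linear (prod_tvs Y Y) Y (\<lambda>(y, y'). y \<oplus>\<^bsub>Y\<^esub> y')"
      by (auto simp: tvs_linear_def E1.Y.a_ac E1.Y.smult_add_right)
  qed
  moreover have "(\<forall>a\<in>carrier (prod_tvs Y Y). Q a) \<longleftrightarrow> (\<forall>y\<in>carrier Y. \<forall>y'\<in>carrier Y. Q (y, y'))" for Q
    by auto
  ultimately show ?thesis by (simp only: baer_ext_def baer_map_def) simp
qed

end

section \<open>Restriction along a dense embedding\<close>

lemma continuous_linear_eq_on_dense:
  assumes A: "pretvs A" and P: "pretvs P" and W: "is_tvs W" and dense: "dense_image A P e"
    and e: "tvs_linear A P e"
    and u: "continuous_linear P W u" and v: "continuous_linear P W v"
    and eq: "\<And>a. a \<in> carrier A \<Longrightarrow> u (e a) = v (e a)" and p: "p \<in> carrier P"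
  shows "u p = v p"
proof -
  have Wp: "pretvs W" using W by (simp add: is_tvs_iff)
  have "pretvs_map P W u" "pretvs_map P W v" "pretvs_map A P e"
    using A P Wp e u v by (auto intro!: pretvs_mapI simp: continuous_linear_def)
  then interpret u: pretvs_map P W u + v: pretvs_map P W v + e: pretvs_map A P e .
  have "u p \<ominus>\<^bsub>W\<^esub> v p = \<zero>\<^bsub>W\<^esub>"
  proof (rule is_tvs_separated[OF W])
    show "u p \<ominus>\<^bsub>W\<^esub> v p \<in> carrier W" using p by simp
    fix U assume "nbhd0 W U"
    then obtain U' where U': "nbhd0 W U'" "\<And>x y. x \<in> U' \<Longrightarrow> y \<in> U' \<Longrightarrow> x \<ominus>\<^bsub>W\<^esub> y \<in> U"
      using u.W.nbhd0_halve_balanced by metis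
    have "nbhd0 P ({q \<in> carrier P. u q \<in> U'} \<inter> {q \<in> carrier P. v q \<in> U'})"
      by (intro u.V.nbhd0_Int continuous_linear_nbhd0[OF P Wp] u v U'(1))
    then obtain a where a: "a \<in> carrier A" "e a \<ominus>\<^bsub>P\<^esub> p \<in> {q \<in> carrier P. u q \<in> U'} \<inter> {q \<in> carrier P. v q \<in> U'}"
      using dense p unfolding dense_image_def by meson
    then have "u (e a \<ominus>\<^bsub>P\<^esub> p) \<in> U'" "v (e a \<ominus>\<^bsub>P\<^esub> p) \<in> U'" by auto
    then have "v (e a \<ominus>\<^bsub>P\<^esub> p) \<ominus>\<^bsub>W\<^esub> u (e a \<ominus>\<^bsub>P\<^esub> p) \<in> U" using U'(2) by simp
    then show "u p \<ominus>\<^bsub>W\<^esub> v p \<in> U"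
      using a(1) p eq by (simp add: u.diff v.diff u.W.diff_diff_cancel_left)
  qed
  then show ?thesis using p by (simp add: u.W.diff_eq_zero_iff)
qed

locale dense_pair =
  fixes Z :: "'z tvs" and Y :: "'y tvs" and W :: "'w tvs" and j :: "'z \<Rightarrow> 'w"
  assumes Z: "is_tvs Z" and Y: "is_tvs Y" and W: "is_tvs W"
    and j: "tvs_embedding Z W j" and dense: "dense_image Z W j"
    and Y_complete: "tvs_complete Y" and W_complete: "tvs_complete W"
    and Y_metrizable: "metrizable_space (topo Y)"
begin

sublocale Z: pretvs Z using Z by (simp add: is_tvs_iff)
sublocale Y: pretvs Y using Y by (simp add: is_tvs_iff)
sublocale W: pretvs W using W by (simp add: is_tvs_iff)

lemma j_linear: "continuous_linear Z W j"
  using j by (simp add: tvs_embedding_def)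

lemma tvs_extensionI:
  "is_extension Z Y E' \<Longrightarrow> tvs_extension Z Y E'" "is_extension W Y E \<Longrightarrow> tvs_extension W Y E"
  by (simp_all add: tvs_extension_def tvs_extension_axioms_def Y.pretvs_axioms Z.pretvs_axioms W.pretvs_axioms)

lemma restrictionI:
  "is_extension Z Y E' \<Longrightarrow> is_extension W Y E \<Longrightarrow> restriction_map Y j E' E R \<Longrightarrow>
   restriction Z Y E' W E j R"
  by (simp add: restriction_def restriction_axioms_def tvs_extensionI j)

text \<open>The pull-back along \<open>j\<close> is a restriction on another type; composing its projection to the middle
  space of \<open>E\<close> with an equivalence moves it to \<open>'y \<times> 'z\<close>.\<close>

lemma restriction_exists:
  assumes E: "is_extension W Y E"
  shows "\<exists>E'\<in>extensions Z Y. \<exists>R. restriction_map Y j E' E R"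
proof -
  note P = pullback_extension[OF Y Z W.pretvs_axioms E j_linear]
  obtain E' where E': "E' \<in> extensions Z Y" "ext_equiv Z Y (pullback_ext Z j E) E'"
    using tvs_extension.transport[OF tvs_extensionI(1)[OF P(1)] Y Z] by metis
  then have "ext_equiv Z Y E' (pullback_ext Z j E)"
    using ext_equiv_sym[OF Z.pretvs_axioms Y.pretvs_axioms P(1)] by (simp add: extensions_def)
  then obtain T where "restriction_map Y (\<lambda>z. z) E' (pullback_ext Z j E) T" unfolding ext_equiv_iff by metis
  from restriction_map_compose[OF this P(2)] E'(1) show ?thesis by auto
qed

lemma restriction_unique:
  assumes "is_extension W Y E" "is_extension Z Y E1" "is_extension Z Y E2"
    and "restriction_map Y j E1 E R1" "restriction_map Y j E2 E R2"
  shows "ext_equiv Z Y E1 E2"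
  by (rule restrictions_equivalent[OF restrictionI restrictionI]) (use assms in auto)

lemma restriction_cong_left:
  assumes "is_extension Z Y E1" "is_extension Z Y E2" "ext_equiv Z Y E1 E2" "restriction_map Y j E1 E R"
  shows "\<exists>R. restriction_map Y j E2 E R"
proof -
  have "ext_equiv Z Y E2 E1" by (rule ext_equiv_sym[OF Z.pretvs_axioms Y.pretvs_axioms assms(1-3)])
  then obtain T where "restriction_map Y (\<lambda>z. z) E2 E1 T" unfolding ext_equiv_iff by metis
  from restriction_map_compose[OF this assms(4)] show ?thesis by auto
qed

lemma restriction_cong_right:
  assumes "ext_equiv W Y E1 E2" "restriction_map Y j E E1 R"
  shows "\<exists>R. restriction_map Y j E E2 R"
proof -
  obtain T where "restriction_map Y (\<lambda>z. z) E1 E2 T" using assms(1) unfolding ext_equiv_iff by metis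
  from restriction_map_compose[OF assms(2) this] show ?thesis by auto
qed

text \<open>The map from the common restriction to \<open>E2\<close> extends by continuity to the middle space of \<open>E1\<close>,
  in which the restriction is dense.\<close>

lemma restriction_injective:
  assumes E: "is_extension Z Y E" and E1: "is_extension W Y E1" and E2: "is_extension W Y E2"
    and R1: "restriction_map Y j E E1 R1" and R2: "restriction_map Y j E E2 R2"
  shows "ext_equiv W Y E1 E2"
proof -
  interpret R1: restriction Z Y E W E1 j R1 using E E1 R1 by (intro restrictionI)
  interpret R2: restriction Z Y E W E2 j R2 using E E2 R2 by (intro restrictionI)
  have R2c: "continuous_linear (middle E) (middle E2) R2" using R2 by (simp add: restriction_map_def)
  obtain T where T: "continuous_linear (middle E1) (middle E2) T"
    "\<And>a. a \<in> carrier (middle E) \<Longrightarrow> T (R1 a) = R2 a"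
    using extend_from_dense[OF R1.E'.X.pretvs_axioms R1.E.X.pretvs_axioms R2.E.middle_tvs
        R2.E.complete_middle[OF Y_complete W_complete] R1.R_embedding R1.R_dense[OF dense] R2c] by metis
  have p1: "continuous_linear (middle E1) W (proj E1)" and p2: "continuous_linear (middle E2) W (proj E2)"
    using E1 E2 by (auto simp: is_extension_def)
  have "restriction_map Y (\<lambda>z. z) E1 E2 T"
    unfolding restriction_map_def
  proof (intro conjI ballI T(1))
    show "T (incl E1 y) = incl E2 y" if "y \<in> carrier Y" for y
      using T(2)[of "incl E y"] that by simp
    show "proj E2 (T x) = proj E1 x" if "x \<in> carrier (middle E1)" for x
      by (rule continuous_linear_eq_on_dense[OF R1.E'.X.pretvs_axioms R1.E.X.pretvs_axioms W R1.R_dense[OF dense]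
            R1.R.linear continuous_linear_compose[OF T(1) p2] p1 _ that])
        (simp add: T(2))
  qed
  then show ?thesis unfolding ext_equiv_iff by metis
qed

lemma extension_exists:
  assumes E: "is_extension Z Y E'"
  shows "\<exists>E\<in>extensions W Y. \<exists>R. restriction_map Y j E' E R"
  by (rule tvs_extension.extends_to_dense_superspace[OF tvs_extensionI(1)[OF E] Y W Y_complete Y_metrizable j dense])

end

subsection \<open>Restriction and Baer sums\<close>

locale restriction_pair = dense_pair Z Y W j
    + R1: restriction Z Y E1' W E1 j R1 + R2: restriction Z Y E2' W E2 j R2
  for Z :: "'z tvs" and Y :: "'y tvs" and W :: "'w tvs" and j :: "'z \<Rightarrow> 'w"
    and E1' :: "('y, 'u1, 'z) extension" and E1 :: "('y, 'x1, 'w) extension" and R1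
    and E2' :: "('y, 'u2, 'z) extension" and E2 :: "('y, 'x2, 'w) extension" and R2
begin

sublocale F: extension_pair W Y E1 E2 ..
sublocale F': extension_pair Z Y E1' E2' ..

text \<open>The inclusion of the fibre product of the restrictions into that of the extensions.\<close>

definition base_change :: "('u1 \<times> 'u2) \<times> 'z \<Rightarrow> ('x1 \<times> 'x2) \<times> 'w" where
  "base_change = map_prod (map_prod R1 R2) j"

lemma base_change_simp [simp]: "base_change ((x, x'), z) = ((R1 x, R2 x'), j z)"
  by (simp add: base_change_def)

lemma base_change_embedding:
  "tvs_embedding (fibre_product Z E1' E2') (fibre_product W E1 E2) base_change"
  unfolding tvs_embedding_def
proof (intro conjI allI impI)
  have lin: "tvs_linear (fibre_product Z E1' E2') (fibre_product W E1 E2) base_change"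
    by (auto simp: tvs_linear_def R1.R.add R2.R.add R1.R.smult R2.R.smult R1.j.add R1.j.smult)
  show "continuous_linear (fibre_product Z E1' E2') (fibre_product W E1 E2) base_change"
  proof (rule continuous_linearI[OF F'.pretvs_fibre_product F.pretvs_fibre_product lin])
    fix U assume "nbhd0 (fibre_product W E1 E2) U"
    then obtain A A' G where U: "nbhd0 (middle E1) A" "nbhd0 (middle E2) A'" "nbhd0 W G"
      "\<forall>x\<in>A. \<forall>x'\<in>A'. \<forall>z\<in>G. proj E1 x = z \<longrightarrow> proj E2 x' = z \<longrightarrow> ((x, x'), z) \<in> U"
      by (rule F.nbhd0_fibre_productE)
    have R1c: "continuous_linear (middle E1') (middle E1) R1" and R2c: "continuous_linear (middle E2') (middle E2) R2"
      using R1.R R2.R by (auto simp: restriction_map_def)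
    show "nbhd0 (fibre_product Z E1' E2') {q \<in> carrier (fibre_product Z E1' E2'). base_change q \<in> U}"
      unfolding F'.nbhd0_fibre_product
    proof (intro conjI exI)
      show "nbhd0 (middle E1') {x \<in> carrier (middle E1'). R1 x \<in> A}"
        by (rule continuous_linear_nbhd0[OF R1.E'.X.pretvs_axioms R1.E.X.pretvs_axioms R1c U(1)])
      show "nbhd0 (middle E2') {x \<in> carrier (middle E2'). R2 x \<in> A'}"
        by (rule continuous_linear_nbhd0[OF R2.E'.X.pretvs_axioms R2.E.X.pretvs_axioms R2c U(2)])
      show "nbhd0 Z {z \<in> carrier Z. j z \<in> G}"
        by (rule continuous_linear_nbhd0[OF Z.pretvs_axioms W.pretvs_axioms j_linear U(3)])
    qed (use U(4) in auto)
  qed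
  show "inj_on base_change (carrier (fibre_product Z E1' E2'))"
    using R1.R_embedding R2.R_embedding by (auto simp: inj_on_def tvs_embedding_def)
  fix U assume "nbhd0 (fibre_product Z E1' E2') U"
  then obtain A A' G where U: "nbhd0 (middle E1') A" "nbhd0 (middle E2') A'" "nbhd0 Z G"
    "\<forall>x\<in>A. \<forall>x'\<in>A'. \<forall>z\<in>G. proj E1' x = z \<longrightarrow> proj E2' x' = z \<longrightarrow> ((x, x'), z) \<in> U"
    by (rule F'.nbhd0_fibre_productE)
  obtain B where B: "nbhd0 (middle E1) B" "\<forall>x\<in>carrier (middle E1'). R1 x \<in> B \<longrightarrow> x \<in> A"
    using R1.R_embedding U(1) unfolding tvs_embedding_def by metis
  obtain B' where B': "nbhd0 (middle E2) B'" "\<forall>x\<in>carrier (middle E2'). R2 x \<in> B' \<longrightarrow> x \<in> A'"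
    using R2.R_embedding U(2) unfolding tvs_embedding_def by metis
  obtain D where D: "nbhd0 W D" "\<forall>z\<in>carrier Z. j z \<in> D \<longrightarrow> z \<in> G"
    using j U(3) unfolding tvs_embedding_def by metis
  let ?O = "{q \<in> carrier (fibre_product W E1 E2). fst (fst q) \<in> B \<and> snd (fst q) \<in> B' \<and> snd q \<in> D}"
  have "nbhd0 (fibre_product W E1 E2) ?O"
    unfolding F.nbhd0_fibre_product
    using B(1) B'(1) D(1) R1.E.X.nbhd0_subset[OF B(1)] R2.E.X.nbhd0_subset[OF B'(1)] W.nbhd0_subset[OF D(1)]
    by (intro conjI exI[of _ B] exI[of _ B'] exI[of _ D]) auto
  moreover have "\<forall>q\<in>carrier (fibre_product Z E1' E2'). base_change q \<in> ?O \<longrightarrow> q \<in> U"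
    using B(2) B'(2) D(2) U(4) by auto
  ultimately show "\<exists>O'. nbhd0 (fibre_product W E1 E2) O' \<and>
      (\<forall>q\<in>carrier (fibre_product Z E1' E2'). base_change q \<in> O' \<longrightarrow> q \<in> U)"
    by (intro exI[of _ ?O] conjI)
qed

text \<open>
  Given \<open>((x, x'), w)\<close>, move \<open>w\<close> slightly to a point \<open>j z\<close>. Both projections are open, so \<open>x\<close> and \<open>x'\<close>
  can be moved along by small \<open>a\<close> and \<open>a'\<close> with the same projection \<open>j z - w\<close>. The moved points lie
  over \<open>Z\<close> and hence in the restrictions.
\<close>

lemma base_change_dense:
  "dense_image (fibre_product Z E1' E2') (fibre_product W E1 E2) base_change"
  unfolding dense_image_def
proof (intro ballI allI impI)
  fix q U assume q: "q \<in> carrier (fibre_product W E1 E2)" and U0: "nbhd0 (fibre_product W E1 E2) U"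
  from U0 obtain A A' G where U: "nbhd0 (middle E1) A" "nbhd0 (middle E2) A'" "nbhd0 W G"
    "\<forall>x\<in>A. \<forall>x'\<in>A'. \<forall>z\<in>G. proj E1 x = z \<longrightarrow> proj E2 x' = z \<longrightarrow> ((x, x'), z) \<in> U"
    by (rule F.nbhd0_fibre_productE)
  obtain x x' w where e: "q = ((x, x'), w)" and x: "x \<in> carrier (middle E1)" "x' \<in> carrier (middle E2)"
    "w \<in> carrier W" "proj E1 x = w" "proj E2 x' = w" using q by (rule F.fibre_product_cases)
  have "nbhd0 W (proj E1 ` A \<inter> proj E2 ` A' \<inter> G)"
    by (intro W.nbhd0_Int R1.E.nbhd0_proj_image R2.E.nbhd0_proj_image U)
  then obtain z where z: "z \<in> carrier Z" "j z \<ominus>\<^bsub>W\<^esub> w \<in> proj E1 ` A \<inter> proj E2 ` A' \<inter> G"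
    using dense x(3) unfolding dense_image_def by metis
  then obtain a a' where a: "a \<in> A" "j z \<ominus>\<^bsub>W\<^esub> w = proj E1 a" "a' \<in> A'" "j z \<ominus>\<^bsub>W\<^esub> w = proj E2 a'" by auto
  have ac: "a \<in> carrier (middle E1)" "a' \<in> carrier (middle E2)"
    using a R1.E.X.nbhd0_subset[OF U(1)] R2.E.X.nbhd0_subset[OF U(2)] by auto
  have "proj E1 (x \<oplus>\<^bsub>middle E1\<^esub> a) = j z" "proj E2 (x' \<oplus>\<^bsub>middle E2\<^esub> a') = j z"
    using x ac z(1) by (simp_all add: R1.E.p.add R2.E.p.add flip: a(2,4))
  then obtain b b' where b: "b \<in> carrier (middle E1')" "R1 b = x \<oplus>\<^bsub>middle E1\<^esub> a" "proj E1' b = z"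
    "b' \<in> carrier (middle E2')" "R2 b' = x' \<oplus>\<^bsub>middle E2\<^esub> a'" "proj E2' b' = z"
    using R1.R_surjE[OF R1.E.X.a_closed[OF x(1) ac(1)] z(1)] R2.R_surjE[OF R2.E.X.a_closed[OF x(2) ac(2)] z(1)]
    by metis
  have bF: "((b, b'), z) \<in> carrier (fibre_product Z E1' E2')"
    unfolding F'.carrier_fibre_product using b z(1) by simp
  have bc: "base_change ((b, b'), z) \<in> carrier (fibre_product W E1 E2)"
    using base_change_embedding bF unfolding tvs_embedding_def continuous_linear_def tvs_linear_def by blast
  have "base_change ((b, b'), z) \<ominus>\<^bsub>fibre_product W E1 E2\<^esub> q = ((a, a'), j z \<ominus>\<^bsub>W\<^esub> w)"
    unfolding e base_change_simp
    by (subst F.fibre_product_diff) (use bc q e x ac b in auto)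
  also have "\<dots> \<in> U" using U(4) a z(2) by auto
  finally show "\<exists>q'\<in>carrier (fibre_product Z E1' E2').
      base_change q' \<ominus>\<^bsub>fibre_product W E1 E2\<^esub> q \<in> U" using bF by (rule bexI)
qed

text \<open>Over \<open>Z\<close> the map \<open>S\<close> takes its values in the image of the restriction \<open>E'\<close>, so it factors
  through it.\<close>

lemma baer_map_restrict:
  assumes E: "is_extension W Y E" and E': "is_extension Z Y E'" and R: "restriction_map Y j E' E R"
    and S: "baer_map W Y E1 E2 E S"
  obtains S' where "baer_map Z Y E1' E2' E' S'"
proof -
  interpret R: restriction Z Y E' W E j R using E E' R by (intro restrictionI)
  have Sc: "continuous_linear (fibre_product W E1 E2) (middle E) S"
    and Si: "\<And>y y'. y \<in> carrier Y \<Longrightarrow> y' \<in> carrier Y \<Longrightarrow> S ((incl E1 y, incl E2 y'), \<zero>\<^bsub>W\<^esub>) = incl E (y \<oplus>\<^bsub>Y\<^esub> y')"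
    and Sp: "\<And>q. q \<in> carrier (fibre_product W E1 E2) \<Longrightarrow> proj E (S q) = snd q"
    using S by (auto simp: baer_map_def)
  let ?F = "fibre_product Z E1' E2'"
  have bcl: "continuous_linear ?F (fibre_product W E1 E2) base_change"
    using base_change_embedding by (simp add: tvs_embedding_def)
  have bcc: "base_change q \<in> carrier (fibre_product W E1 E2)" if "q \<in> carrier ?F" for q
    using bcl that unfolding continuous_linear_def tvs_linear_def by blast
  have Scc: "S q \<in> carrier (middle E)" if "q \<in> carrier (fibre_product W E1 E2)" for q
    using Sc that unfolding continuous_linear_def tvs_linear_def by blast
  have pS: "proj E (S (base_change q)) = j (snd q)" if "q \<in> carrier ?F" for q
    using Sp[OF bcc[OF that]] by (simp add: base_change_def)
  have sndc: "snd q \<in> carrier Z" if "q \<in> carrier ?F" for q using that by auto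
  have "(\<lambda>q. S (base_change q)) ` carrier ?F \<subseteq> R ` carrier (middle E')"
  proof
    fix x assume "x \<in> (\<lambda>q. S (base_change q)) ` carrier ?F"
    then obtain q where q: "q \<in> carrier ?F" "x = S (base_change q)" by auto
    then obtain b where "b \<in> carrier (middle E')" "R b = x"
      using R.R_surjE[of x "snd q"] pS[OF q(1)] sndc[OF q(1)] Scc[OF bcc[OF q(1)]] by auto
    then show "x \<in> R ` carrier (middle E')" by auto
  qed
  from factor_through_embedding[OF F'.pretvs_fibre_product R.E'.X.pretvs_axioms R.E.X.pretvs_axioms R.R_embedding
      continuous_linear_compose[OF bcl Sc] this]
  obtain S' where S': "continuous_linear ?F (middle E') S'"
    "\<And>q. q \<in> carrier ?F \<Longrightarrow> R (S' q) = S (base_change q)" by blast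
  have S'c: "S' q \<in> carrier (middle E')" if "q \<in> carrier ?F" for q
    using S'(1) that unfolding continuous_linear_def tvs_linear_def by blast
  have inj: "inj_on R (carrier (middle E'))" using R.R_embedding by (simp add: tvs_embedding_def)
  have "baer_map Z Y E1' E2' E' S'"
    unfolding baer_map_def
  proof (intro conjI ballI S'(1))
    fix y y' assume y: "y \<in> carrier Y" "y' \<in> carrier Y"
    have q: "((incl E1' y, incl E2' y'), \<zero>\<^bsub>Z\<^esub>) \<in> carrier ?F"
      unfolding F'.carrier_fibre_product using y by simp
    show "S' ((incl E1' y, incl E2' y'), \<zero>\<^bsub>Z\<^esub>) = incl E' (y \<oplus>\<^bsub>Y\<^esub> y')"
      by (rule inj_onD[OF inj _ S'c[OF q]]) (use S'(2)[OF q] y Si in simp_all)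
  next
    fix q assume q: "q \<in> carrier ?F"
    have "j (proj E' (S' q)) = j (snd q)"
      using R.proj_R[OF S'c[OF q]] S'(2)[OF q] pS[OF q] by simp
    then show "proj E' (S' q) = snd q" using R.j_inj sndc[OF q] S'c[OF q] by simp
  qed
  then show thesis by (rule that)
qed

text \<open>The middle space of \<open>E\<close> is complete, so \<open>S'\<close> extends by continuity from the dense fibre product
  of the restrictions; compatibility with the projections extends by uniqueness.\<close>

lemma baer_map_extend:
  assumes E: "is_extension W Y E" and E': "is_extension Z Y E'" and R: "restriction_map Y j E' E R"
    and S': "baer_map Z Y E1' E2' E' S'"
  obtains S where "baer_map W Y E1 E2 E S"
proof -
  interpret R: restriction Z Y E' W E j R using E E' R by (intro restrictionI)
  let ?F = "fibre_product Z E1' E2'"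
  have Sc: "continuous_linear ?F (middle E') S'"
    and Si: "\<And>y y'. y \<in> carrier Y \<Longrightarrow> y' \<in> carrier Y \<Longrightarrow> S' ((incl E1' y, incl E2' y'), \<zero>\<^bsub>Z\<^esub>) = incl E' (y \<oplus>\<^bsub>Y\<^esub> y')"
    and Sp: "\<And>q. q \<in> carrier ?F \<Longrightarrow> proj E' (S' q) = snd q"
    using S' by (auto simp: baer_map_def)
  have Scc: "S' q \<in> carrier (middle E')" if "q \<in> carrier ?F" for q
    using Sc that unfolding continuous_linear_def tvs_linear_def by blast
  have Rc: "continuous_linear (middle E') (middle E) R" using R by (simp add: restriction_map_def)
  from extend_from_dense[OF F'.pretvs_fibre_product F.pretvs_fibre_product R.E.middle_tvs
      R.E.complete_middle[OF Y_complete W_complete] base_change_embedding base_change_dense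
      continuous_linear_compose[OF Sc Rc]]
  obtain S where S: "continuous_linear (fibre_product W E1 E2) (middle E) S"
    "\<And>q. q \<in> carrier ?F \<Longrightarrow> S (base_change q) = R (S' q)" by blast
  have pc: "continuous_linear (middle E) W (proj E)" using E by (simp add: is_extension_def)
  have bcl: "tvs_linear ?F (fibre_product W E1 E2) base_change"
    using base_change_embedding by (simp add: tvs_embedding_def continuous_linear_def)
  have "baer_map W Y E1 E2 E S"
    unfolding baer_map_def
  proof (intro conjI ballI S(1))
    fix y y' assume y: "y \<in> carrier Y" "y' \<in> carrier Y"
    have q: "((incl E1' y, incl E2' y'), \<zero>\<^bsub>Z\<^esub>) \<in> carrier ?F"
      unfolding F'.carrier_fibre_product using y by simp
    show "S ((incl E1 y, incl E2 y'), \<zero>\<^bsub>W\<^esub>) = incl E (y \<oplus>\<^bsub>Y\<^esub> y')"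
      using S(2)[OF q] y Si by simp
  next
    fix q assume q: "q \<in> carrier (fibre_product W E1 E2)"
    show "proj E (S q) = snd q"
    proof (rule continuous_linear_eq_on_dense[OF F'.pretvs_fibre_product F.pretvs_fibre_product W base_change_dense bcl
            continuous_linear_compose[OF S(1) pc] F.snd_continuous_linear _ q])
      fix a assume a: "a \<in> carrier ?F"
      show "proj E (S (base_change a)) = snd (base_change a)"
        using S(2)[OF a] R.proj_R[OF Scc[OF a]] Sp[OF a] by (simp add: base_change_def)
    qed
  qed
  then show thesis by (rule that)
qed

end

section \<open>The isomorphism\<close>

lemma ext_equiv_refl: "ext_equiv Z Y E E"
  unfolding ext_equiv_def by (intro exI[of _ "\<lambda>x. x"]) (simp add: continuous_linear_id)

lemma ext_equiv_trans:
  assumes "ext_equiv Z Y E1 E2" "ext_equiv Z Y E2 E3" shows "ext_equiv Z Y E1 E3"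
proof -
  obtain R S where "restriction_map Y (\<lambda>z. z) E1 E2 R" "restriction_map Y (\<lambda>z. z) E2 E3 S"
    using assms unfolding ext_equiv_iff by metis
  from restriction_map_compose[OF this] show ?thesis unfolding ext_equiv_iff by auto
qed

lemma equiv_ext_rel:
  assumes "pretvs Z" "pretvs Y" shows "equiv (extensions Z Y) (ext_rel Z Y)"
proof (rule equivI)
  show "ext_rel Z Y \<subseteq> extensions Z Y \<times> extensions Z Y" by (auto simp: ext_rel_def)
  show "refl_on (extensions Z Y) (ext_rel Z Y)"
    by (rule refl_onI) (auto simp: ext_rel_def ext_equiv_refl)
  show "sym (ext_rel Z Y)"
    by (rule symI) (use ext_equiv_sym[OF assms] in \<open>auto simp: ext_rel_def extensions_def\<close>)
  show "trans (ext_rel Z Y)"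
    by (rule transI) (auto simp: ext_rel_def intro: ext_equiv_trans)
qed

context dense_pair
begin

text \<open>The map of the theorem, stated for all sets of extensions so that it can be applied to a product of
  classes before that product is known to be a class.\<close>

definition extend_class ::
  "('y, 'y \<times> 'z, 'z) extension set \<Rightarrow> ('y, 'y \<times> 'w, 'w) extension set" where
  "extend_class D = {E \<in> extensions W Y. \<exists>E'\<in>D. \<exists>R. restriction_map Y j E' E R}"

lemma extend_class_Image:
  assumes E: "E \<in> extensions W Y" and E': "E' \<in> extensions Z Y" and R: "restriction_map Y j E' E R"
  shows "extend_class (ext_rel Z Y `` {E'}) = ext_rel W Y `` {E}"
proof (intro equalityI subsetI)
  fix F assume "F \<in> extend_class (ext_rel Z Y `` {E'})"
  then obtain F' S where F: "F \<in> extensions W Y" "F' \<in> extensions Z Y" "ext_equiv Z Y E' F'"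
    "restriction_map Y j F' F S" unfolding extend_class_def ext_rel_def by auto
  have i: "is_extension Z Y E'" "is_extension Z Y F'" "is_extension W Y E" "is_extension W Y F"
    using E E' F by (auto simp: extensions_def)
  have "ext_equiv Z Y F' E'" by (rule ext_equiv_sym[OF Z.pretvs_axioms Y.pretvs_axioms i(1,2) F(3)])
  then obtain T where "restriction_map Y j E' F T" using restriction_cong_left[OF i(2,1) _ F(4)] by metis
  then have "ext_equiv W Y E F" by (rule restriction_injective[OF i(1,3,4) R])
  then show "F \<in> ext_rel W Y `` {E}" using F(1) E by (simp add: ext_rel_def)
next
  fix F assume "F \<in> ext_rel W Y `` {E}"
  then have F: "F \<in> extensions W Y" "ext_equiv W Y E F" by (auto simp: ext_rel_def)
  obtain S where "restriction_map Y j E' F S" using restriction_cong_right[OF F(2) R] by metis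
  moreover have "E' \<in> ext_rel Z Y `` {E'}" using E' by (simp add: ext_rel_def ext_equiv_refl)
  ultimately show "F \<in> extend_class (ext_rel Z Y `` {E'})"
    using F(1) unfolding extend_class_def by auto
qed

lemma class_subset: "D \<in> extensions Z Y // ext_rel Z Y \<Longrightarrow> E \<in> D \<Longrightarrow> E \<in> extensions Z Y"
  by (auto simp: quotient_def ext_rel_def)

text \<open>
  For each inclusion, the extensions still missing on one side of \<open>j\<close> are supplied by
  \<open>extension_exists\<close> or \<open>restriction_exists\<close>; then the Baer map is carried across \<open>j\<close>.
\<close>

lemma extend_class_mult:
  assumes C: "C \<in> carrier (Ext_TVS Z Y)" and D: "D \<in> carrier (Ext_TVS Z Y)"
  shows "extend_class (C \<otimes>\<^bsub>Ext_TVS Z Y\<^esub> D) = extend_class C \<otimes>\<^bsub>Ext_TVS W Y\<^esub> extend_class D"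
proof (intro equalityI subsetI)
  have Cs: "\<And>E. E \<in> C \<Longrightarrow> is_extension Z Y E" and Ds: "\<And>E. E \<in> D \<Longrightarrow> is_extension Z Y E"
    using C D class_subset by (auto simp: Ext_TVS_def extensions_def)
  {
    fix E assume "E \<in> extend_class (C \<otimes>\<^bsub>Ext_TVS Z Y\<^esub> D)"
    then obtain E' R E1' E2' where E: "E \<in> extensions W Y" "restriction_map Y j E' E R"
      and E': "E' \<in> extensions Z Y" "E1' \<in> C" "E2' \<in> D" "ext_equiv Z Y (baer_ext Z Y E1' E2') E'"
      unfolding extend_class_def Ext_TVS_def by auto
    obtain E1 R1 where E1: "E1 \<in> extensions W Y" "restriction_map Y j E1' E1 R1"
      using extension_exists[OF Cs[OF E'(2)]] by metis
    obtain E2 R2 where E2: "E2 \<in> extensions W Y" "restriction_map Y j E2' E2 R2"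
      using extension_exists[OF Ds[OF E'(3)]] by metis
    have i: "is_extension Z Y E'" "is_extension W Y E" "is_extension W Y E1" "is_extension W Y E2"
      using E' E E1 E2 by (auto simp: extensions_def)
    have "restriction_pair Z Y W j E1' E1 R1 E2' E2 R2"
      using E1(2) E2(2) i Cs[OF E'(2)] Ds[OF E'(3)]
      by (intro restriction_pair.intro dense_pair_axioms restrictionI)
    then interpret P: restriction_pair Z Y W j E1' E1 R1 E2' E2 R2 .
    obtain S' where "baer_map Z Y E1' E2' E' S'"
      using E'(4) P.F'.ext_equiv_baer_iff[OF tvs_extensionI(1)[OF i(1)]] by metis
    then obtain S where "baer_map W Y E1 E2 E S"
      using P.baer_map_extend[OF i(2,1) E(2)] by metis
    then have "ext_equiv W Y (baer_ext W Y E1 E2) E"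
      using P.F.ext_equiv_baer_iff[OF tvs_extensionI(2)[OF i(2)]] by metis
    moreover have "E1 \<in> extend_class C" "E2 \<in> extend_class D"
      using E1 E2 E'(2,3) unfolding extend_class_def by auto
    ultimately show "E \<in> extend_class C \<otimes>\<^bsub>Ext_TVS W Y\<^esub> extend_class D"
      using E(1) unfolding Ext_TVS_def by auto
  }
  {
    fix E assume "E \<in> extend_class C \<otimes>\<^bsub>Ext_TVS W Y\<^esub> extend_class D"
    then obtain E1' E2' E1 E2 R1 R2 where E: "E \<in> extensions W Y" "ext_equiv W Y (baer_ext W Y E1 E2) E"
      and E1: "E1 \<in> extensions W Y" "E1' \<in> C" "restriction_map Y j E1' E1 R1"
      and E2: "E2 \<in> extensions W Y" "E2' \<in> D" "restriction_map Y j E2' E2 R2"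
      unfolding extend_class_def Ext_TVS_def by auto
    have i: "is_extension W Y E" "is_extension W Y E1" "is_extension W Y E2"
      using E E1 E2 by (auto simp: extensions_def)
    obtain E' R where E': "E' \<in> extensions Z Y" "restriction_map Y j E' E R"
      using restriction_exists[OF i(1)] by metis
    have iE': "is_extension Z Y E'" using E' by (simp add: extensions_def)
    have "restriction_pair Z Y W j E1' E1 R1 E2' E2 R2"
      using E1(3) E2(3) i Cs[OF E1(2)] Ds[OF E2(2)]
      by (intro restriction_pair.intro dense_pair_axioms restrictionI)
    then interpret P: restriction_pair Z Y W j E1' E1 R1 E2' E2 R2 .
    obtain S where "baer_map W Y E1 E2 E S"
      using E(2) P.F.ext_equiv_baer_iff[OF tvs_extensionI(2)[OF i(1)]] by metis
    then obtain S' where "baer_map Z Y E1' E2' E' S'"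
      using P.baer_map_restrict[OF i(1) iE' E'(2)] by metis
    then have "ext_equiv Z Y (baer_ext Z Y E1' E2') E'"
      using P.F'.ext_equiv_baer_iff[OF tvs_extensionI(1)[OF iE']] by metis
    then have "E' \<in> C \<otimes>\<^bsub>Ext_TVS Z Y\<^esub> D" using E'(1) E1(2) E2(2) unfolding Ext_TVS_def by auto
    then show "E \<in> extend_class (C \<otimes>\<^bsub>Ext_TVS Z Y\<^esub> D)"
      using E'(2) E(1) unfolding extend_class_def by auto
  }
qed

theorem extend_class_iso: "extend_class \<in> iso (Ext_TVS Z Y) (Ext_TVS W Y)"
proof -
  note eqZ = equiv_ext_rel[OF Z.pretvs_axioms Y.pretvs_axioms]
  have cW: "carrier (Ext_TVS W Y) = extensions W Y // ext_rel W Y"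
    and cZ: "carrier (Ext_TVS Z Y) = extensions Z Y // ext_rel Z Y" by (simp_all add: Ext_TVS_def)
  have closed: "extend_class D \<in> carrier (Ext_TVS W Y)" if D: "D \<in> carrier (Ext_TVS Z Y)" for D
  proof -
    obtain E' where E': "E' \<in> extensions Z Y" "D = ext_rel Z Y `` {E'}" using D unfolding cZ by (rule quotientE)
    have "is_extension Z Y E'" using E'(1) by (simp add: extensions_def)
    then obtain E R where "E \<in> extensions W Y" "restriction_map Y j E' E R"
      using extension_exists by metis
    then show ?thesis unfolding E'(2) cW using extend_class_Image[OF _ E'(1)] quotientI by metis
  qed
  have "extend_class ` carrier (Ext_TVS Z Y) = carrier (Ext_TVS W Y)"
  proof (intro equalityI subsetI)
    fix D assume "D \<in> carrier (Ext_TVS W Y)"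
    then obtain E where E: "E \<in> extensions W Y" "D = ext_rel W Y `` {E}" unfolding cW by (rule quotientE)
    have "is_extension W Y E" using E(1) by (simp add: extensions_def)
    then obtain E' R where E': "E' \<in> extensions Z Y" "restriction_map Y j E' E R"
      using restriction_exists by metis
    have "D = extend_class (ext_rel Z Y `` {E'})"
      using extend_class_Image[OF E(1) E'] E(2) by simp
    moreover have "ext_rel Z Y `` {E'} \<in> carrier (Ext_TVS Z Y)" unfolding cZ by (rule quotientI[OF E'(1)])
    ultimately show "D \<in> extend_class ` carrier (Ext_TVS Z Y)" by (rule image_eqI)
  qed (use closed in auto)
  moreover have "inj_on extend_class (carrier (Ext_TVS Z Y))"
  proof (rule inj_onI)
    fix D1 D2 assume D: "D1 \<in> carrier (Ext_TVS Z Y)" "D2 \<in> carrier (Ext_TVS Z Y)"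
      "extend_class D1 = extend_class D2"
    obtain E1 where E1: "E1 \<in> extensions Z Y" "D1 = ext_rel Z Y `` {E1}" using D(1) unfolding cZ by (rule quotientE)
    obtain E2 where E2: "E2 \<in> extensions Z Y" "D2 = ext_rel Z Y `` {E2}" using D(2) unfolding cZ by (rule quotientE)
    have i: "is_extension Z Y E1" using E1 by (simp add: extensions_def)
    obtain E R where E: "E \<in> extensions W Y" "restriction_map Y j E1 E R"
      using extension_exists[OF i] by metis
    have "E1 \<in> D1" using E1 by (simp add: ext_rel_def ext_equiv_refl)
    then have "E \<in> extend_class D1" using E unfolding extend_class_def by auto
    then have "E \<in> extend_class D2" by (simp only: D(3))
    then obtain F S where F: "F \<in> D2" "restriction_map Y j F E S" unfolding extend_class_def by auto
    have F2: "ext_equiv Z Y E2 F" "F \<in> extensions Z Y" using F(1) unfolding E2(2) ext_rel_def by auto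
    have "ext_equiv Z Y E1 F"
      using restriction_unique[OF _ i _ E(2) F(2)] E(1) F2(2) by (simp add: extensions_def)
    then have "(E1, F) \<in> ext_rel Z Y" "(E2, F) \<in> ext_rel Z Y" using F2 E1(1) E2(1) by (auto simp: ext_rel_def)
    then show "D1 = D2" unfolding E1(2) E2(2) using equiv_class_eq[OF eqZ] by metis
  qed
  ultimately show ?thesis
    unfolding iso_iff hom_def using closed extend_class_mult by auto
qed

end

theorem theorem11:
  fixes Y :: "'y tvs" and Z :: "'z tvs" and rhoZ :: "'w tvs" and j :: "'z \<Rightarrow> 'w"
  assumes "is_tvs Y" and "is_tvs Z"
    and "tvs_complete Y" and "metrizable_space (topo Y)"
    and "is_completion Z rhoZ j"
  shows "Ext_TVS Z Y \<cong> Ext_TVS rhoZ Y"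
proof -
  have "is_tvs rhoZ" "tvs_complete rhoZ" using assms(5) by (auto simp: is_completion_def)
  then interpret dense_pair Z Y rhoZ j
    using assms is_completion_embedding[OF assms(2,5)] by unfold_locales
  show ?thesis by (rule is_isoI[OF extend_class_iso])
qed

end
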